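(* Fix $(C,D,S)\in\mathcal{G}_{(-\infty,0)}$ satisfying the sharp condition. Let $\Omega$ be a domain in $\mathbb{C}^n$ with $n\ge2$, and let $\phi\in C^2(\Omega)$ be a real-valued function. 1. Assume that for every pseudoconvex subdomain $\tilde\Omega\subset\Omega$, the pair $(\tilde\Omega,\phi)$ has the sharp $L^2$-division property. Then $e^\phi$ is plurisubharmonic, i.e. $\sqrt{-1}\partial\bar\partial\phi+\sqrt{-1}\partial\phi\wedge\bar\partial\phi$ is positive semi-definite; in particular $\sqrt{-1}\partial\bar\partial\phi$ has at most one negative eigenvalue at each point. 2. Assume that for every pseudoconvex subdomain $\tilde\Omega\subset\Omega$ and every pluriharmonic function $\psi$ on $\Omega$, the pair $(\tilde\Omega,\phi+\psi)$ has the sharp $L^2$-division property. Then $\phi$ is plurisubharmonic. 3. Assume that for every pseudoconvex subdomain $\tilde\Omega\subset\Omega$ and every $\epsilon>0$, the pair $(\tilde\Omega,\epsilon\phi)$ has the sharp $L^2$-division property. Then $\phi$ is plurisubharmonic.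
   Context: **The class $\mathcal{G}_{(-\infty,0)}$.** It is the set of triples $(C,D,S)$ of positive smooth functions on $(-\infty,0)$ satisfying $\frac{d}{dt}S<0$, $\frac{d}{dt}D=-C$ and $\frac{d}{dt}(SD)=-D$. Such a triple satisfies the *sharp condition* if $$\int_0^1 r\,D(\log r^2)\,dr<+\infty\qquad\text{and}\qquad \lim_{r\to1^-}D(\log r^2)=0 .$$ **Sharp $L^2$-division property** (with respect to the fixed triple $(C,D,S)$). Let $\Omega$ be a domain in $\mathbb{C}^n$ ($n\ge2$) and $\phi$ a continuous function on $\Omega$. The pair $(\Omega,\phi)$ has the sharp $L^2$-division property if the following holds: whenever $f,g_1,\dots,g_n$ are holomorphic functions on $\Omega$ with $\log|g|<0$ on $\Omega$, $dg_1\wedge\dots\wedge dg_n\neq0$ everywhere on $\Omega$, and $$\int_\Omega\left(C(\log|g|^2)+(n-1)D(\log|g|^2)\right)|f|^2|g|^{-2n}e^{-\phi}\,d\lambda<+\infty,$$ there exist holomorphic functions $F_1,\dots,F_n$ on $\Omega$ such that $\sum_i g_iF_i=f$ and $$\int_\Omega C(\log|g|^2)|F|^2|g|^{-2(n-1)}e^{-\phi}\,d\lambda\le\int_\Omega\left(C(\log|g|^2)+(n-1)D(\log|g|^2)\right)|f|^2|g|^{-2n}e^{-\phi}\,d\lambda .$$ Here $|g|^2=\sum_i|g_i|^2$, $|F|^2=\sum_i|F_i|^2$ and $d\lambda$ is Lebesgue measure. *)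

theory Defs
  imports "HOL-Analysis.Analysis"
begin

text \<open>The space of n complex variables is \<open>complex ^ 'n\<close> with n = \<open>CARD('n)\<close>; its norm is the
  Hermitian norm and \<open>lborel\<close> is the Lebesgue measure of the underlying real space of dimension 2n.\<close>

subsection \<open>The class of triples and the sharp condition\<close>

text \<open>Infinite differentiability; only meant for open sets \<open>U\<close>.\<close>

definition smooth_real_on :: "real set \<Rightarrow> (real \<Rightarrow> real) \<Rightarrow> bool" where
  "smooth_real_on U f \<longleftrightarrow> (\<forall>k::nat. \<forall>t\<in>U. (deriv ^^ k) f field_differentiable (at t))"

definition G_class :: "((real \<Rightarrow> real) \<times> (real \<Rightarrow> real) \<times> (real \<Rightarrow> real)) set" where
  "G_class = {(C, D, S).
     smooth_real_on {..<0} C \<and> smooth_real_on {..<0} D \<and> smooth_real_on {..<0} S \<and>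
     (\<forall>t<0. C t > 0 \<and> D t > 0 \<and> S t > 0) \<and>
     (\<forall>t<0. deriv S t < 0) \<and>
     (\<forall>t<0. (D has_real_derivative - C t) (at t)) \<and>
     (\<forall>t<0. ((\<lambda>s. S s * D s) has_real_derivative - D t) (at t))}"

definition sharp_condition :: "(real \<Rightarrow> real) \<Rightarrow> bool" where
  "sharp_condition D \<longleftrightarrow>
     (\<integral>\<^sup>+r\<in>{0<..<1}. ennreal (r * D (ln (r\<^sup>2))) \<partial>lborel) < \<infinity> \<and>
     ((\<lambda>r. D (ln (r\<^sup>2))) \<longlongrightarrow> 0) (at_left 1)"

subsection \<open>Several complex variables\<close>

definition Cn_domain :: "(complex ^ 'n) set \<Rightarrow> bool" where
  "Cn_domain \<Omega> \<longleftrightarrow> open \<Omega> \<and> connected \<Omega> \<and> \<Omega> \<noteq> {}"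

definition holomorphic_Cn :: "(complex ^ 'n) set \<Rightarrow> (complex ^ 'n \<Rightarrow> complex) \<Rightarrow> bool" where
  "holomorphic_Cn \<Omega> f \<longleftrightarrow>
     (\<forall>z\<in>\<Omega>. \<exists>L. (f has_derivative L) (at z) \<and> (\<forall>c v. L (c *s v) = c * L v))"

text \<open>Wirtinger derivatives with respect to the j-th variable and its conjugate;
  \<open>axis j 1\<close> and \<open>axis j \<i>\<close> are the real coordinate directions of the j-th variable.\<close>

definition wirt :: "'n \<Rightarrow> (complex ^ 'n \<Rightarrow> complex) \<Rightarrow> complex ^ 'n \<Rightarrow> complex" where
  "wirt j u z =
     (frechet_derivative u (at z) (axis j 1) - \<i> * frechet_derivative u (at z) (axis j \<i>)) / 2"

definition wirt_bar :: "'n \<Rightarrow> (complex ^ 'n \<Rightarrow> complex) \<Rightarrow> complex ^ 'n \<Rightarrow> complex" where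
  "wirt_bar j u z =
     (frechet_derivative u (at z) (axis j 1) + \<i> * frechet_derivative u (at z) (axis j \<i>)) / 2"

text \<open>The holomorphic Jacobian determinant: the coefficient of the n-form obtained by wedging
  the differentials of the components of \<open>g\<close>.\<close>

definition jacobian_det :: "(complex ^ 'n \<Rightarrow> complex ^ 'n) \<Rightarrow> complex ^ 'n \<Rightarrow> complex" where
  "jacobian_det g z = det (\<chi> i j. wirt j (\<lambda>w. g w $ i) z)"

definition C2_on :: "(complex ^ 'n) set \<Rightarrow> (complex ^ 'n \<Rightarrow> real) \<Rightarrow> bool" where
  "C2_on \<Omega> u \<longleftrightarrow>
     (\<exists>(u' :: complex ^ 'n \<Rightarrow> (complex ^ 'n) \<Rightarrow>\<^sub>L real)
       (u'' :: complex ^ 'n \<Rightarrow> (complex ^ 'n) \<Rightarrow>\<^sub>L ((complex ^ 'n) \<Rightarrow>\<^sub>L real)).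
        (\<forall>z\<in>\<Omega>. (u has_derivative blinfun_apply (u' z)) (at z)) \<and>
        (\<forall>z\<in>\<Omega>. (u' has_derivative blinfun_apply (u'' z)) (at z)) \<and>
        continuous_on \<Omega> u'')"

text \<open>A real (1,1)-form \<open>\<i> * (\<Sum>j k. A $ j $ k * dz\<^sub>j \<and> dzbar\<^sub>k)\<close> is represented by its
  coefficient matrix \<open>A\<close>. For \<open>levi_matrix\<close> the form is i del delbar u; for \<open>grad_matrix\<close> it is
  the wedge product i (del u) (delbar u).\<close>

definition levi_matrix :: "(complex ^ 'n \<Rightarrow> real) \<Rightarrow> complex ^ 'n \<Rightarrow> complex ^ 'n ^ 'n" where
  "levi_matrix u z = (\<chi> j k. wirt j (wirt_bar k (\<lambda>w. complex_of_real (u w))) z)"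

definition grad_matrix :: "(complex ^ 'n \<Rightarrow> real) \<Rightarrow> complex ^ 'n \<Rightarrow> complex ^ 'n ^ 'n" where
  "grad_matrix u z =
     (\<chi> j k. wirt j (\<lambda>w. complex_of_real (u w)) z * wirt_bar k (\<lambda>w. complex_of_real (u w)) z)"

definition pos_semidef :: "complex ^ 'n ^ 'n \<Rightarrow> bool" where
  "pos_semidef A \<longleftrightarrow>
     (\<forall>j k. A $ j $ k = cnj (A $ k $ j)) \<and>
     (\<forall>v :: complex ^ 'n. 0 \<le> Re (\<Sum>j\<in>UNIV. \<Sum>k\<in>UNIV. A $ j $ k * v $ j * cnj (v $ k)))"

text \<open>Negative eigenvalues counted with multiplicity. The multiplicity is the complex dimension of
  the eigenspace; this is only used for Hermitian matrices, where it is also the algebraic one.\<close>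

definition neg_eigenvalue_count :: "complex ^ 'n ^ 'n \<Rightarrow> nat" where
  "neg_eigenvalue_count A =
     (\<Sum>l\<in>{l::real. l < 0 \<and> (\<exists>v. v \<noteq> 0 \<and> A *v v = complex_of_real l *s v)}.
        vec.dim {v. A *v v = complex_of_real l *s v})"

text \<open>Plurisubharmonicity of a real-valued function: upper semicontinuity and the submean value
  inequality on every closed affine disc in \<open>\<Omega>\<close>. An upper semicontinuous function is bounded above on
  the boundary circle, so, the central value being finite, the inequality for the extended integral
  entails integrability.\<close>

definition plurisubharmonic_on :: "(complex ^ 'n) set \<Rightarrow> (complex ^ 'n \<Rightarrow> real) \<Rightarrow> bool" where
  "plurisubharmonic_on \<Omega> u \<longleftrightarrow>
     (\<forall>z\<in>\<Omega>. \<forall>c>u z. \<forall>\<^sub>F w in at z within \<Omega>. u w < c) \<and>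
     (\<forall>z v. (\<forall>\<tau>. norm \<tau> \<le> 1 \<longrightarrow> z + \<tau> *s v \<in> \<Omega>) \<longrightarrow>
        (\<lambda>\<theta>. u (z + cis \<theta> *s v)) integrable_on {0..2*pi} \<and>
        u z \<le> (1 / (2*pi)) * integral {0..2*pi} (\<lambda>\<theta>. u (z + cis \<theta> *s v)))"

definition pluriharmonic_on :: "(complex ^ 'n) set \<Rightarrow> (complex ^ 'n \<Rightarrow> real) \<Rightarrow> bool" where
  "pluriharmonic_on \<Omega> u \<longleftrightarrow> C2_on \<Omega> u \<and> (\<forall>z\<in>\<Omega>. levi_matrix u z = 0)"

text \<open>Pseudoconvexity: existence of a continuous plurisubharmonic exhaustion function.\<close>

definition pseudoconvex :: "(complex ^ 'n) set \<Rightarrow> bool" where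
  "pseudoconvex \<Omega> \<longleftrightarrow>
     (\<exists>u. continuous_on \<Omega> u \<and> plurisubharmonic_on \<Omega> u \<and> (\<forall>c::real. compact {z\<in>\<Omega>. u z \<le> c}))"

definition pseudoconvex_subdomain :: "(complex ^ 'n) set \<Rightarrow> (complex ^ 'n) set \<Rightarrow> bool" where
  "pseudoconvex_subdomain \<Omega>' \<Omega> \<longleftrightarrow> Cn_domain \<Omega>' \<and> \<Omega>' \<subseteq> \<Omega> \<and> pseudoconvex \<Omega>'"

subsection \<open>The sharp \<open>L\<^sup>2\<close>-division property\<close>

text \<open>The hypothesis that \<open>log |g|\<close> is negative (with value \<open>-\<infinity>\<close> at zeros of \<open>g\<close>) is written
  \<open>norm (g z) < 1\<close>, because \<open>ln 0 = 0\<close> here. In both integrands the value at a zero of \<open>g\<close> is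
  immaterial: by the Jacobian condition these zeros are isolated. Elsewhere the integrands are
  nonnegative, so \<open>ennreal\<close> does not truncate.\<close>

definition sharp_L2_division ::
  "(real \<Rightarrow> real) \<Rightarrow> (real \<Rightarrow> real) \<Rightarrow> (complex ^ 'n) set \<Rightarrow> (complex ^ 'n \<Rightarrow> real) \<Rightarrow> bool" where
  "sharp_L2_division C D \<Omega> \<phi> \<longleftrightarrow>
     (\<forall>(f :: complex ^ 'n \<Rightarrow> complex) (g :: complex ^ 'n \<Rightarrow> complex ^ 'n).
        let n = CARD('n);
            I = (\<integral>\<^sup>+z\<in>\<Omega>. ennreal ((C (ln ((norm (g z))\<^sup>2)) + real (n - 1) * D (ln ((norm (g z))\<^sup>2)))
                   * (norm (f z))\<^sup>2 / norm (g z) ^ (2 * n) * exp (- \<phi> z)) \<partial>lborel)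
        in holomorphic_Cn \<Omega> f \<and> (\<forall>i. holomorphic_Cn \<Omega> (\<lambda>z. g z $ i)) \<and>
           (\<forall>z\<in>\<Omega>. norm (g z) < 1) \<and> (\<forall>z\<in>\<Omega>. jacobian_det g z \<noteq> 0) \<and> I < \<infinity>
           \<longrightarrow> (\<exists>F :: complex ^ 'n \<Rightarrow> complex ^ 'n.
                 (\<forall>i. holomorphic_Cn \<Omega> (\<lambda>z. F z $ i)) \<and>
                 (\<forall>z\<in>\<Omega>. (\<Sum>i\<in>UNIV. g z $ i * F z $ i) = f z) \<and>
                 (\<integral>\<^sup>+z\<in>\<Omega>. ennreal (C (ln ((norm (g z))\<^sup>2)) * (norm (F z))\<^sup>2
                    / norm (g z) ^ (2 * (n - 1)) * exp (- \<phi> z)) \<partial>lborel) \<le> I))"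

end

theory Submission
  imports Defs "HOL-Complex_Analysis.Cauchy_Integral_Formula"
begin

text \<open>All three parts follow from the claim that the hypothesis of part 1 already forces \<open>\<phi>\<close> to have a
  nonnegative Levi form; parts 2 and 3 reduce to it with \<open>\<psi> = 0\<close> and \<open>\<epsilon> = 1\<close>.

  Suppose the Levi form at \<open>z\<^sub>0\<close> has the value \<open>-\<kappa> < 0\<close> at a vector \<open>v\<close> with \<open>v\<^sub>k = 1\<close>. Use the division
  property on the small ellipsoid \<open>{|g| < 1}\<close>, where \<open>g\<close> is the inverse of the affine map
  \<open>w \<mapsto> z\<^sub>0 + s w\<^sub>k v + s\<^sup>2 T w\<close> and \<open>T\<close> drops the k-th coordinate, with \<open>f = g\<^sub>a exp h\<close>, \<open>a \<noteq> k\<close>. The holomorphic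
  polynomial \<open>h\<close> absorbs the pluriharmonic part of the second order Taylor polynomial of \<open>\<phi>\<close>, so
  the weight becomes \<open>1 + s\<^sup>2 (\<kappa> |w\<^sub>k|\<^sup>2 + o(1))\<close>, which is invariant under \<open>w \<mapsto> e\<^sup>i\<^sup>\<theta> w\<close> up to the error. A solution \<open>F\<close> has
  \<open>F\<^sub>a = exp h\<close> at the centre, hence averaging over the circle action bounds its norm from below by that of the
  constant solution. At order \<open>s\<^sup>0\<close> both sides of the estimate agree; at order \<open>s\<^sup>2\<close> integration by parts
  in the radial variable gives, with \<open>P = \<integral> D |w|\<^sup>-\<^sup>2\<^sup>(\<^sup>n\<^sup>-\<^sup>2\<^sup>)\<close> over the unit ball, \<open>2\<kappa>P/n\<close> on the left and at most
  \<open>(n+1)\<kappa>P/n\<^sup>2\<close> on the right, which is impossible for \<open>n \<ge> 2\<close>.\<close>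

subsection \<open>Linear changes of variables for Lebesgue measure\<close>

text \<open>For a constant weight on the unit ball, with g = w, f = w_a and the a-th unit vector as
  solution, the estimate is an equality: both sides are the integral of D(log |w|^2) |w|^(-2(n-1)).
  So there is no slack at order s^0, and order s^2 decides. The data integral sees |w_k|^2 only in
  the product |w_a|^2 |w_k|^2, whose mean is at most that of |w|^4/n^2, while on the other side
  |w_k|^2 alone has the mean of |w|^2/n. The resulting coefficients (n+1)/n^2 and 2/n are strictly
  ordered because 2n > n+1. Transversal directions are scaled by s^2 since uniform scaling would
  bring the Levi form in every direction into order s^2. The lower bound must hold for an unknown F,
  of which the division identity fixes a value at the centre; the circle action preserves the
  weights and turns that value into an integral bound. The Jacobian factor of the affine map occurs
  on both sides and cancels, so it is enough that it is positive and finite.\<close>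

text \<open>Both sides come from evaluating \<open>\<integral>\<integral> 1\<^sub>A(x) 1\<^sub>Q(y + x)\<close> with Fubini, \<open>Q\<close> being the unit cube.\<close>

lemma translation_invariant_measure_unique:
  fixes M :: "'a::euclidean_space measure"
  assumes sets_M: "sets M = sets borel" and fin: "sigma_finite_measure M"
    and inv: "\<And>a. distr M borel (\<lambda>x. x + a) = M"
  shows "M = density lborel (\<lambda>_. emeasure M (box 0 One))"
proof (rule measure_eqI)
  fix A assume "A \<in> sets M"
  then have A[measurable]: "A \<in> sets borel" by (simp add: sets_M)
  define Q :: "'a set" where "Q = box 0 One"
  have Q[measurable]: "Q \<in> sets borel" by (simp add: Q_def)
  have Q1: "emeasure lborel Q = 1"
    by (simp add: Q_def emeasure_lborel_box_eq)
  note [measurable_cong] = sets_M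
  interpret M: sigma_finite_measure M by (rule fin)
  interpret L: sigma_finite_measure "lborel :: 'a measure" by (rule sigma_finite_lborel)
  interpret P: pair_sigma_finite M "lborel :: 'a measure" ..
  have shiftM: "(\<integral>\<^sup>+x. h (x + a) \<partial>M) = (\<integral>\<^sup>+x. h x \<partial>M)" if [measurable]: "h \<in> borel_measurable borel" for h :: "'a \<Rightarrow> ennreal" and a
    by (subst (2) inv[of a, symmetric]) (simp add: nn_integral_distr)
  have shiftL: "(\<integral>\<^sup>+x. h (x + a) \<partial>lborel) = (\<integral>\<^sup>+x. h x \<partial>lborel)" if [measurable]: "h \<in> borel_measurable borel" for h :: "'a \<Rightarrow> ennreal" and a
    by (subst (2) lborel_distr_plus[of a, symmetric]) (simp add: nn_integral_distr add.commute)
  have flip: "(\<integral>\<^sup>+y. h (- y) \<partial>lborel) = (\<integral>\<^sup>+y. h y \<partial>lborel)" if [measurable]: "h \<in> borel_measurable borel" for h :: "'a \<Rightarrow> ennreal"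
    by (subst (2) lborel_affine[of "-1" 0])
      (simp_all add: nn_integral_density nn_integral_distr)
  have "emeasure M A = (\<integral>\<^sup>+x. indicator A x * (\<integral>\<^sup>+y. indicator Q y \<partial>lborel) \<partial>M)"
    using Q1 by (simp add: sets_M A)
  also have "\<dots> = (\<integral>\<^sup>+x. (\<integral>\<^sup>+y. indicator A x * indicator Q (y + x) \<partial>lborel) \<partial>M)"
    by (intro nn_integral_cong) (simp add: nn_integral_cmult shiftL del: nn_integral_indicator)
  also have "\<dots> = (\<integral>\<^sup>+y. (\<integral>\<^sup>+x. indicator A x * indicator Q (y + x) \<partial>M) \<partial>lborel)"
    by (rule P.Fubini'[symmetric]) measurable
  also have "\<dots> = (\<integral>\<^sup>+y. (\<integral>\<^sup>+x. indicator A (x - y) * indicator Q x \<partial>M) \<partial>lborel)"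
  proof (rule nn_integral_cong)
    fix y :: 'a
    show "(\<integral>\<^sup>+x. indicator A x * indicator Q (y + x) \<partial>M) = (\<integral>\<^sup>+x. indicator A (x - y) * indicator Q x \<partial>M)"
      using shiftM[of "\<lambda>x. indicator A (x - y) * indicator Q x" y] by (simp add: add.commute)
  qed
  also have "\<dots> = (\<integral>\<^sup>+x. (\<integral>\<^sup>+y. indicator A (x - y) * indicator Q x \<partial>lborel) \<partial>M)"
    by (rule P.Fubini') measurable
  also have "\<dots> = (\<integral>\<^sup>+x. emeasure lborel A * indicator Q x \<partial>M)"
  proof (rule nn_integral_cong)
    fix x :: 'a
    have "(\<integral>\<^sup>+y. indicator A (x - y) \<partial>lborel) = (\<integral>\<^sup>+y. indicator A (x + y) \<partial>lborel)"
      using flip[of "\<lambda>y. indicator A (x - y)"] by simp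
    also have "\<dots> = emeasure lborel A"
      using shiftL[of "indicator A" x] by (simp add: add.commute)
    finally show "(\<integral>\<^sup>+y. indicator A (x - y) * indicator Q x \<partial>lborel) = emeasure lborel A * indicator Q x"
      by (simp add: nn_integral_multc)
  qed
  also have "\<dots> = emeasure lborel A * emeasure M Q"
    by (simp add: nn_integral_cmult sets_M)
  finally show "emeasure M A = emeasure (density lborel (\<lambda>_. emeasure M (box 0 One))) A"
    by (simp add: emeasure_density_const Q_def mult.commute)
qed (simp add: sets_M)

text \<open>Since T x + a = T (x + T^-1 a), the image measure is again translation invariant, hence
  a multiple of Lebesgue measure. The factor is finite because preimages of bounded sets are
  bounded, and nonzero because the total mass is.\<close>

lemma distr_lborel_linear_bij:
  fixes T :: "'a::euclidean_space \<Rightarrow> 'a"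
  assumes T: "linear T" and bij: "bij T"
  obtains c :: ennreal where "0 < c" "c < \<infinity>" "distr lborel borel T = density lborel (\<lambda>_. c)"
proof -
  have [measurable]: "T \<in> borel_measurable borel"
    using T by (intro borel_measurable_continuous_onI linear_continuous_on)
      (simp add: linear_conv_bounded_linear)
  define M where "M = distr lborel borel T"
  define T' where "T' = inv T"
  have TT': "T (T' x) = x" "T' (T x) = x" for x
    using bij by (auto simp: T'_def bij_is_inj bij_is_surj surj_f_inv_f)
  have lT': "linear T'"
  proof (rule linearI)
    show "T' (x + y) = T' x + T' y" for x y
      using TT'(2)[of "T' x + T' y"] by (simp add: linear_add[OF T] TT'(1))
    show "T' (r *\<^sub>R x) = r *\<^sub>R T' x" for r x
      using TT'(2)[of "r *\<^sub>R T' x"] by (simp add: linear_scale[OF T] TT'(1))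
  qed
  have inv: "distr M borel (\<lambda>x. x + a) = M" for a
  proof -
    have "distr M borel (\<lambda>x. x + a) = distr lborel borel (\<lambda>x. T x + a)"
      unfolding M_def by (subst distr_distr) (auto simp: o_def)
    also have "(\<lambda>x. T x + a) = T \<circ> (\<lambda>x. T' a + x)"
      using T by (auto simp: fun_eq_iff linear_add TT' add.commute)
    also have "distr lborel borel \<dots> = distr (distr lborel borel (\<lambda>x. T' a + x)) borel T"
      by (subst distr_distr) auto
    finally show ?thesis by (simp add: lborel_distr_plus M_def)
  qed
  have img: "T -` B = T' ` B" for B
    by (auto simp: TT' image_iff) (metis TT'(2))
  have bddfin: "emeasure M B < \<infinity>" if "bounded B" "B \<in> sets borel" for B
  proof -
    have "bounded (T' ` B)"
      using that lT' bounded_linear_image linear_conv_bounded_linear by blast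
    then obtain r where r: "T' ` B \<subseteq> cball 0 r" using bounded_subset_ballD[of "T' ` B" 0] ball_subset_cball by blast
    have "emeasure lborel (T' ` B) \<le> emeasure lborel (cball (0::'a) r)"
      by (rule emeasure_mono[OF r]) simp
    also have "\<dots> < \<infinity>" by (rule emeasure_lborel_cball_finite)
    finally show ?thesis using that by (simp add: M_def emeasure_distr img)
  qed
  have "sigma_finite_measure M"
  proof
    show "\<exists>A. countable A \<and> A \<subseteq> sets M \<and> \<Union> A = space M \<and> (\<forall>a\<in>A. emeasure M a \<noteq> \<infinity>)"
    proof (intro exI conjI ballI)
      show "countable (range (\<lambda>n::nat. cball (0::'a) (real n)))" by simp
      show "\<Union> (range (\<lambda>n::nat. cball (0::'a) (real n))) = space M"
        by (auto simp: M_def real_arch_simple)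
      show "range (\<lambda>n::nat. cball (0::'a) (real n)) \<subseteq> sets M" by (auto simp: M_def)
    next
      fix B assume "B \<in> range (\<lambda>n::nat. cball (0::'a) (real n))"
      then show "emeasure M B \<noteq> \<infinity>" using bddfin[of B] by fastforce
    qed
  qed
  then have *: "M = density lborel (\<lambda>_. emeasure M (box 0 One))"
    by (intro translation_invariant_measure_unique inv) (simp add: M_def)
  have "emeasure M (box 0 One) \<noteq> 0"
  proof
    assume "emeasure M (box 0 One) = 0"
    then have "emeasure M UNIV = 0" by (subst *) (simp add: emeasure_density)
    then show False by (simp add: M_def emeasure_distr)
  qed
  then show thesis
    using * bddfin[of "box 0 One"] by (intro that[of "emeasure M (box 0 One)"]) (auto simp: M_def zero_less_iff_neq_zero)
qed

lemma nn_integral_lborel_linear_bij: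
  fixes T :: "'a::euclidean_space \<Rightarrow> 'a"
  assumes T: "linear T" and bij: "bij T"
  obtains c :: ennreal where "0 < c" "c < \<infinity>"
    "\<And>h. h \<in> borel_measurable borel \<Longrightarrow> (\<integral>\<^sup>+x. h (T x) \<partial>lborel) = c * (\<integral>\<^sup>+x. h x \<partial>lborel)"
proof -
  obtain c where c: "0 < c" "c < \<infinity>" "distr lborel borel T = density lborel (\<lambda>_. c)"
    using distr_lborel_linear_bij[OF assms] by blast
  have [measurable]: "T \<in> borel_measurable borel"
    using T by (intro borel_measurable_continuous_onI linear_continuous_on)
      (simp add: linear_conv_bounded_linear)
  have "(\<integral>\<^sup>+x. h (T x) \<partial>lborel) = c * (\<integral>\<^sup>+x. h x \<partial>lborel)" if [measurable]: "h \<in> borel_measurable borel" for h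
  proof -
    have "(\<integral>\<^sup>+x. h (T x) \<partial>lborel) = (\<integral>\<^sup>+x. h x \<partial>distr lborel borel T)"
      by (simp add: nn_integral_distr)
    then show ?thesis by (simp add: c(3) nn_integral_density nn_integral_cmult)
  qed
  with c show thesis by (rule_tac that)
qed

text \<open>The closed unit ball has positive finite measure and equals its own preimage, which
  forces the factor to be 1.\<close>

lemma nn_integral_lborel_isometry:
  fixes T :: "'a::euclidean_space \<Rightarrow> 'a"
  assumes T: "linear T" and iso: "\<And>x. norm (T x) = norm x" and h: "h \<in> borel_measurable borel"
  shows "(\<integral>\<^sup>+x. h (T x) \<partial>lborel) = (\<integral>\<^sup>+x. h x \<partial>lborel)"
proof -
  have "inj T" by (metis T iso norm_eq_zero linear_injective_0)
  then have "bij T" using T linear_injective_imp_surjective by (auto simp: bij_def)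
  then obtain c where c: "0 < c" "c < \<infinity>"
    "\<And>h. h \<in> borel_measurable borel \<Longrightarrow> (\<integral>\<^sup>+x. h (T x) \<partial>lborel) = c * (\<integral>\<^sup>+x. h x \<partial>lborel)"
    using nn_integral_lborel_linear_bij[OF T] by blast
  define m where "m = emeasure lborel (cball (0::'a) 1)"
  have "m = (\<integral>\<^sup>+x. indicator (cball 0 1) (T x) \<partial>lborel)"
    by (simp add: iso m_def indicator_def flip: nn_integral_indicator)
  also have "\<dots> = c * m" unfolding m_def by (subst c(3)) (auto intro!: borel_measurable_indicator)
  finally have "m = c * m" .
  moreover have "m < \<infinity>" unfolding m_def by (rule emeasure_lborel_cball_finite)
  moreover have "m \<noteq> 0"
  proof
    assume "m = 0"
    then have "emeasure lborel (ball (0::'a) 1) = 0"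
      unfolding m_def by (metis ball_subset_cball emeasure_mono le_zero_eq sets.sets_into_space borel_closed closed_cball sets_lborel)
    then show False
      using open_not_negligible[of "ball (0::'a) 1"] by (simp add: negligible_iff_null_sets null_sets_def)
  qed
  ultimately have "c = 1"
    using ennreal_mult_cancel_left[of m 1 c] by (auto simp: mult.commute)
  then show ?thesis using c(3)[OF h] by simp
qed

subsection \<open>Radial integrals and the moments of the weights\<close>

text \<open>Polar coordinates from ball volumes: the image under the norm of the measure on the unit
  ball and the density n V r^(n-1) both give the half-line above x the mass V - V x^n for 0 \<le> x
  < 1. The cut-off to the unit ball keeps these masses finite, as
  \<open>measure_eqI_lessThan\<close> requires.\<close>

lemma nn_integral_lborel_radial:
  fixes H :: "real \<Rightarrow> ennreal"
  assumes [measurable]: "H \<in> borel_measurable borel"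
  shows "(\<integral>\<^sup>+x. H (norm (x::'a::euclidean_space)) * indicator (ball 0 1) x \<partial>lborel)
    = (\<integral>\<^sup>+r\<in>{0<..<1}. H r * ennreal (DIM('a) * unit_ball_vol DIM('a) * r ^ (DIM('a) - 1)) \<partial>lborel)"
proof -
  define n where "n = DIM('a)"
  define V where "V = unit_ball_vol n"
  have n: "n > 0" by (simp add: n_def)
  have V: "V \<ge> 0" by (simp add: V_def)
  define M1 where "M1 = distr (density lborel (indicator (ball (0::'a) 1))) borel norm"
  define M2 where "M2 = density lborel (\<lambda>r. ennreal (n * V * r ^ (n - 1)) * indicator {0<..<1} r)"
  have M1_eq: "emeasure M1 {x<..} = emeasure lborel ({y::'a. x < norm y} \<inter> ball 0 1)" for x
  proof -
    have [measurable]: "{y::'a. x < norm y} \<in> sets borel"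
      by (intro borel_open open_Collect_less continuous_intros)
    have "emeasure M1 {x<..} = emeasure (density lborel (indicator (ball (0::'a) 1))) {y. x < norm y}"
      by (simp add: M1_def emeasure_distr vimage_def)
    also have "\<dots> = (\<integral>\<^sup>+y. indicator ({y. x < norm y} \<inter> ball 0 1) (y::'a) \<partial>lborel)"
      by (subst emeasure_density)
        (auto intro!: nn_integral_cong borel_measurable_indicator simp: indicator_inter_arith mult.commute simp del: nn_integral_indicator)
    also have "\<dots> = emeasure lborel ({y::'a. x < norm y} \<inter> ball 0 1)"
      by (rule nn_integral_indicator) auto
    finally show ?thesis .
  qed
  have M1: "emeasure M1 {x<..} = ennreal (V - V * max 0 x ^ n)" if "x < 1" for x
  proof -
    have "emeasure M1 {x<..} = emeasure lborel ({y::'a. x < norm y} \<inter> ball 0 1)"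
      by (rule M1_eq)
    also have "\<dots> = ennreal (V - V * max 0 x ^ n)"
    proof (cases "x < 0")
      case True
      then have "{y::'a. x < norm y} \<inter> ball 0 1 = ball 0 1"
        by (auto intro: less_le_trans)
      then show ?thesis using True n by (simp add: emeasure_ball V_def n_def zero_power)
    next
      case False
      have "{y::'a. x < norm y} \<inter> ball 0 1 = ball 0 1 - cball 0 x" by auto
      moreover have "emeasure lborel (ball 0 1 - cball (0::'a) x) = emeasure lborel (ball (0::'a) 1) - emeasure lborel (cball (0::'a) x)"
        using that False by (intro emeasure_Diff) (auto simp: emeasure_cball)
      ultimately show ?thesis using False V
        by (simp add: emeasure_ball emeasure_cball V_def n_def ennreal_minus)
    qed
    finally show ?thesis .
  qed
  have M2: "emeasure M2 {x<..} = ennreal (V - V * max 0 x ^ n)" if "x < 1" for x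
  proof -
    have "emeasure M2 {x<..} = (\<integral>\<^sup>+r. ennreal (n * V * r ^ (n - 1)) * indicator {0<..<1} r * indicator {x<..} r \<partial>lborel)"
      by (simp add: M2_def emeasure_density)
    also have "\<dots> = (\<integral>\<^sup>+r. ennreal (n * V * r ^ (n - 1)) * indicator {max 0 x..1} r \<partial>lborel)"
    proof (rule nn_integral_cong_AE)
      show "AE r in lborel. ennreal (n * V * r ^ (n - 1)) * indicator {0<..<1} r * indicator {x<..} r
          = ennreal (n * V * r ^ (n - 1)) * indicator {max 0 x..1} r"
        using AE_lborel_singleton[of "0::real"] AE_lborel_singleton[of "1::real"] AE_lborel_singleton[of x]
        by eventually_elim (auto simp: indicator_def)
    qed
    also have "\<dots> = ennreal (V * 1 ^ n - V * max 0 x ^ n)"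
    proof (rule nn_integral_FTC_Icc[where F = "\<lambda>r. V * r ^ n"])
      show "((\<lambda>r. V * r ^ n) has_real_derivative real n * V * r ^ (n - 1)) (at r)" for r
        by (auto intro!: derivative_eq_intros)
    qed (use that V in auto)
    finally show ?thesis by simp
  qed
  have "M1 = M2"
  proof (rule measure_eqI_lessThan)
    have fin: "emeasure M1 {x<..} < \<infinity> \<and> emeasure M1 {x<..} = emeasure M2 {x<..}" for x
    proof (cases "x < 1")
      case True
      then show ?thesis using M1 M2 by simp
    next
      case False
      have "emeasure M1 {x<..} = 0"
      proof -
        have "emeasure M1 {x<..} = emeasure lborel ({y::'a. x < norm y} \<inter> ball 0 1)"
          by (rule M1_eq)
        also have "{y::'a. x < norm y} \<inter> ball 0 1 = {}" using False by auto
        finally show ?thesis by simp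
      qed
      moreover have "emeasure M2 {x<..} = 0"
      proof -
        have "emeasure M2 {x<..} = (\<integral>\<^sup>+r. ennreal (n * V * r ^ (n - 1)) * indicator {0<..<1} r * indicator {x<..} r \<partial>lborel)"
          by (simp add: M2_def emeasure_density)
        also have "\<dots> = (\<integral>\<^sup>+r. 0 \<partial>(lborel :: real measure))"
          by (rule nn_integral_cong) (use False in \<open>auto simp: indicator_def\<close>)
        finally show ?thesis by simp
      qed
      ultimately show ?thesis by simp
    qed
    show "emeasure M1 {x<..} < \<infinity>" for x by (rule fin[THEN conjunct1])
    show "emeasure M1 {x<..} = emeasure M2 {x<..}" for x by (rule fin[THEN conjunct2])
  qed (simp_all add: M1_def M2_def)
  then have "(\<integral>\<^sup>+r. H r \<partial>M1) = (\<integral>\<^sup>+r. H r \<partial>M2)" by simp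
  moreover have "(\<integral>\<^sup>+r. H r \<partial>M1) = (\<integral>\<^sup>+x. H (norm (x::'a)) * indicator (ball 0 1) x \<partial>lborel)"
    unfolding M1_def
    by (subst nn_integral_distr, measurable, subst nn_integral_density)
      (auto intro!: borel_measurable_indicator simp: mult.commute)
  ultimately show ?thesis
    by (simp add: M2_def nn_integral_density ac_simps n_def V_def)
qed

text \<open>The antiderivative enters at the endpoints through its limits only; at radius 1 a limit
  is all that is known about D(log r^2).\<close>

lemma nn_integral_FTC_Ioo_nonneg:
  fixes F f :: "real \<Rightarrow> real"
  assumes ab: "a < b"
    and F: "\<And>x. a < x \<Longrightarrow> x < b \<Longrightarrow> (F has_real_derivative f x) (at x)"
    and f: "\<And>x. a < x \<Longrightarrow> x < b \<Longrightarrow> isCont f x"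
    and nn: "\<And>x. a < x \<Longrightarrow> x < b \<Longrightarrow> 0 \<le> f x"
    and A: "(F \<longlongrightarrow> A) (at_right a)" and B: "(F \<longlongrightarrow> B) (at_left b)"
  shows "(\<integral>\<^sup>+x\<in>{a<..<b}. ennreal (f x) \<partial>lborel) = ennreal (B - A)"
proof -
  have 1: "((F \<circ> real_of_ereal) \<longlongrightarrow> A) (at_right (ereal a))" "((F \<circ> real_of_ereal) \<longlongrightarrow> B) (at_left (ereal b))"
    using A B by (simp_all add: ereal_tendsto_simps)
  have "set_integrable lborel (einterval (ereal a) (ereal b)) f"
    by (rule interval_integral_FTC_nonneg[where F = F, OF _ _ _ _ 1]) (use ab F f nn in auto)
  then have int: "set_integrable lborel {a<..<b} f" by simp
  have "(LBINT x=ereal a..ereal b. f x) = B - A"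
    by (rule interval_integral_FTC_nonneg[where F = F, OF _ _ _ _ 1]) (use ab F f nn in auto)
  then have "(\<integral>x. indicator {a<..<b} x *\<^sub>R f x \<partial>lborel) = B - A"
    using ab by (simp add: interval_lebesgue_integral_def set_lebesgue_integral_def)
  moreover have "(\<integral>\<^sup>+x. ennreal (indicator {a<..<b} x *\<^sub>R f x) \<partial>lborel) = ennreal (\<integral>x. indicator {a<..<b} x *\<^sub>R f x \<partial>lborel)"
    using int nn by (intro nn_integral_eq_integral) (auto simp: set_integrable_def indicator_def)
  moreover have "(\<integral>\<^sup>+x. ennreal (indicator {a<..<b} x *\<^sub>R f x) \<partial>lborel) = (\<integral>\<^sup>+x\<in>{a<..<b}. ennreal (f x) \<partial>lborel)"
    by (intro nn_integral_cong) (auto simp: indicator_def)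
  ultimately show ?thesis by simp
qed

section \<open>Radial weights and integration by parts in the radius\<close>

locale weight_pair =
  fixes C D :: "real \<Rightarrow> real"
  assumes C_cont: "continuous_on {..<0} C"
    and D_deriv: "\<And>t. t < 0 \<Longrightarrow> (D has_real_derivative - C t) (at t)"
    and C_pos: "\<And>t. t < 0 \<Longrightarrow> 0 < C t" and D_pos: "\<And>t. t < 0 \<Longrightarrow> 0 < D t"
    and D_lim: "((\<lambda>r. D (ln (r\<^sup>2))) \<longlongrightarrow> 0) (at_left 1)"
    and D_fin: "(\<integral>\<^sup>+r\<in>{0<..<1}. ennreal (r * D (ln (r\<^sup>2))) \<partial>lborel) < \<infinity>"
begin

text \<open>\<open>C\<close> and \<open>D\<close> are arbitrary, possibly non-measurable, outside the negative half-line; hence the cut-off.\<close>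

definition Cr :: "real \<Rightarrow> real" where "Cr r = (if 0 < r \<and> r < 1 then C (ln (r\<^sup>2)) else 0)"
definition Dr :: "real \<Rightarrow> real" where "Dr r = (if 0 < r \<and> r < 1 then D (ln (r\<^sup>2)) else 0)"

lemma ln_sq_neg: "0 < r \<Longrightarrow> r < 1 \<Longrightarrow> ln (r\<^sup>2) < (0::real)"
  by (simp add: ln_realpow)

lemma Cr_nonneg: "0 \<le> Cr r" and Dr_nonneg: "0 \<le> Dr r"
  using C_pos D_pos ln_sq_neg by (auto simp: Cr_def Dr_def less_imp_le)

lemma D_cont: "continuous_on {..<0} D"
  by (intro continuous_at_imp_continuous_on ballI)
    (auto intro: DERIV_isCont D_deriv)

lemma Cr_measurable[measurable]: "Cr \<in> borel_measurable borel"
  and Dr_measurable[measurable]: "Dr \<in> borel_measurable borel"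
proof -
  have "(\<lambda>r. if r \<in> {0<..<1} then f (ln (r\<^sup>2)) else 0) \<in> borel_measurable borel"
    if "continuous_on {..<0} f" for f :: "real \<Rightarrow> real"
    by (rule borel_measurable_continuous_on_if)
      (auto intro!: continuous_intros continuous_on_compose2[OF that] simp: abs_square_less_1)
  from this[OF C_cont] this[OF D_cont] show "Cr \<in> borel_measurable borel" "Dr \<in> borel_measurable borel"
    unfolding Cr_def[abs_def] Dr_def[abs_def] by simp_all
qed

text \<open>The derivative of -D(log r^2) is C(log r^2) 2/r, and the sharp condition makes the
  boundary term at radius 1 vanish. In this form integration by parts becomes an exchange of
  integrals.\<close>

lemma Dr_eq_integral:
  assumes r: "0 < r" "r < 1"
  shows "ennreal (Dr r) = (\<integral>\<^sup>+\<rho>\<in>{r<..<1}. ennreal (Cr \<rho> * (2 / \<rho>)) \<partial>lborel)"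
proof -
  have "(\<integral>\<^sup>+\<rho>\<in>{r<..<1}. ennreal (C (ln (\<rho>\<^sup>2)) * (2 / \<rho>)) \<partial>lborel) = ennreal (0 - - D (ln (r\<^sup>2)))"
  proof (rule nn_integral_FTC_Ioo_nonneg[OF r(2)])
    show "((\<lambda>\<rho>. - D (ln (\<rho>\<^sup>2))) has_real_derivative C (ln (x\<^sup>2)) * (2 / x)) (at x)" if "r < x" "x < 1" for x
    proof -
      have "((\<lambda>\<rho>. ln (\<rho>\<^sup>2)) has_real_derivative 2 / x) (at x)"
        using r that by (auto intro!: derivative_eq_intros simp: power2_eq_square field_simps)
      from DERIV_chain2[OF D_deriv this] show ?thesis
        using r that ln_sq_neg[of x] by (auto intro!: derivative_eq_intros)
    qed
    show "isCont (\<lambda>x. C (ln (x\<^sup>2)) * (2 / x)) x" if "r < x" "x < 1" for x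
    proof -
      have "isCont C (ln (x\<^sup>2))" using C_cont ln_sq_neg[of x] r that
        by (simp add: continuous_on_eq_continuous_at)
      then have "isCont (\<lambda>x. C (ln (x\<^sup>2))) x"
        by (rule isCont_o2[rotated]) (use r that in \<open>auto intro!: continuous_intros\<close>)
      then show ?thesis using r that by (auto intro!: continuous_intros)
    qed
    show "0 \<le> C (ln (x\<^sup>2)) * (2 / x)" if "r < x" "x < 1" for x
      using r that C_pos[of "ln (x\<^sup>2)"] ln_sq_neg[of x] by (simp add: less_imp_le)
    have "isCont D (ln (r\<^sup>2))" using D_deriv r ln_sq_neg by (blast intro: DERIV_isCont)
    then have "isCont (\<lambda>x. D (ln (x\<^sup>2))) r"
      by (rule isCont_o2[rotated]) (use r in \<open>auto intro!: continuous_intros\<close>)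
    then have "isCont (\<lambda>x. - D (ln (x\<^sup>2))) r" by (rule continuous_minus)
    then show "((\<lambda>x. - D (ln (x\<^sup>2))) \<longlongrightarrow> - D (ln (r\<^sup>2))) (at_right r)"
      by (simp add: isCont_def filterlim_at_split)
    show "((\<lambda>x. - D (ln (x\<^sup>2))) \<longlongrightarrow> 0) (at_left 1)"
      using tendsto_minus[OF D_lim] by simp
  qed
  also have "(\<integral>\<^sup>+\<rho>\<in>{r<..<1}. ennreal (C (ln (\<rho>\<^sup>2)) * (2 / \<rho>)) \<partial>lborel) = (\<integral>\<^sup>+\<rho>\<in>{r<..<1}. ennreal (Cr \<rho> * (2 / \<rho>)) \<partial>lborel)"
    using r by (intro nn_integral_cong) (auto simp: indicator_def Cr_def)
  finally show ?thesis using r by (simp add: Dr_def)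
qed

text \<open>Integration by parts as Fubini on the triangle r < \<rho>: after inserting
  \<open>Dr_eq_integral\<close>, the inner integral of 2 r^(2k-1)/\<rho> over 0 < r < \<rho> is
  \<rho>^(2k-1)/k. All integrands are nonnegative, so the identity holds in [0,\<infinity>] and no
  boundary term at radius 0 has to be discussed.\<close>

lemma Cr_moment_eq:
  assumes k: "k > 0"
  shows "(\<integral>\<^sup>+r\<in>{0<..<1}. ennreal (Cr r * r ^ (2*k - 1)) \<partial>lborel)
    = of_nat k * (\<integral>\<^sup>+r\<in>{0<..<1}. ennreal (Dr r * r ^ (2*k - 1)) \<partial>lborel)"
proof -
  have inner: "(\<integral>\<^sup>+r. ennreal (Cr \<rho> * (2 / \<rho>) * r ^ (2*k - 1)) * indicator {0<..<1} r * indicator {r<..<1} \<rho> \<partial>lborel)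
      = ennreal (Cr \<rho> * \<rho> ^ (2*k - 1) / k) * indicator {0<..<1} \<rho>" for \<rho>
  proof (cases "0 < \<rho> \<and> \<rho> < 1")
    case True
    have "(\<integral>\<^sup>+r. ennreal (Cr \<rho> * (2 / \<rho>) * r ^ (2*k - 1)) * indicator {0<..<1} r * indicator {r<..<1} \<rho> \<partial>lborel)
      = (\<integral>\<^sup>+r. ennreal (Cr \<rho> * (2 / \<rho>) * r ^ (2*k - 1)) * indicator {0..\<rho>} r \<partial>lborel)"
    proof (rule nn_integral_cong_AE)
      show "AE r in lborel. ennreal (Cr \<rho> * (2 / \<rho>) * r ^ (2*k - 1)) * indicator {0<..<1} r * indicator {r<..<1} \<rho>
          = ennreal (Cr \<rho> * (2 / \<rho>) * r ^ (2*k - 1)) * indicator {0..\<rho>} r"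
        using AE_lborel_singleton[of "0::real"] AE_lborel_singleton[of \<rho>]
        by eventually_elim (use True in \<open>auto simp: indicator_def\<close>)
    qed
    also have "\<dots> = ennreal (Cr \<rho> / (k * \<rho>) * \<rho> ^ (2*k) - Cr \<rho> / (k * \<rho>) * 0 ^ (2*k))"
    proof (rule nn_integral_FTC_Icc[where F = "\<lambda>r. Cr \<rho> / (k * \<rho>) * r ^ (2*k)"])
      show "((\<lambda>r. Cr \<rho> / (k * \<rho>) * r ^ (2*k)) has_real_derivative Cr \<rho> * (2 / \<rho>) * r ^ (2*k - 1)) (at r)" for r
        using k True by (auto intro!: derivative_eq_intros simp: field_simps)
    qed (use True Cr_nonneg in auto)
    also have "Cr \<rho> / (k * \<rho>) * \<rho> ^ (2*k) - Cr \<rho> / (k * \<rho>) * 0 ^ (2*k) = Cr \<rho> * \<rho> ^ (2*k - 1) / k"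
      using k True by (simp add: power_eq_if)
    finally show ?thesis using True by simp
  next
    case False
    then have "(\<integral>\<^sup>+r. ennreal (Cr \<rho> * (2 / \<rho>) * r ^ (2*k - 1)) * indicator {0<..<1} r * indicator {r<..<1} \<rho> \<partial>lborel) = (\<integral>\<^sup>+r. 0 \<partial>(lborel :: real measure))"
      by (intro nn_integral_cong) (auto simp: indicator_def)
    then show ?thesis using False by (auto simp: indicator_def)
  qed
  have "(\<integral>\<^sup>+r\<in>{0<..<1}. ennreal (Dr r * r ^ (2*k - 1)) \<partial>lborel)
    = (\<integral>\<^sup>+r. (\<integral>\<^sup>+\<rho>. ennreal (Cr \<rho> * (2 / \<rho>) * r ^ (2*k - 1)) * indicator {0<..<1} r * indicator {r<..<1} \<rho> \<partial>lborel) \<partial>lborel)"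
  proof (rule nn_integral_cong)
    fix r :: real
    show "ennreal (Dr r * r ^ (2*k - 1)) * indicator {0<..<1} r
       = (\<integral>\<^sup>+\<rho>. ennreal (Cr \<rho> * (2 / \<rho>) * r ^ (2*k - 1)) * indicator {0<..<1} r * indicator {r<..<1} \<rho> \<partial>lborel)"
    proof (cases "0 < r \<and> r < 1")
      case True
      have "ennreal (Dr r * r ^ (2*k - 1)) = ennreal (r ^ (2*k - 1)) * (\<integral>\<^sup>+\<rho>\<in>{r<..<1}. ennreal (Cr \<rho> * (2 / \<rho>)) \<partial>lborel)"
        by (subst Dr_eq_integral[symmetric]) (use True Dr_nonneg in \<open>simp_all add: ennreal_mult mult.commute\<close>)
      also have "\<dots> = (\<integral>\<^sup>+\<rho>. ennreal (r ^ (2*k - 1)) * (ennreal (Cr \<rho> * (2 / \<rho>)) * indicator {r<..<1} \<rho>) \<partial>lborel)"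
        by (subst nn_integral_cmult) auto
      also have "\<dots> = (\<integral>\<^sup>+\<rho>. ennreal (Cr \<rho> * (2 / \<rho>) * r ^ (2*k - 1)) * indicator {r<..<1} \<rho> \<partial>lborel)"
        using True Cr_nonneg
        by (intro nn_integral_cong) (auto simp: indicator_def ennreal_mult'[symmetric] mult.commute)
      finally show ?thesis using True by simp
    qed auto
  qed
  also have "\<dots> = (\<integral>\<^sup>+\<rho>. (\<integral>\<^sup>+r. ennreal (Cr \<rho> * (2 / \<rho>) * r ^ (2*k - 1)) * indicator {0<..<1} r * indicator {r<..<1} \<rho> \<partial>lborel) \<partial>lborel)"
  proof (rule lborel_pair.Fubini')
    \<comment> \<open>The set in the last indicator moves with r, so joint measurability is proved
      for the equivalent condition on the pair.\<close>
    have "(\<lambda>(\<rho>, r). ennreal (Cr \<rho> * (2 / \<rho>) * r ^ (2*k - 1)) * indicator {0<..<1} r * indicator {r<..<1} \<rho>)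
      = (\<lambda>x. ennreal (Cr (fst x) * (2 / fst x) * snd x ^ (2*k - 1))
           * (if 0 < snd x \<and> snd x < 1 \<and> snd x < fst x \<and> fst x < 1 then 1 else 0))"
      by (auto simp: fun_eq_iff indicator_def)
    also have "\<dots> \<in> borel_measurable (lborel \<Otimes>\<^sub>M lborel)" by measurable
    finally show "(\<lambda>(\<rho>, r). ennreal (Cr \<rho> * (2 / \<rho>) * r ^ (2*k - 1)) * indicator {0<..<1} r * indicator {r<..<1} \<rho>)
      \<in> borel_measurable (lborel \<Otimes>\<^sub>M lborel)" .
  qed
  also have "\<dots> = (\<integral>\<^sup>+\<rho>. ennreal (1 / k) * (ennreal (Cr \<rho> * \<rho> ^ (2*k - 1)) * indicator {0<..<1} \<rho>) \<partial>lborel)"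
    unfolding inner using Cr_nonneg
    by (intro nn_integral_cong) (auto simp: indicator_def ennreal_mult'[symmetric])
  also have "\<dots> = ennreal (1 / k) * (\<integral>\<^sup>+\<rho>\<in>{0<..<1}. ennreal (Cr \<rho> * \<rho> ^ (2*k - 1)) \<partial>lborel)"
    by (subst nn_integral_cmult) auto
  finally have "of_nat k * (\<integral>\<^sup>+r\<in>{0<..<1}. ennreal (Dr r * r ^ (2*k - 1)) \<partial>lborel)
    = (ennreal k * ennreal (1 / k)) * (\<integral>\<^sup>+\<rho>\<in>{0<..<1}. ennreal (Cr \<rho> * \<rho> ^ (2*k - 1)) \<partial>lborel)"
    by (simp add: ennreal_of_nat_eq_real_of_nat mult.assoc)
  also have "ennreal k * ennreal (1 / k) = 1"
    using k by (simp flip: ennreal_mult')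
  finally show ?thesis by simp
qed

end

text \<open>Polar coordinates contribute r^(2m-1); dividing by r^(2a) leaves the odd exponent
  2(m-a)-1 of \<open>Cr_moment_eq\<close>.\<close>

lemma radial_weight:
  fixes E :: "real \<Rightarrow> real"
  assumes dim: "DIM('a::euclidean_space) = 2 * m" and a: "a < m"
    and E[measurable]: "E \<in> borel_measurable borel" and E0: "\<And>r. 0 \<le> E r" "\<And>r. \<not> (0 < r \<and> r < 1) \<Longrightarrow> E r = 0"
  shows "(\<integral>\<^sup>+x. ennreal (E (norm (x::'a)) / norm x ^ (2*a)) \<partial>lborel)
    = ennreal (2 * real m * unit_ball_vol (2 * real m)) * (\<integral>\<^sup>+r\<in>{0<..<1}. ennreal (E r * r ^ (2*(m-a) - 1)) \<partial>lborel)"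
proof -
  have "(\<integral>\<^sup>+x. ennreal (E (norm (x::'a)) / norm x ^ (2*a)) \<partial>lborel)
    = (\<integral>\<^sup>+x. ennreal (E (norm (x::'a)) / norm x ^ (2*a)) * indicator (ball 0 1) x \<partial>lborel)"
    using E0(2) by (intro nn_integral_cong) (auto simp: indicator_def)
  also have "\<dots> = (\<integral>\<^sup>+r\<in>{0<..<1}. ennreal (E r / r ^ (2*a)) * ennreal (DIM('a) * unit_ball_vol DIM('a) * r ^ (DIM('a) - 1)) \<partial>lborel)"
    by (rule nn_integral_lborel_radial) measurable
  also have "\<dots> = (\<integral>\<^sup>+r. ennreal (2 * real m * unit_ball_vol (2 * real m)) * (ennreal (E r * r ^ (2*(m-a) - 1)) * indicator {0<..<1} r) \<partial>lborel)"
  proof (rule nn_integral_cong)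
    fix r :: real
    have "E r / r ^ (2*a) * (2 * m * unit_ball_vol (2*m) * r ^ (2*m - 1)) = 2 * m * unit_ball_vol (2*m) * (E r * r ^ (2*(m-a) - 1))" if "0 < r"
    proof -
      have "2*m - 1 = (2*(m-a) - 1) + 2*a" using a by simp
      then have "r ^ (2*m - 1) = r ^ (2*(m-a) - 1) * r ^ (2*a)" by (simp only: power_add)
      then show ?thesis using that by (simp add: field_simps)
    qed
    then show "ennreal (E r / r ^ (2*a)) * ennreal (DIM('a) * unit_ball_vol DIM('a) * r ^ (DIM('a) - 1)) * indicator {0<..<1} r
       = ennreal (2 * real m * unit_ball_vol (2 * real m)) * (ennreal (E r * r ^ (2*(m-a) - 1)) * indicator {0<..<1} r)"
      using E0(1)[of r] by (auto simp: indicator_def dim ennreal_mult[symmetric])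
  qed
  also have "\<dots> = ennreal (2 * real m * unit_ball_vol (2 * real m)) * (\<integral>\<^sup>+r\<in>{0<..<1}. ennreal (E r * r ^ (2*(m-a) - 1)) \<partial>lborel)"
    by (rule nn_integral_cmult) measurable
  finally show ?thesis .
qed

context weight_pair
begin

lemma Cr_eq_0: "\<not> (0 < r \<and> r < 1) \<Longrightarrow> Cr r = 0" and Dr_eq_0: "\<not> (0 < r \<and> r < 1) \<Longrightarrow> Dr r = 0"
  by (auto simp: Cr_def Dr_def)

lemma Dr_pos: "0 < r \<Longrightarrow> r < 1 \<Longrightarrow> 0 < Dr r"
  using D_pos ln_sq_neg by (simp add: Dr_def)

text \<open>This is \<open>Cr_moment_eq\<close> with k = m - a, the polar factor being common to
  both sides. The constants 1, 2, n and n+1 of the later moments all come from this m - a.\<close>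

lemma weight_integral_eq:
  assumes dim: "DIM('a::euclidean_space) = 2 * m" and a: "a < m"
  shows "(\<integral>\<^sup>+x. ennreal (Cr (norm (x::'a)) / norm x ^ (2*a)) \<partial>lborel)
    = of_nat (m - a) * (\<integral>\<^sup>+x. ennreal (Dr (norm (x::'a)) / norm x ^ (2*a)) \<partial>lborel)"
proof -
  have "m - a > 0" using a by simp
  then show ?thesis
    using Cr_moment_eq[of "m - a"]
    by (subst (1 2) radial_weight[OF dim a]) (simp_all add: Cr_nonneg Dr_nonneg Cr_eq_0 Dr_eq_0 mult_ac)
qed

text \<open>The radial exponent 2(m-a)-1 is at least 1 and r < 1, so the integrand is dominated by r
  D(log r^2), which the sharp condition makes integrable.\<close>

lemma weight_integral_finite:
  assumes dim: "DIM('a::euclidean_space) = 2 * m" and a: "a < m"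
  shows "(\<integral>\<^sup>+x. ennreal (Dr (norm (x::'a)) / norm x ^ (2*a)) \<partial>lborel) < \<infinity>"
proof -
  have "(\<integral>\<^sup>+r\<in>{0<..<1}. ennreal (Dr r * r ^ (2*(m-a) - 1)) \<partial>lborel)
      \<le> (\<integral>\<^sup>+r\<in>{0<..<1}. ennreal (r * D (ln (r\<^sup>2))) \<partial>lborel)"
  proof (rule nn_integral_mono)
    fix r :: real
    have "Dr r * r ^ (2*(m-a) - 1) \<le> Dr r * r ^ 1" if "0 < r" "r < 1"
      using that a by (intro mult_left_mono power_decreasing Dr_nonneg) auto
    then show "ennreal (Dr r * r ^ (2*(m-a) - 1)) * indicator {0<..<1} r \<le> ennreal (r * D (ln (r\<^sup>2))) * indicator {0<..<1} r"
      by (auto simp: indicator_def Dr_def mult.commute intro!: ennreal_leI)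
  qed
  also have "\<dots> < \<infinity>" by (rule D_fin)
  finally show ?thesis
    by (subst radial_weight[OF dim a]) (auto simp: Dr_nonneg Dr_eq_0 ennreal_mult_less_top)
qed

lemma weight_integral_pos:
  "0 < (\<integral>\<^sup>+x. ennreal (Dr (norm (x::'a::euclidean_space)) / norm x ^ (2*a)) \<partial>lborel)"
proof -
  have "\<not> (AE x::'a in lborel. ennreal (Dr (norm x) / norm x ^ (2*a)) = 0)"
  proof
    assume "AE x::'a in lborel. ennreal (Dr (norm x) / norm x ^ (2*a)) = 0"
    then have "AE x::'a in lborel. x \<notin> ball 0 1 - {0}"
    proof eventually_elim
      case (elim x)
      show ?case
      proof
        assume "x \<in> ball 0 1 - {0}"
        then have "0 < Dr (norm x) / norm x ^ (2*a)" using Dr_pos[of "norm x"] by simp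
        then show False using elim by (simp add: ennreal_eq_0_iff)
      qed
    qed
    then have "ball (0::'a) 1 - {0} \<in> null_sets lborel"
      by (subst AE_iff_null_sets) auto
    then have "negligible (ball (0::'a) 1 - {0})" by (simp add: negligible_iff_null_sets null_sets_completionI)
    \<comment> \<open>The origin is put back to obtain an open set, which cannot be
      negligible.\<close>
    then have "negligible (insert 0 (ball (0::'a) 1 - {0}))" by (subst negligible_insert)
    also have "insert 0 (ball (0::'a) 1 - {0}) = ball 0 1" by auto
    finally show False
      using open_not_negligible[of "ball (0::'a) 1"] by simp
  qed
  moreover have "(\<lambda>x::'a. ennreal (Dr (norm x) / norm x ^ (2*a))) \<in> borel_measurable lborel"
    by measurable
  ultimately have "(\<integral>\<^sup>+x. ennreal (Dr (norm (x::'a)) / norm x ^ (2*a)) \<partial>lborel) \<noteq> 0"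
    using nn_integral_0_iff_AE by blast
  then show ?thesis by (simp only: zero_less_iff_neq_zero not_False_eq_True)
qed

end

section \<open>Coordinate moments of radial densities\<close>

lemma norm_vec_sq: "(norm (w :: 'a::real_normed_vector ^ 'n))\<^sup>2 = (\<Sum>i\<in>UNIV. (norm (w $ i))\<^sup>2)"
  by (simp add: norm_vec_def L2_set_def sum_nonneg)

lemma vec_nth_borel_measurable[measurable]: "(\<lambda>w :: complex ^ 'n. w $ i) \<in> borel_measurable borel"
  by (intro borel_measurable_continuous_onI continuous_intros)

lemma norm_permute_coords:
  assumes \<pi>: "bij (\<pi> :: 'n \<Rightarrow> 'n)" shows "norm (\<chi> i. w $ \<pi> i) = norm (w :: complex ^ 'n)"
proof -
  have "(norm (\<chi> i. w $ \<pi> i))\<^sup>2 = (norm w)\<^sup>2"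
    unfolding norm_vec_sq using sum.reindex_bij_betw[OF \<pi>, of "\<lambda>i. (norm (w $ i))\<^sup>2"] by simp
  then show ?thesis by (metis norm_ge_zero power2_eq_imp_eq)
qed

lemma nn_integral_permute_coords:
  fixes H :: "complex ^ 'n \<Rightarrow> ennreal"
  assumes \<pi>: "bij (\<pi> :: 'n \<Rightarrow> 'n)" and H: "H \<in> borel_measurable borel"
  shows "(\<integral>\<^sup>+w. H (\<chi> i. w $ \<pi> i) \<partial>lborel) = (\<integral>\<^sup>+w. H w \<partial>lborel)"
proof (rule nn_integral_lborel_isometry[where T = "\<lambda>w. \<chi> i. w $ \<pi> i", OF _ _ H])
  show "linear (\<lambda>w :: complex ^ 'n. \<chi> i. w $ \<pi> i)"
    by (auto intro!: linearI simp: vec_eq_iff)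
  show "norm (\<chi> i. w $ \<pi> i) = norm w" for w :: "complex ^ 'n"
    by (rule norm_permute_coords[OF \<pi>])
qed

text \<open>Swapping two coordinates preserves the norm and the measure, so the n summands of |w|^2
  contribute equally.\<close>

lemma nn_integral_coord_sq:
  fixes E :: "real \<Rightarrow> ennreal"
  assumes E[measurable]: "E \<in> borel_measurable borel"
  shows "of_nat CARD('n) * (\<integral>\<^sup>+w. ennreal ((norm (w $ k))\<^sup>2) * E (norm (w :: complex ^ 'n)) \<partial>lborel)
    = (\<integral>\<^sup>+w. ennreal ((norm w)\<^sup>2) * E (norm (w :: complex ^ 'n)) \<partial>lborel)"
proof -
  define A where "A j = (\<integral>\<^sup>+w. ennreal ((norm (w $ j))\<^sup>2) * E (norm (w :: complex ^ 'n)) \<partial>lborel)" for j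
  have "A j = A k" for j
  proof -
    have "bij (Transposition.transpose j k)" by simp
    from nn_integral_permute_coords[OF this, of "\<lambda>w. ennreal ((norm (w $ k))\<^sup>2) * E (norm w)"]
    show ?thesis by (simp add: A_def norm_permute_coords)
  qed
  then have "(\<Sum>j\<in>UNIV. A j) = (\<Sum>j\<in>(UNIV::'n set). A k)" by (rule sum.cong[OF refl])
  then have "of_nat CARD('n) * A k = (\<Sum>j\<in>UNIV. A j)" by simp
  also have "\<dots> = (\<integral>\<^sup>+w. (\<Sum>j\<in>UNIV. ennreal ((norm (w $ j))\<^sup>2) * E (norm (w :: complex ^ 'n))) \<partial>lborel)"
    unfolding A_def by (rule nn_integral_sum[symmetric]) measurable
  also have "\<dots> = (\<integral>\<^sup>+w. ennreal ((norm w)\<^sup>2) * E (norm (w :: complex ^ 'n)) \<partial>lborel)"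
    by (simp add: norm_vec_sq sum_ennreal flip: sum_distrib_right)
  finally show ?thesis by (simp add: A_def)
qed

text \<open>The exact constant \<open>1/(n(n+1))\<close> would need unitary invariance; the permutation-invariant bound \<open>1/n\<^sup>2\<close> suffices.\<close>

lemma nn_integral_coord_prod_le:
  fixes E :: "real \<Rightarrow> ennreal" and a k :: "'n::finite"
  assumes E[measurable]: "E \<in> borel_measurable borel" and ak: "a \<noteq> k"
  shows "(of_nat CARD('n))\<^sup>2 * (\<integral>\<^sup>+w. ennreal ((norm (w $ a))\<^sup>2 * (norm (w $ k))\<^sup>2) * E (norm (w :: complex ^ 'n)) \<partial>lborel)
    \<le> (\<integral>\<^sup>+w. ennreal (norm w ^ 4) * E (norm (w :: complex ^ 'n)) \<partial>lborel)"
proof -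
  define B where "B j l = (\<integral>\<^sup>+w. ennreal ((norm (w $ j))\<^sup>2 * (norm (w $ l))\<^sup>2) * E (norm (w :: complex ^ 'n)) \<partial>lborel)" for j l
  have perm: "B (\<pi> i) (\<pi> l) = B i l" if "bij \<pi>" for \<pi> i l
    using nn_integral_permute_coords[OF that, of "\<lambda>w. ennreal ((norm (w $ i))\<^sup>2 * (norm (w $ l))\<^sup>2) * E (norm w)"]
    by (simp add: B_def norm_permute_coords that)
  have diag: "B j j = B i i" for i j
    using perm[of "Transposition.transpose i j" i i] by simp
  \<comment> \<open>Off the diagonal a permutation carries (a,k) to (j,l) and gives equality; on it,
    2xy \<le> x^2 + y^2 bounds \<open>B a k\<close> by the mean of two diagonal terms, and these are
    all equal. Summing over all n^2 pairs then gives the integral of |w|^4.\<close>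
  have le: "B a k \<le> B j l" for j l
  proof (cases "j = l")
    case True
    define h :: real where "h = 1/2"
    have h: "0 \<le> h" and h_sum: "h + h = 1" by (simp_all add: h_def)
    have "B a k \<le> (\<integral>\<^sup>+w. (ennreal h * (ennreal ((norm (w $ a))\<^sup>2 * (norm (w $ a))\<^sup>2) * E (norm (w :: complex ^ 'n)))
        + ennreal h * (ennreal ((norm (w $ k))\<^sup>2 * (norm (w $ k))\<^sup>2) * E (norm w))) \<partial>lborel)"
      unfolding B_def
    proof (rule nn_integral_mono)
      fix w :: "complex ^ 'n"
      define x y where "x = (norm (w $ a))\<^sup>2" and "y = (norm (w $ k))\<^sup>2"
      have "0 \<le> (x - y)\<^sup>2" by simp
      then have "x * y \<le> h * (x * x) + h * (y * y)" by (simp add: h_def power2_eq_square algebra_simps)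
      then have "ennreal (x * y) \<le> ennreal (h * (x * x) + h * (y * y))" by (rule ennreal_leI)
      also have "\<dots> = ennreal h * ennreal (x * x) + ennreal h * ennreal (y * y)"
        using h by (simp add: ennreal_plus ennreal_mult x_def y_def)
      finally have "ennreal (x * y) * E (norm w) \<le> (ennreal h * ennreal (x * x) + ennreal h * ennreal (y * y)) * E (norm w)"
        by (rule mult_right_mono) simp
      then show "ennreal ((norm (w $ a))\<^sup>2 * (norm (w $ k))\<^sup>2) * E (norm w)
        \<le> ennreal h * (ennreal ((norm (w $ a))\<^sup>2 * (norm (w $ a))\<^sup>2) * E (norm w))
          + ennreal h * (ennreal ((norm (w $ k))\<^sup>2 * (norm (w $ k))\<^sup>2) * E (norm w))"
        by (simp add: x_def y_def distrib_right mult.assoc)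
    qed
    also have "\<dots> = ennreal h * B a a + ennreal h * B k k"
      unfolding B_def by (simp add: nn_integral_add nn_integral_cmult)
    also have "\<dots> = (ennreal h + ennreal h) * B j j"
      by (simp add: diag[of a j] diag[of k j] distrib_right)
    also have "ennreal h + ennreal h = 1" using h by (simp add: h_sum flip: ennreal_plus)
    finally show ?thesis using True by simp
  next
    case False
    \<comment> \<open>The first swap sends a to j. The second sends the image of k to l and fixes j,
      because j differs both from that image and from l.\<close>
    define \<pi> where "\<pi> = Transposition.transpose (Transposition.transpose a j k) l \<circ> Transposition.transpose a j"
    have "bij \<pi>" by (simp add: \<pi>_def bij_comp)
    moreover have "Transposition.transpose a j k \<noteq> j" using ak
      by (metis transpose_apply_first transpose_eq_imp_eq)
    then have "\<pi> a = j" "\<pi> k = l" using False by (auto simp: \<pi>_def)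
    ultimately show ?thesis using perm[of \<pi> a k] by simp
  qed
  have "(of_nat CARD('n))\<^sup>2 * B a k = (\<Sum>j\<in>(UNIV::'n set). \<Sum>l\<in>(UNIV::'n set). B a k)"
    by (simp add: power2_eq_square mult.assoc)
  also have "\<dots> \<le> (\<Sum>j\<in>UNIV. \<Sum>l\<in>UNIV. B j l)"
    by (intro sum_mono le)
  also have "\<dots> = (\<integral>\<^sup>+w. (\<Sum>j\<in>UNIV. \<Sum>l\<in>UNIV. ennreal ((norm (w $ j))\<^sup>2 * (norm (w $ l))\<^sup>2) * E (norm (w :: complex ^ 'n))) \<partial>lborel)"
    unfolding B_def by (subst nn_integral_sum, measurable)+
  also have "\<dots> = (\<integral>\<^sup>+w. ennreal (norm w ^ 4) * E (norm (w :: complex ^ 'n)) \<partial>lborel)"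
  proof (rule nn_integral_cong)
    fix w :: "complex ^ 'n"
    have "norm w ^ 4 = (norm w)\<^sup>2 * (norm w)\<^sup>2" by (simp flip: power_add)
    also have "\<dots> = (\<Sum>j\<in>UNIV. \<Sum>l\<in>UNIV. (norm (w $ j))\<^sup>2 * (norm (w $ l))\<^sup>2)"
      by (simp add: norm_vec_sq sum_product)
    finally show "(\<Sum>j\<in>UNIV. \<Sum>l\<in>UNIV. ennreal ((norm (w $ j))\<^sup>2 * (norm (w $ l))\<^sup>2) * E (norm w)) = ennreal (norm w ^ 4) * E (norm w)"
      by (simp add: sum_ennreal sum_nonneg flip: sum_distrib_right)
  qed
  finally show ?thesis by (simp add: B_def)
qed

section \<open>The two weights of the division estimate and their moments\<close>

lemma DIM_Cn: "DIM(complex ^ 'n) = 2 * CARD('n)"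
  by simp

context weight_pair
begin

text \<open>With the components of g as coordinates w, \<open>div_weight\<close> is the factor of
  |F|^2 e^(-\<phi>) in the solution integral, and \<open>data_weight\<close> that of |f|^2
  e^(-\<phi>) in the data integral.\<close>

definition div_weight :: "complex ^ 'n \<Rightarrow> ennreal" where
  "div_weight w = ennreal (Cr (norm w) / norm w ^ (2 * (CARD('n) - 1)))"

definition data_weight :: "complex ^ 'n \<Rightarrow> ennreal" where
  "data_weight w = ennreal ((Cr (norm w) + real (CARD('n) - 1) * Dr (norm w)) / norm w ^ (2 * CARD('n)))"

text \<open>The index a = n-2 gives the P of the overview, and a = n-1 the common value of both
  sides at order s^0. The type argument only carries the dimension.\<close>

definition moment :: "'n::finite itself \<Rightarrow> nat \<Rightarrow> ennreal" where
  "moment _ a = (\<integral>\<^sup>+x. ennreal (Dr (norm (x :: complex ^ 'n)) / norm x ^ (2 * a)) \<partial>lborel)"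

lemma div_weight_measurable[measurable]: "div_weight \<in> borel_measurable borel"
  and data_weight_measurable[measurable]: "data_weight \<in> borel_measurable borel"
  unfolding div_weight_def[abs_def] data_weight_def[abs_def] by measurable

lemma data_weight_power:
  fixes w :: "complex ^ 'n"
  assumes j: "j \<le> CARD('n)"
  shows "ennreal (norm w ^ (2*j)) * data_weight w
    = ennreal (Cr (norm w) / norm w ^ (2 * (CARD('n) - j)))
      + of_nat (CARD('n) - 1) * ennreal (Dr (norm w) / norm w ^ (2 * (CARD('n) - j)))"
proof (cases "w = 0")
  case True
  then show ?thesis by (simp add: data_weight_def Cr_eq_0 Dr_eq_0)
next
  case False
  have "2 * CARD('n) = 2 * j + 2 * (CARD('n) - j)" using j by simp
  then have pw: "norm w ^ (2 * CARD('n)) = norm w ^ (2*j) * norm w ^ (2 * (CARD('n) - j))"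
    by (metis power_add)
  have "norm w ^ (2*j) * ((Cr (norm w) + real (CARD('n) - 1) * Dr (norm w)) / norm w ^ (2 * CARD('n)))
    = Cr (norm w) / norm w ^ (2 * (CARD('n) - j)) + real (CARD('n) - 1) * (Dr (norm w) / norm w ^ (2 * (CARD('n) - j)))"
    unfolding pw using False by (simp add: field_simps)
  then show ?thesis
    unfolding data_weight_def ennreal_of_nat_eq_real_of_nat
    by (subst ennreal_mult'[symmetric], simp, subst ennreal_mult'[symmetric], simp)
      (simp add: Cr_nonneg Dr_nonneg flip: ennreal_plus)
qed

text \<open>The C-part of the weight contributes n - (n-j) = j moments by
  \<open>weight_integral_eq\<close>, the D-part n-1 of them.\<close>

lemma nn_integral_data_weight:
  assumes j: "0 < j" "j \<le> CARD('n::finite)"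
  shows "(\<integral>\<^sup>+w. ennreal (norm w ^ (2*j)) * data_weight (w :: complex ^ 'n) \<partial>lborel)
    = of_nat (j + (CARD('n) - 1)) * moment TYPE('n) (CARD('n) - j)"
proof -
  have "(\<integral>\<^sup>+w. ennreal (norm w ^ (2*j)) * data_weight (w :: complex ^ 'n) \<partial>lborel)
    = (\<integral>\<^sup>+w. ennreal (Cr (norm (w :: complex ^ 'n)) / norm w ^ (2 * (CARD('n) - j))) \<partial>lborel)
      + of_nat (CARD('n) - 1) * moment TYPE('n) (CARD('n) - j)"
    unfolding data_weight_power[OF j(2)] moment_def
    by (subst nn_integral_add) (simp_all add: nn_integral_cmult)
  also have "(\<integral>\<^sup>+w. ennreal (Cr (norm (w :: complex ^ 'n)) / norm w ^ (2 * (CARD('n) - j))) \<partial>lborel)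
    = of_nat (CARD('n) - (CARD('n) - j)) * moment TYPE('n) (CARD('n) - j)"
    unfolding moment_def using j by (intro weight_integral_eq DIM_Cn) auto
  also have "CARD('n) - (CARD('n) - j) = j" using j by simp
  finally show ?thesis by (simp only: of_nat_add distrib_right)
qed

text \<open>Here the factor n - a of \<open>weight_integral_eq\<close> is 1. This is the left side
  of the estimate at order s^0.\<close>

lemma nn_integral_div_weight:
  "(\<integral>\<^sup>+w. div_weight (w :: complex ^ 'n) \<partial>lborel) = moment TYPE('n) (CARD('n) - 1)"
proof -
  have "CARD('n) - 1 < CARD('n)" by simp
  from weight_integral_eq[OF DIM_Cn this] show ?thesis
    by (simp add: div_weight_def moment_def)
qed

text \<open>Symmetry replaces |w_k|^2 by |w|^2/n; this lowers the exponent index to n-2, where the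
  factor of \<open>weight_integral_eq\<close> is 2.\<close>

lemma nn_integral_coord_div_weight:
  assumes n: "CARD('n::finite) \<ge> 2"
  shows "of_nat CARD('n) * (\<integral>\<^sup>+w. ennreal ((norm (w $ k))\<^sup>2) * div_weight (w :: complex ^ 'n) \<partial>lborel)
    = 2 * moment TYPE('n) (CARD('n) - 2)"
proof -
  have "of_nat CARD('n) * (\<integral>\<^sup>+w. ennreal ((norm (w $ k))\<^sup>2) * div_weight (w :: complex ^ 'n) \<partial>lborel)
    = (\<integral>\<^sup>+w. ennreal ((norm w)\<^sup>2) * div_weight (w :: complex ^ 'n) \<partial>lborel)"
    unfolding div_weight_def
    by (rule nn_integral_coord_sq[where E = "\<lambda>r. ennreal (Cr r / r ^ (2 * (CARD('n) - 1)))"]) measurable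
  also have "\<dots> = (\<integral>\<^sup>+w. ennreal (Cr (norm (w :: complex ^ 'n)) / norm w ^ (2 * (CARD('n) - 2))) \<partial>lborel)"
  proof (rule nn_integral_cong)
    fix w :: "complex ^ 'n"
    have "2 * (CARD('n) - 1) = 2 + 2 * (CARD('n) - 2)" using n by simp
    then have "norm w ^ (2 * (CARD('n) - 1)) = norm w ^ 2 * norm w ^ (2 * (CARD('n) - 2))"
      by (metis power_add)
    then show "ennreal ((norm w)\<^sup>2) * div_weight w = ennreal (Cr (norm w) / norm w ^ (2 * (CARD('n) - 2)))"
      by (cases "w = 0") (simp_all add: div_weight_def Cr_eq_0 flip: ennreal_mult')
  qed
  also have "\<dots> = of_nat (CARD('n) - (CARD('n) - 2)) * moment TYPE('n) (CARD('n) - 2)"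
    unfolding moment_def using n by (intro weight_integral_eq DIM_Cn) auto
  also have "CARD('n) - (CARD('n) - 2) = 2" using n by simp
  finally show ?thesis by simp
qed

text \<open>The factor 1 + (n-1) = n of \<open>nn_integral_data_weight\<close> cancels the 1/n from
  symmetry, so the right side at order s^0 is exactly the value in
  \<open>nn_integral_div_weight\<close>. This is where the sharp constant of the division property
  is felt.\<close>

lemma nn_integral_coord_data_weight:
  "(\<integral>\<^sup>+w. ennreal ((norm (w $ a))\<^sup>2) * data_weight (w :: complex ^ 'n) \<partial>lborel)
    = moment TYPE('n) (CARD('n) - 1)"
proof -
  have "of_nat CARD('n) * (\<integral>\<^sup>+w. ennreal ((norm (w $ a))\<^sup>2) * data_weight (w :: complex ^ 'n) \<partial>lborel)
    = (\<integral>\<^sup>+w. ennreal ((norm w)\<^sup>2) * data_weight (w :: complex ^ 'n) \<partial>lborel)"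
    unfolding data_weight_def
    by (rule nn_integral_coord_sq[where E = "\<lambda>r. ennreal ((Cr r + real (CARD('n) - 1) * Dr r) / r ^ (2 * CARD('n)))"]) measurable
  also have "\<dots> = of_nat CARD('n) * moment TYPE('n) (CARD('n) - 1)"
    using nn_integral_data_weight[where 'n = 'n, of 1] by simp
  finally show ?thesis by (simp add: ennreal_mult_cancel_left)
qed

lemma nn_integral_coord_prod_data_weight:
  assumes n: "CARD('n::finite) \<ge> 2" and ak: "a \<noteq> k"
  shows "(of_nat CARD('n))\<^sup>2 * (\<integral>\<^sup>+w. ennreal ((norm (w $ a))\<^sup>2 * (norm (w $ k))\<^sup>2) * data_weight (w :: complex ^ 'n) \<partial>lborel)
    \<le> of_nat (CARD('n) + 1) * moment TYPE('n) (CARD('n) - 2)"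
proof -
  have "(of_nat CARD('n))\<^sup>2 * (\<integral>\<^sup>+w. ennreal ((norm (w $ a))\<^sup>2 * (norm (w $ k))\<^sup>2) * data_weight (w :: complex ^ 'n) \<partial>lborel)
    \<le> (\<integral>\<^sup>+w. ennreal (norm w ^ 4) * data_weight (w :: complex ^ 'n) \<partial>lborel)"
    unfolding data_weight_def
    by (rule nn_integral_coord_prod_le[where E = "\<lambda>r. ennreal ((Cr r + real (CARD('n) - 1) * Dr r) / r ^ (2 * CARD('n)))", OF _ ak]) measurable
  also have "\<dots> = of_nat (2 + (CARD('n) - 1)) * moment TYPE('n) (CARD('n) - 2)"
    using nn_integral_data_weight[where 'n = 'n, of 2] n by simp
  also have "2 + (CARD('n) - 1) = CARD('n) + 1" using n by simp
  finally show ?thesis .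
qed

lemma moment_finite: "a < CARD('n::finite) \<Longrightarrow> moment TYPE('n) a < \<infinity>"
  unfolding moment_def by (rule weight_integral_finite[OF DIM_Cn])

lemma moment_pos: "0 < moment TYPE('n::finite) a"
  unfolding moment_def by (rule weight_integral_pos)

text \<open>Comparison of coefficients, with q in the role of s^2. The terms without q cancel.
  Division by q leaves \<kappa>(x - y) \<le> 3 \<eta> p0, where 3 \<eta> collects the error \<eta>
  on the left and 2 \<eta> on the right. From n x = 2p and n^2 y \<le> (n+1) p follows n^2 (x - y)
  \<ge> (2n - (n+1)) p = (n-1) p.\<close>

lemma moment_inequality:
  fixes a k :: "'n::finite"
  assumes n: "CARD('n) \<ge> 2" and ak: "a \<noteq> k" and q: "q > 0" "q * \<eta> \<le> 1" and \<kappa>: "\<kappa> > 0" "\<eta> > 0"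
    and le: "(\<integral>\<^sup>+w. ennreal (1 + q * (\<kappa> * (norm (w $ k))\<^sup>2 - \<eta>)) * div_weight (w :: complex ^ 'n) \<partial>lborel)
      \<le> (\<integral>\<^sup>+w. ennreal ((norm (w $ a))\<^sup>2 * (1 + q * (\<kappa> * (norm (w $ k))\<^sup>2 + 2 * \<eta>))) * data_weight (w :: complex ^ 'n) \<partial>lborel)"
  shows "\<kappa> * enn2real (moment TYPE('n) (CARD('n) - 2)) * (CARD('n) - 1)
    \<le> 3 * \<eta> * (CARD('n))\<^sup>2 * enn2real (moment TYPE('n) (CARD('n) - 1))"
proof -
  define n where "n = real CARD('n)"
  have n2: "n \<ge> 2" using n by (simp add: n_def)
  define p0 where "p0 = enn2real (moment TYPE('n) (CARD('n) - 1))"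
  define p where "p = enn2real (moment TYPE('n) (CARD('n) - 2))"
  have p0: "moment TYPE('n) (CARD('n) - 1) = ennreal p0" "p0 \<ge> 0"
    using moment_finite[where 'n='n, of "CARD('n) - 1"] by (simp_all add: p0_def)
  have p: "moment TYPE('n) (CARD('n) - 2) = ennreal p" "p \<ge> 0"
    using moment_finite[where 'n='n, of "CARD('n) - 2"] n by (simp_all add: p_def)
  define X where "X = (\<integral>\<^sup>+w. ennreal ((norm (w $ k))\<^sup>2) * div_weight (w :: complex ^ 'n) \<partial>lborel)"
  define Y where "Y = (\<integral>\<^sup>+w. ennreal ((norm (w $ a))\<^sup>2 * (norm (w $ k))\<^sup>2) * data_weight (w :: complex ^ 'n) \<partial>lborel)"
  have nX: "ennreal n * X = ennreal (2 * p)"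
    using nn_integral_coord_div_weight[OF n, of k] p
    by (simp add: X_def n_def ennreal_mult flip: ennreal_of_nat_eq_real_of_nat)
  have nY: "ennreal (n\<^sup>2) * Y \<le> ennreal ((n + 1) * p)"
  proof -
    have "ennreal ((n + 1) * p) = of_nat (CARD('n) + 1) * moment TYPE('n) (CARD('n) - 2)"
      unfolding p(1) by (simp add: n_def ennreal_mult' add.commute flip: ennreal_of_nat_eq_real_of_nat)
    moreover have "ennreal (n\<^sup>2) = (of_nat CARD('n))\<^sup>2"
      by (simp add: n_def ennreal_of_nat_eq_real_of_nat flip: ennreal_power)
    ultimately show ?thesis using nn_integral_coord_prod_data_weight[OF n ak] by (simp add: Y_def)
  qed
  have "X < \<infinity>" using nX n2 by (cases "X = \<infinity>") (auto simp: ennreal_mult_top top.not_eq_extremum)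
  then obtain x where x: "X = ennreal x" "x \<ge> 0" by (metis ennreal_cases infinity_ennreal_def less_irrefl)
  have "Y \<noteq> \<infinity>"
  proof
    assume "Y = \<infinity>"
    then have "ennreal (n\<^sup>2) * Y = \<infinity>" using n2 by (simp add: ennreal_mult_top)
    then show False using nY by (simp add: top_unique)
  qed
  then obtain y where y: "Y = ennreal y" "y \<ge> 0" by (metis ennreal_cases infinity_ennreal_def)
  have rx: "n * x = 2 * p"
    using nX n2 x p by (simp flip: ennreal_mult)
  have ry: "n\<^sup>2 * y \<le> (n + 1) * p"
    using nY n2 y p by (simp flip: ennreal_mult)
  have "(\<integral>\<^sup>+w. ennreal (1 + q * (\<kappa> * (norm (w $ k))\<^sup>2 - \<eta>)) * div_weight (w :: complex ^ 'n) \<partial>lborel)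
    = (\<integral>\<^sup>+w. ennreal (1 - q * \<eta>) * div_weight w + ennreal (q * \<kappa>) * (ennreal ((norm (w $ k))\<^sup>2) * div_weight (w :: complex ^ 'n)) \<partial>lborel)"
  proof (rule nn_integral_cong)
    fix w :: "complex ^ 'n"
    have "1 + q * (\<kappa> * (norm (w $ k))\<^sup>2 - \<eta>) = (1 - q * \<eta>) + (q * \<kappa>) * (norm (w $ k))\<^sup>2"
      by (simp add: algebra_simps)
    then have "ennreal (1 + q * (\<kappa> * (norm (w $ k))\<^sup>2 - \<eta>)) = ennreal (1 - q * \<eta>) + ennreal (q * \<kappa>) * ennreal ((norm (w $ k))\<^sup>2)"
      using q \<kappa> by (simp only:) (subst ennreal_plus, simp_all add: ennreal_mult)
    then show "ennreal (1 + q * (\<kappa> * (norm (w $ k))\<^sup>2 - \<eta>)) * div_weight w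
      = ennreal (1 - q * \<eta>) * div_weight w + ennreal (q * \<kappa>) * (ennreal ((norm (w $ k))\<^sup>2) * div_weight w)"
      by (simp add: distrib_right mult.assoc)
  qed
  also have "\<dots> = ennreal (1 - q * \<eta>) * ennreal p0 + ennreal (q * \<kappa>) * X"
    unfolding X_def p0(1)[symmetric] nn_integral_div_weight[symmetric]
    by (subst nn_integral_add) (simp_all add: nn_integral_cmult)
  also have "\<dots> = ennreal ((1 - q * \<eta>) * p0 + q * \<kappa> * x)"
    using q \<kappa> p0 x by (simp add: ennreal_plus ennreal_mult)
  finally have L: "(\<integral>\<^sup>+w. ennreal (1 + q * (\<kappa> * (norm (w $ k))\<^sup>2 - \<eta>)) * div_weight (w :: complex ^ 'n) \<partial>lborel)
    = ennreal ((1 - q * \<eta>) * p0 + q * \<kappa> * x)" .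
  have "(\<integral>\<^sup>+w. ennreal ((norm (w $ a))\<^sup>2 * (1 + q * (\<kappa> * (norm (w $ k))\<^sup>2 + 2 * \<eta>))) * data_weight (w :: complex ^ 'n) \<partial>lborel)
    = (\<integral>\<^sup>+w. ennreal (1 + 2 * q * \<eta>) * (ennreal ((norm (w $ a))\<^sup>2) * data_weight w) + ennreal (q * \<kappa>) * (ennreal ((norm (w $ a))\<^sup>2 * (norm (w $ k))\<^sup>2) * data_weight (w :: complex ^ 'n)) \<partial>lborel)"
  proof (rule nn_integral_cong)
    fix w :: "complex ^ 'n"
    have "(norm (w $ a))\<^sup>2 * (1 + q * (\<kappa> * (norm (w $ k))\<^sup>2 + 2 * \<eta>)) = (1 + 2 * q * \<eta>) * (norm (w $ a))\<^sup>2 + (q * \<kappa>) * ((norm (w $ a))\<^sup>2 * (norm (w $ k))\<^sup>2)"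
      by (simp add: algebra_simps)
    then have "ennreal ((norm (w $ a))\<^sup>2 * (1 + q * (\<kappa> * (norm (w $ k))\<^sup>2 + 2 * \<eta>))) = ennreal (1 + 2 * q * \<eta>) * ennreal ((norm (w $ a))\<^sup>2) + ennreal (q * \<kappa>) * ennreal ((norm (w $ a))\<^sup>2 * (norm (w $ k))\<^sup>2)"
      using q \<kappa> by (simp only:) (subst ennreal_plus, simp_all add: ennreal_mult)
    then show "ennreal ((norm (w $ a))\<^sup>2 * (1 + q * (\<kappa> * (norm (w $ k))\<^sup>2 + 2 * \<eta>))) * data_weight w
      = ennreal (1 + 2 * q * \<eta>) * (ennreal ((norm (w $ a))\<^sup>2) * data_weight w) + ennreal (q * \<kappa>) * (ennreal ((norm (w $ a))\<^sup>2 * (norm (w $ k))\<^sup>2) * data_weight w)"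
      by (simp only: distrib_right mult.assoc)
  qed
  also have "\<dots> = ennreal (1 + 2 * q * \<eta>) * ennreal p0 + ennreal (q * \<kappa>) * Y"
    unfolding Y_def p0(1)[symmetric] nn_integral_coord_data_weight[of a, symmetric]
    by (subst nn_integral_add) (simp_all add: nn_integral_cmult)
  also have "\<dots> = ennreal ((1 + 2 * q * \<eta>) * p0 + q * \<kappa> * y)"
    using q \<kappa> p0 y by (subst ennreal_plus) (simp_all add: ennreal_mult)
  finally have "ennreal ((1 - q * \<eta>) * p0 + q * \<kappa> * x) \<le> ennreal ((1 + 2 * q * \<eta>) * p0 + q * \<kappa> * y)"
    using le L by simp
  then have "(1 - q * \<eta>) * p0 + q * \<kappa> * x \<le> (1 + 2 * q * \<eta>) * p0 + q * \<kappa> * y"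
    using q \<kappa> p0 y by (subst (asm) ennreal_le_iff) simp_all
  then have "q * (\<kappa> * (x - y)) \<le> q * (3 * \<eta> * p0)" by (simp add: algebra_simps)
  then have "\<kappa> * (x - y) \<le> 3 * \<eta> * p0" using q by simp
  then have "n\<^sup>2 * (\<kappa> * (x - y)) \<le> n\<^sup>2 * (3 * \<eta> * p0)" by (rule mult_left_mono) simp
  moreover have "n\<^sup>2 * (x - y) \<ge> p * (n - 1)"
  proof -
    have "n\<^sup>2 * x = n * (2 * p)" using rx by (simp add: power2_eq_square)
    then show ?thesis using ry by (simp add: algebra_simps)
  qed
  then have "\<kappa> * (n\<^sup>2 * (x - y)) \<ge> \<kappa> * (p * (n - 1))" using \<kappa> by (intro mult_left_mono) auto
  ultimately have "\<kappa> * (p * (n - 1)) \<le> n\<^sup>2 * (3 * \<eta> * p0)" by (simp add: mult.left_commute)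
  then show ?thesis using n
    by (simp add: n_def p_def p0_def of_nat_diff mult_ac)
qed

end

subsection \<open>Holomorphic functions and circle averages\<close>

lemma norm_smult_vec: "norm (c *s v) = norm c * norm (v :: complex ^ 'n)"
proof -
  have "(norm (c *s v))\<^sup>2 = (norm c * norm v)\<^sup>2"
    unfolding power_mult_distrib norm_vec_sq by (simp add: norm_mult power_mult_distrib sum_distrib_left)
  then show ?thesis by (metis norm_ge_zero mult_nonneg_nonneg power2_eq_imp_eq)
qed

lemma bounded_linear_smult_vec: "bounded_linear (\<lambda>c. c *s v)" for v :: "complex ^ 'n"
  by (auto intro!: linear_conv_bounded_linear[THEN iffD1] linearI simp: vec_eq_iff algebra_simps)

lemma bounded_linear_i_smult: "bounded_linear (\<lambda>v. \<i> *s v)" for v :: "complex ^ 'n"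
  by (auto intro!: linear_conv_bounded_linear[THEN iffD1] linearI simp: vec_eq_iff algebra_simps)

lemmas continuous_on_smult_vec [continuous_intros] = bounded_linear.continuous_on[OF bounded_linear_smult_vec]
lemmas continuous_on_i_smult [continuous_intros] = bounded_linear.continuous_on[OF bounded_linear_i_smult]

lemma holomorphic_Cn_continuous_on: "holomorphic_Cn \<Omega> f \<Longrightarrow> continuous_on \<Omega> f"
  unfolding holomorphic_Cn_def
  by (meson continuous_at_imp_continuous_on has_derivative_continuous)

lemma has_derivative_scale_line:
  "((\<lambda>\<tau>. z + \<tau> *s v) has_derivative (\<lambda>\<tau>. \<tau> *s v)) (at t within S)" for v :: "complex ^ 'n"
  by (auto intro!: derivative_eq_intros bounded_linear_imp_has_derivative bounded_linear_smult_vec)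

lemma holomorphic_Cn_line:
  assumes f: "holomorphic_Cn \<Omega> f" and T: "open T" "\<And>\<tau>. \<tau> \<in> T \<Longrightarrow> z + \<tau> *s v \<in> \<Omega>"
  shows "(\<lambda>\<tau>. f (z + \<tau> *s v)) holomorphic_on T"
proof (rule holomorphic_onI)
  fix \<tau> assume "\<tau> \<in> T"
  then have "z + \<tau> *s v \<in> \<Omega>" using T by blast
  then obtain L where L: "(f has_derivative L) (at (z + \<tau> *s v))" "\<And>c v. L (c *s v) = c * L v"
    using f unfolding holomorphic_Cn_def by blast
  have "((\<lambda>\<tau>. f (z + \<tau> *s v)) has_derivative (\<lambda>t. L (t *s v))) (at \<tau> within T)"
    by (rule has_derivative_compose[OF has_derivative_scale_line L(1)])
  moreover have "(\<lambda>t. L (t *s v)) = (*) (L v)" by (simp add: L(2) fun_eq_iff)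
  ultimately have "((\<lambda>\<tau>. f (z + \<tau> *s v)) has_field_derivative L v) (at \<tau> within T)"
    by (simp add: has_field_derivative_def)
  then show "(\<lambda>\<tau>. f (z + \<tau> *s v)) field_differentiable at \<tau> within T"
    by (auto simp: field_differentiable_def)
qed

text \<open>Cauchy's formula at the centre of the circle, where dz/z = i d\<theta>.\<close>

lemma circle_mean_value:
  fixes h :: "complex \<Rightarrow> complex"
  assumes "h holomorphic_on cball 0 1"
  shows "((\<lambda>\<theta>. h (cis \<theta>)) has_integral (2 * pi * h 0)) {0..2*pi}"
proof -
  have "((\<lambda>u. h u/(u-0)) has_contour_integral (2 * of_real pi * \<i> * h 0)) (circlepath 0 1)"
    using Cauchy_integral_circlepath_simple[OF assms, of 0] by simp
  then have "((\<lambda>t. h (cis t) / cis t * \<i> * cis t) has_integral (2 * of_real pi * \<i> * h 0)) {0..2*pi}"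
    unfolding circlepath_def by (subst (asm) has_contour_integral_part_circlepath_iff) simp_all
  then have "((\<lambda>t. h (cis t) * \<i>) has_integral (2 * of_real pi * \<i> * h 0)) {0..2*pi}"
    by (rule has_integral_eq[rotated]) simp
  from has_integral_mult_left[OF this, of "-\<i>"] show ?thesis
    by (simp add: mult_ac)
qed

lemma norm_cis_smult: "norm (cis \<theta> *s w) = norm (w :: complex ^ 'n)"
  by (simp add: norm_smult_vec)

text \<open>On the disc through w, h has mean value h(0) = 1 over the circle. The inequality |h -
  1|^2 \<ge> 0 reads |h|^2 \<ge> 2 Re h - 1, and the right-hand side has mean 1.\<close>

lemma circle_integral_norm_sq_ge:
  fixes G :: "complex ^ 'n \<Rightarrow> complex"
  assumes G: "holomorphic_Cn (ball 0 1) G" "G 0 = 1" and w: "norm w < 1"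
  shows "ennreal (2 * pi) \<le> (\<integral>\<^sup>+\<theta>\<in>{0..2*pi}. ennreal ((norm (G (cis \<theta> *s w)))\<^sup>2) \<partial>lborel)"
proof -
  define h where "h \<tau> = G (0 + \<tau> *s w)" for \<tau>
  define T where "T = {\<tau>::complex. norm (\<tau> *s w) < 1}"
  have "open T" unfolding T_def by (intro open_Collect_less continuous_intros)
  have "cball 0 1 \<subseteq> T"
  proof
    fix \<tau> :: complex assume "\<tau> \<in> cball 0 1"
    then have "norm \<tau> * norm w \<le> 1 * norm w" by (intro mult_right_mono) auto
    then show "\<tau> \<in> T" using w by (simp add: T_def norm_smult_vec)
  qed
  moreover have "h holomorphic_on T"
    unfolding h_def[abs_def] by (rule holomorphic_Cn_line[OF G(1) \<open>open T\<close>]) (simp add: T_def)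
  ultimately have hol: "h holomorphic_on cball 0 1" by (rule holomorphic_on_subset[rotated])
  have "((\<lambda>\<theta>. h (cis \<theta>)) has_integral (2 * pi * h 0)) {0..2*pi}"
    by (rule circle_mean_value[OF hol])
  then have "((\<lambda>\<theta>. Re (h (cis \<theta>))) has_integral (2 * pi)) {0..2*pi}"
    using has_integral_Re by (force simp: h_def G(2))
  moreover have "((\<lambda>_. 1::real) has_integral (2 * pi)) {0..2*pi}"
    using has_integral_const_real[of "1::real" 0 "2*pi"] by simp
  ultimately have "((\<lambda>\<theta>. 2 * Re (h (cis \<theta>)) - 1) has_integral (2 * (2 * pi) - 2 * pi)) {0..2*pi}"
    by (intro has_integral_diff has_integral_mult_right)
  then have I1: "((\<lambda>\<theta>. 2 * Re (h (cis \<theta>)) - 1) has_integral (2 * pi)) {0..2*pi}" by simp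
  have "continuous_on {0..2*pi} (\<lambda>\<theta>. (norm (h (cis \<theta>)))\<^sup>2)"
    by (intro continuous_intros continuous_on_compose2[OF holomorphic_on_imp_continuous_on[OF hol]]) (auto intro!: continuous_intros)
  then have "(\<lambda>\<theta>. (norm (h (cis \<theta>)))\<^sup>2) integrable_on {0..2*pi}" by (rule integrable_continuous_interval)
  then obtain I where I: "((\<lambda>\<theta>. (norm (h (cis \<theta>)))\<^sup>2) has_integral I) {0..2*pi}" by (auto simp: integrable_on_def)
  have "2 * pi \<le> I"
  proof (rule has_integral_le[OF I1 I])
    fix \<theta>
    have "0 \<le> (Re (h (cis \<theta>)) - 1)\<^sup>2 + (Im (h (cis \<theta>)))\<^sup>2" by simp
    then show "2 * Re (h (cis \<theta>)) - 1 \<le> (norm (h (cis \<theta>)))\<^sup>2"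
      unfolding cmod_power2 power2_diff by simp
  qed
  moreover have "(\<integral>\<^sup>+\<theta>\<in>{0..2*pi}. ennreal ((norm (h (cis \<theta>)))\<^sup>2) \<partial>lborel) = ennreal I"
    by (rule nn_integral_has_integral_lebesgue'[OF _ I]) simp
  ultimately show ?thesis by (simp add: h_def ennreal_leI)
qed

text \<open>Rotation invariance of K and of the measure allows |G|^2 to be replaced by its mean over
  the circle, which is at least 1. Thus the constant 1 minimises the weighted norm among holomorphic
  G with G(0) = 1.\<close>

lemma nn_integral_circle_average:
  fixes G :: "complex ^ 'n \<Rightarrow> complex" and K :: "complex ^ 'n \<Rightarrow> ennreal"
  assumes G: "holomorphic_Cn (ball 0 1) G" "G 0 = 1"
    and K[measurable]: "K \<in> borel_measurable borel" and Kinv: "\<And>\<theta> w. K (cis \<theta> *s w) = K w"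
    and K0: "\<And>w. norm w \<ge> 1 \<Longrightarrow> K w = 0"
  shows "(\<integral>\<^sup>+w. K w \<partial>lborel) \<le> (\<integral>\<^sup>+w. ennreal ((norm (G w))\<^sup>2) * K w \<partial>lborel)"
proof -
  \<comment> \<open>Nothing is known about G outside the ball; the cut-off makes the integrand
    measurable on the whole space.\<close>
  define Q where "Q w = (if w \<in> ball 0 1 then (norm (G w))\<^sup>2 else 0)" for w :: "complex ^ 'n"
  have Q[measurable]: "Q \<in> borel_measurable borel"
    unfolding Q_def[abs_def]
    by (intro borel_measurable_continuous_on_if continuous_intros holomorphic_Cn_continuous_on G) auto
  have rot: "(\<lambda>x :: real \<times> (complex ^ 'n). cis (fst x) *s snd x) \<in> borel_measurable (lborel \<Otimes>\<^sub>M lborel)"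
  proof -
    have "continuous_on UNIV (\<lambda>x :: real \<times> (complex ^ 'n). \<chi> i. cis (fst x) * snd x $ i)"
      by (intro continuous_intros)
    then have "(\<lambda>x :: real \<times> (complex ^ 'n). \<chi> i. cis (fst x) * snd x $ i) \<in> borel_measurable borel"
      by (rule borel_measurable_continuous_onI)
    moreover have "(\<lambda>x :: real \<times> (complex ^ 'n). \<chi> i. cis (fst x) * snd x $ i) = (\<lambda>x. cis (fst x) *s snd x)"
      by (auto simp: vec_eq_iff)
    ultimately show ?thesis by (simp add: lborel_prod)
  qed
  define J where "J = (\<integral>\<^sup>+w. ennreal (Q w) * K w \<partial>lborel)"
  have inv: "(\<integral>\<^sup>+w. ennreal (Q (cis \<theta> *s w)) * K w \<partial>lborel) = J" for \<theta>
  proof -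
    have "linear (\<lambda>w :: complex ^ 'n. cis \<theta> *s w)"
      by (auto intro!: linearI simp: vec_eq_iff algebra_simps)
    from nn_integral_lborel_isometry[OF this norm_cis_smult, of "\<lambda>w. ennreal (Q w) * K w"]
    show ?thesis by (simp add: Kinv J_def)
  qed
  have "ennreal (2 * pi) * (\<integral>\<^sup>+w. K w \<partial>lborel) = (\<integral>\<^sup>+w. ennreal (2 * pi) * K w \<partial>lborel)"
    by (simp add: nn_integral_cmult)
  also have "\<dots> \<le> (\<integral>\<^sup>+w. (\<integral>\<^sup>+\<theta>. ennreal (Q (cis \<theta> *s w)) * K w * indicator {0..2*pi} \<theta> \<partial>lborel) \<partial>lborel)"
  proof (rule nn_integral_mono)
    fix w :: "complex ^ 'n"
    show "ennreal (2 * pi) * K w \<le> (\<integral>\<^sup>+\<theta>. ennreal (Q (cis \<theta> *s w)) * K w * indicator {0..2*pi} \<theta> \<partial>lborel)"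
    proof (cases "norm w < 1")
      case True
      have [measurable]: "(\<lambda>\<theta>. cis \<theta> *s w) \<in> borel_measurable borel"
      proof -
        have "(\<lambda>\<theta>. \<chi> i. cis \<theta> * w $ i) \<in> borel_measurable borel"
          by (intro borel_measurable_continuous_onI continuous_intros)
        moreover have "(\<lambda>\<theta>. \<chi> i. cis \<theta> * w $ i) = (\<lambda>\<theta>. cis \<theta> *s w)" by (auto simp: vec_eq_iff)
        ultimately show ?thesis by simp
      qed
      have "(\<integral>\<^sup>+\<theta>. ennreal (Q (cis \<theta> *s w)) * K w * indicator {0..2*pi} \<theta> \<partial>lborel)
         = (\<integral>\<^sup>+\<theta>. (ennreal (Q (cis \<theta> *s w)) * indicator {0..2*pi} \<theta>) * K w \<partial>lborel)"
        by (simp add: mult_ac)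
      also have "\<dots> = (\<integral>\<^sup>+\<theta>. ennreal (Q (cis \<theta> *s w)) * indicator {0..2*pi} \<theta> \<partial>lborel) * K w"
        by (rule nn_integral_multc) measurable
      also have "(\<integral>\<^sup>+\<theta>. ennreal (Q (cis \<theta> *s w)) * indicator {0..2*pi} \<theta> \<partial>lborel)
         = (\<integral>\<^sup>+\<theta>\<in>{0..2*pi}. ennreal ((norm (G (cis \<theta> *s w)))\<^sup>2) \<partial>lborel)"
        using True by (simp add: Q_def norm_cis_smult)
      finally show ?thesis
        using circle_integral_norm_sq_ge[OF G True] by (simp add: mult_right_mono)
    next
      case False
      then show ?thesis by (simp add: K0)
    qed
  qed
  also have "\<dots> = (\<integral>\<^sup>+\<theta>. (\<integral>\<^sup>+w. ennreal (Q (cis \<theta> *s w)) * K w * indicator {0..2*pi} \<theta> \<partial>lborel) \<partial>lborel)"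
  proof (rule lborel_pair.Fubini')
    have "(\<lambda>x. ennreal (Q (cis (fst x) *s snd x)) * K (snd x) * indicator {0..2*pi} (fst x)) \<in> borel_measurable (lborel \<Otimes>\<^sub>M lborel)"
      using rot by measurable
    then show "(\<lambda>(\<theta>, w). ennreal (Q (cis \<theta> *s w)) * K w * indicator {0..2*pi} \<theta>) \<in> borel_measurable (lborel \<Otimes>\<^sub>M lborel)"
      by (simp add: split_beta')
  qed
  also have "\<dots> = (\<integral>\<^sup>+\<theta>. J * indicator {0..2*pi} \<theta> \<partial>lborel)"
  proof (rule nn_integral_cong)
    fix \<theta> :: real
    show "(\<integral>\<^sup>+w. ennreal (Q (cis \<theta> *s w)) * K w * indicator {0..2*pi} \<theta> \<partial>lborel) = J * indicator {0..2*pi} \<theta>"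
      using inv[of \<theta>] by (cases "\<theta> \<in> {0..2*pi}") auto
  qed
  also have "\<dots> = ennreal (2 * pi) * J"
    by (simp add: nn_integral_cmult mult.commute)
  finally have "ennreal (2 * pi) * (\<integral>\<^sup>+w. K w \<partial>lborel) \<le> ennreal (2 * pi) * J" .
  then have "(\<integral>\<^sup>+w. K w \<partial>lborel) \<le> J"
    by (subst (asm) ennreal_mult_le_mult_iff) auto
  also have "J = (\<integral>\<^sup>+w. ennreal ((norm (G w))\<^sup>2) * K w \<partial>lborel)"
    unfolding J_def using K0 by (intro nn_integral_cong) (auto simp: Q_def)
  finally show ?thesis .
qed

section \<open>Holomorphic functions and affine substitutions\<close>

lemma holomorphic_Cn_mult:
  assumes "holomorphic_Cn \<Omega> f" "holomorphic_Cn \<Omega> g"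
  shows "holomorphic_Cn \<Omega> (\<lambda>z. f z * g z)"
  unfolding holomorphic_Cn_def
proof
  fix z assume z: "z \<in> \<Omega>"
  obtain L where L: "(f has_derivative L) (at z)" "\<And>c v. L (c *s v) = c * L v"
    using assms(1) z unfolding holomorphic_Cn_def by blast
  obtain M where M: "(g has_derivative M) (at z)" "\<And>c v. M (c *s v) = c * M v"
    using assms(2) z unfolding holomorphic_Cn_def by blast
  from has_derivative_mult[OF L(1) M(1)] L(2) M(2)
  show "\<exists>L. ((\<lambda>z. f z * g z) has_derivative L) (at z) \<and> (\<forall>c v. L (c *s v) = c * L v)"
    by (intro exI[of _ "\<lambda>v. f z * M v + L v * g z"]) (simp add: algebra_simps)
qed

lemma holomorphic_Cn_exp:
  assumes "holomorphic_Cn \<Omega> f"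
  shows "holomorphic_Cn \<Omega> (\<lambda>z. exp (f z))"
  unfolding holomorphic_Cn_def
proof
  fix z assume z: "z \<in> \<Omega>"
  obtain L where L: "(f has_derivative L) (at z)" "\<And>c v. L (c *s v) = c * L v"
    using assms(1) z unfolding holomorphic_Cn_def by blast
  have "(exp has_derivative (*) (exp (f z))) (at (f z))"
    using DERIV_exp unfolding has_field_derivative_def .
  from has_derivative_compose[OF L(1) this] L(2)
  show "\<exists>L. ((\<lambda>z. exp (f z)) has_derivative L) (at z) \<and> (\<forall>c v. L (c *s v) = c * L v)"
    by (intro exI[of _ "\<lambda>v. exp (f z) * L v"]) (simp add: algebra_simps)
qed

lemma holomorphic_Cn_uminus:
  assumes "holomorphic_Cn \<Omega> f"
  shows "holomorphic_Cn \<Omega> (\<lambda>z. - f z)"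
  unfolding holomorphic_Cn_def
proof
  fix z assume z: "z \<in> \<Omega>"
  obtain L where L: "(f has_derivative L) (at z)" "\<And>c v. L (c *s v) = c * L v"
    using assms(1) z unfolding holomorphic_Cn_def by blast
  from has_derivative_minus[OF L(1)] L(2)
  show "\<exists>L. ((\<lambda>z. - f z) has_derivative L) (at z) \<and> (\<forall>c v. L (c *s v) = c * L v)"
    by (intro exI[of _ "\<lambda>v. - L v"]) simp
qed

lemma holomorphic_Cn_add:
  assumes "holomorphic_Cn \<Omega> f" "holomorphic_Cn \<Omega> g"
  shows "holomorphic_Cn \<Omega> (\<lambda>z. f z + g z)"
  unfolding holomorphic_Cn_def
proof
  fix z assume z: "z \<in> \<Omega>"
  obtain L where L: "(f has_derivative L) (at z)" "\<And>c v. L (c *s v) = c * L v"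
    using assms(1) z unfolding holomorphic_Cn_def by blast
  obtain M where M: "(g has_derivative M) (at z)" "\<And>c v. M (c *s v) = c * M v"
    using assms(2) z unfolding holomorphic_Cn_def by blast
  from has_derivative_add[OF L(1) M(1)] L(2) M(2)
  show "\<exists>L. ((\<lambda>z. f z + g z) has_derivative L) (at z) \<and> (\<forall>c v. L (c *s v) = c * L v)"
    by (intro exI[of _ "\<lambda>v. L v + M v"]) (simp add: algebra_simps)
qed

lemma holomorphic_Cn_const: "holomorphic_Cn \<Omega> (\<lambda>z. c)"
  unfolding holomorphic_Cn_def
  by (intro ballI exI[of _ "\<lambda>v. 0"]) simp

lemma holomorphic_Cn_linear:
  assumes "bounded_linear L" "\<And>c v. L (c *s v) = c * L v"
  shows "holomorphic_Cn \<Omega> L"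
  unfolding holomorphic_Cn_def
  using assms by (intro ballI exI[of _ L]) (simp add: bounded_linear_imp_has_derivative)

lemma bounded_linear_matrix_vector_mult: "bounded_linear (\<lambda>v. M *v v)" for M :: "complex ^ 'n ^ 'm"
  by (auto intro!: linear_conv_bounded_linear[THEN iffD1] linearI
      simp: vec_eq_iff matrix_vector_mult_def algebra_simps sum.distrib scaleR_sum_right)

lemma matrix_vector_mult_smult: "M *v (c *s v) = c *s (M *v v)" for M :: "complex ^ 'n ^ 'm"
  by (simp add: vec_eq_iff matrix_vector_mult_def sum_distrib_left mult_ac)

lemma holomorphic_Cn_compose_affine:
  fixes N :: "complex ^ 'n ^ 'm"
  assumes f: "holomorphic_Cn \<Omega> f" and sub: "\<And>w. w \<in> S \<Longrightarrow> b + N *v w \<in> \<Omega>"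
  shows "holomorphic_Cn S (\<lambda>w. f (b + N *v w))"
  unfolding holomorphic_Cn_def
proof
  fix w assume "w \<in> S"
  then have "b + N *v w \<in> \<Omega>" by (rule sub)
  then obtain L where L: "(f has_derivative L) (at (b + N *v w))" "\<And>c v. L (c *s v) = c * L v"
    using f unfolding holomorphic_Cn_def by blast
  have "((\<lambda>w. b + N *v w) has_derivative (\<lambda>v. N *v v)) (at w)"
    by (auto intro!: derivative_eq_intros bounded_linear_imp_has_derivative bounded_linear_matrix_vector_mult)
  from has_derivative_compose[OF this L(1)] L(2)
  show "\<exists>L. ((\<lambda>w. f (b + N *v w)) has_derivative L) (at w) \<and> (\<forall>c v. L (c *s v) = c * L v)"
    by (intro exI[of _ "\<lambda>v. L (N *v v)"]) (simp add: matrix_vector_mult_smult)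
qed

lemma holomorphic_Cn_coord: "holomorphic_Cn \<Omega> (\<lambda>w. w $ i)"
  unfolding holomorphic_Cn_def
  by (intro ballI exI[of _ "\<lambda>v. v $ i"] conjI bounded_linear_imp_has_derivative bounded_linear_vec_nth) simp

lemma jacobian_det_affine: "jacobian_det (\<lambda>z. M *v (z - z0)) z = det M"
proof -
  have "wirt j (\<lambda>w. (M *v (w - z0)) $ i) z = M $ i $ j" for i j
  proof -
    have "((\<lambda>w. (M *v (w - z0)) $ i) has_derivative (\<lambda>v. (M *v v) $ i)) (at z)"
      by (auto intro!: derivative_eq_intros bounded_linear.has_derivative[OF bounded_linear_vec_nth]
          bounded_linear.has_derivative[OF bounded_linear_matrix_vector_mult])
    then have "frechet_derivative (\<lambda>w. (M *v (w - z0)) $ i) (at z) = (\<lambda>v. (M *v v) $ i)"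
      by (rule frechet_derivative_at[symmetric])
    moreover have "(M *v axis j c) $ i = M $ i $ j * c" for c
      by (simp add: matrix_vector_mult_def axis_def if_distrib[of "\<lambda>x. _ * x"] cong: if_cong)
    ultimately show ?thesis by (simp add: wirt_def mult.left_commute[of \<i> "M $ i $ j"])
  qed
  then show ?thesis by (simp add: jacobian_det_def vec_eq_iff flip: vec_lambda_unique)
qed

subsection \<open>The division property on ellipsoids\<close>

definition ellipsoid :: "complex ^ 'n ^ 'n \<Rightarrow> complex ^ 'n \<Rightarrow> (complex ^ 'n) set" where
  "ellipsoid M z0 = {z. norm (M *v (z - z0)) < 1}"

lemma ellipsoid_eq_image:
  assumes MN: "M ** N = mat 1" "N ** M = mat 1"
  shows "ellipsoid M z0 = (\<lambda>w. z0 + N *v w) ` ball 0 1"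
proof -
  have "N *v (M *v v) = v" "M *v (N *v v) = v" for v
    by (simp_all add: MN matrix_vector_mul_assoc)
  then show ?thesis
    by (auto simp: ellipsoid_def image_iff intro!: bexI[of _ "M *v (_ - z0)"])
qed

lemma continuous_on_matrix_vector_mult [continuous_intros]:
  "continuous_on S f \<Longrightarrow> continuous_on S (\<lambda>x. M *v f x)" for M :: "complex ^ 'n ^ 'm"
  by (rule bounded_linear.continuous_on[OF bounded_linear_matrix_vector_mult])

lemma Cn_domain_ellipsoid:
  assumes MN: "M ** N = mat 1" "N ** M = mat 1"
  shows "Cn_domain (ellipsoid M z0)"
  unfolding Cn_domain_def
proof (intro conjI)
  show "open (ellipsoid M z0)"
    unfolding ellipsoid_def by (intro open_Collect_less continuous_intros)
  show "connected (ellipsoid M z0)"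
    unfolding ellipsoid_eq_image[OF MN] by (intro connected_continuous_image continuous_intros) simp
  have "z0 \<in> ellipsoid M z0" by (simp add: ellipsoid_def)
  then show "ellipsoid M z0 \<noteq> {}" by blast
qed

text \<open>The inner product is the real part of a complex linear function of cis \<theta>, which
  vanishes at the centre of the circle. Used to discard first order terms of circle
  averages.\<close>

lemma circle_integral_inner_zero:
  "((\<lambda>\<theta>. p \<bullet> (cis \<theta> *s q)) has_integral 0) {0..2*pi}" for p q :: "complex ^ 'n"
proof -
  define c where "c = (\<Sum>i\<in>UNIV. q $ i * cnj (p $ i))"
  have "(\<lambda>\<tau>. \<tau> * c) holomorphic_on cball 0 1" by (intro holomorphic_intros)
  from circle_mean_value[OF this] have "((\<lambda>\<theta>. cis \<theta> * c) has_integral 0) {0..2*pi}" by simp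
  from has_integral_Re[OF this] have "((\<lambda>\<theta>. Re (cis \<theta> * c)) has_integral 0) {0..2*pi}" by simp
  moreover have "p \<bullet> (cis \<theta> *s q) = Re (cis \<theta> * c)" for \<theta>
    by (simp add: c_def inner_vec_def inner_complex_def sum_distrib_left algebra_simps sum.distrib sum_subtractf)
  ultimately show ?thesis by simp
qed

lemma circle_integrable:
  fixes u :: "complex ^ 'n \<Rightarrow> real"
  assumes cont: "continuous_on \<Omega> u" and disc: "\<And>\<tau>. norm \<tau> \<le> 1 \<Longrightarrow> z + \<tau> *s v \<in> \<Omega>"
  shows "(\<lambda>\<theta>. u (z + cis \<theta> *s v)) integrable_on {0..2*pi}"
  by (intro integrable_continuous_interval continuous_on_compose2[OF cont] continuous_intros)
    (auto intro!: disc continuous_intros)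

lemma plurisubharmonic_onI:
  fixes u :: "complex ^ 'n \<Rightarrow> real"
  assumes cont: "continuous_on \<Omega> u"
    and sub: "\<And>z v. (\<And>\<tau>. norm \<tau> \<le> 1 \<Longrightarrow> z + \<tau> *s v \<in> \<Omega>) \<Longrightarrow>
      2 * pi * u z \<le> integral {0..2*pi} (\<lambda>\<theta>. u (z + cis \<theta> *s v))"
  shows "plurisubharmonic_on \<Omega> u"
  unfolding plurisubharmonic_on_def
proof (intro conjI ballI allI impI)
  fix z c assume "z \<in> \<Omega>" "u z < c"
  then show "\<forall>\<^sub>F w in at z within \<Omega>. u w < c"
    using cont by (intro order_tendstoD(2)[of u "u z"]) (auto simp: continuous_on_def)
next
  fix z v assume disc: "\<forall>\<tau>. norm \<tau> \<le> 1 \<longrightarrow> z + \<tau> *s v \<in> \<Omega>"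
  show "(\<lambda>\<theta>. u (z + cis \<theta> *s v)) integrable_on {0..2*pi}"
    by (rule circle_integrable[OF cont]) (use disc in blast)
  show "u z \<le> 1 / (2 * pi) * integral {0..2*pi} (\<lambda>\<theta>. u (z + cis \<theta> *s v))"
    using sub[of z v] disc by (simp add: field_simps)
qed

text \<open>The exhaustion is 1/(1 - |M(z - z0)|^2). By convexity of 1/(1 - x) it lies above the
  tangent at a = |p|^2; in |p + cis \<theta> q|^2 the term |q|^2 only helps, and the linear term has
  mean zero over the circle.\<close>

lemma pseudoconvex_ellipsoid:
  assumes MN: "M ** N = mat 1" "N ** M = mat 1"
  shows "pseudoconvex (ellipsoid M z0)"
proof -
  define u where "u z = 1 / (1 - (norm (M *v (z - z0)))\<^sup>2)" for z
  have lt: "(norm (M *v (z - z0)))\<^sup>2 < 1" if "z \<in> ellipsoid M z0" for z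
    using that by (simp add: ellipsoid_def abs_square_less_1)
  have cont: "continuous_on (ellipsoid M z0) u"
    unfolding u_def using lt by (intro continuous_intros) fastforce
  have "plurisubharmonic_on (ellipsoid M z0) u"
  proof (rule plurisubharmonic_onI[OF cont])
    fix z v assume *: "\<And>\<tau>. norm \<tau> \<le> 1 \<Longrightarrow> z + \<tau> *s v \<in> ellipsoid M z0"
    then have in_E: "z + cis \<theta> *s v \<in> ellipsoid M z0" for \<theta> by simp
    have "z \<in> ellipsoid M z0" using *[of 0] by simp
    define p q where "p = M *v (z - z0)" and "q = M *v v"
    define a where "a = (norm p)\<^sup>2"
    have a1: "a < 1" using lt[OF \<open>z \<in> _\<close>] by (simp add: a_def p_def)
    have uz: "u z = 1 / (1 - a)" by (simp add: u_def a_def p_def)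
    have pq: "M *v (z + cis \<theta> *s v - z0) = p + cis \<theta> *s q" for \<theta>
      by (simp add: p_def q_def matrix_vector_mult_smult algebra_simps vec.add vec.diff)
    have int: "(\<lambda>\<theta>. u (z + cis \<theta> *s v)) integrable_on {0..2*pi}"
      by (rule circle_integrable[OF cont *])
    have "((\<lambda>_. 1 / (1 - a)) has_integral (2 * pi * (1 / (1 - a)))) {0..2*pi}"
      using has_integral_const_real[of "1 / (1 - a)" 0 "2*pi"] by simp
    from has_integral_add[OF this has_integral_mult_right[OF circle_integral_inner_zero[of p q], of "2 / (1 - a)\<^sup>2"]]
    have low: "((\<lambda>\<theta>. 1 / (1 - a) + 2 / (1 - a)\<^sup>2 * (p \<bullet> (cis \<theta> *s q))) has_integral (2 * pi * (1 / (1 - a)))) {0..2*pi}"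
      by simp
    have "2 * pi * (1 / (1 - a)) \<le> integral {0..2*pi} (\<lambda>\<theta>. u (z + cis \<theta> *s v))"
    proof (rule has_integral_le[OF low integrable_integral[OF int]])
      fix \<theta>
      define x where "x = (norm (p + cis \<theta> *s q))\<^sup>2"
      have x1: "x < 1" using lt[OF in_E[of \<theta>]] by (simp add: x_def pq)
      have "x = a + 2 * (p \<bullet> (cis \<theta> *s q)) + (norm (cis \<theta> *s q))\<^sup>2"
        by (simp add: x_def a_def power2_norm_eq_inner inner_add inner_commute)
      then have "2 * (p \<bullet> (cis \<theta> *s q)) \<le> x - a" by simp
      then have "2 * (p \<bullet> (cis \<theta> *s q)) / (1 - a)\<^sup>2 \<le> (x - a) / (1 - a)\<^sup>2" by (rule divide_right_mono) simp
      \<comment> \<open>The exact distance between 1/(1 - x) and its tangent at a; it is nonnegative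
        for x < 1.\<close>
      moreover have "1 / (1 - x) - 1 / (1 - a) - (x - a) / (1 - a)\<^sup>2 = (x - a)\<^sup>2 / ((1 - x) * (1 - a)\<^sup>2)"
        using x1 a1 by (simp add: divide_simps) (simp add: power2_eq_square algebra_simps)
      moreover have "0 \<le> (x - a)\<^sup>2 / ((1 - x) * (1 - a)\<^sup>2)" using x1 by simp
      ultimately show "1 / (1 - a) + 2 / (1 - a)\<^sup>2 * (p \<bullet> (cis \<theta> *s q)) \<le> u (z + cis \<theta> *s v)"
        by (simp add: u_def pq flip: x_def)
    qed
    then show "2 * pi * u z \<le> integral {0..2*pi} (\<lambda>\<theta>. u (z + cis \<theta> *s v))"
      by (simp only: uz)
  qed
  moreover have "compact {z \<in> ellipsoid M z0. u z \<le> c}" for c :: real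
  proof (cases "c > 0")
    case True
    \<comment> \<open>For c > 0 the condition u \<le> c bounds |w|^2 by 1 - 1/c, which is less than
      1: the sublevel set stays away from the boundary.\<close>
    have "{z \<in> ellipsoid M z0. u z \<le> c} = (\<lambda>w. z0 + N *v w) ` {w. (norm w)\<^sup>2 \<le> 1 - 1 / c}"
    proof -
      have NM: "N *v (M *v v) = v" "M *v (N *v v) = v" for v
        by (simp_all add: MN matrix_vector_mul_assoc)
      have "z \<in> ellipsoid M z0 \<and> u z \<le> c \<longleftrightarrow> (norm (M *v (z - z0)))\<^sup>2 \<le> 1 - 1 / c" for z
      proof (cases "(norm (M *v (z - z0)))\<^sup>2 < 1")
        case True
        then show ?thesis using \<open>c > 0\<close>
          by (auto simp: ellipsoid_def u_def abs_square_less_1 field_simps)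
      next
        case False
        have "0 < 1 / c" using \<open>c > 0\<close> by simp
        then have "\<not> (norm (M *v (z - z0)))\<^sup>2 \<le> 1 - 1 / c" using False by linarith
        then show ?thesis using False lt by blast
      qed
      then have "{z \<in> ellipsoid M z0. u z \<le> c} = {z. (norm (M *v (z - z0)))\<^sup>2 \<le> 1 - 1 / c}" by blast
      also have "\<dots> = (\<lambda>w. z0 + N *v w) ` {w. (norm w)\<^sup>2 \<le> 1 - 1 / c}"
      proof (intro equalityI subsetI)
        fix z assume "z \<in> {z. (norm (M *v (z - z0)))\<^sup>2 \<le> 1 - 1 / c}"
        moreover have "z = z0 + N *v (M *v (z - z0))" by (simp add: NM)
        ultimately show "z \<in> (\<lambda>w. z0 + N *v w) ` {w. (norm w)\<^sup>2 \<le> 1 - 1 / c}" by blast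
      qed (auto simp: NM)
      finally show ?thesis .
    qed
    moreover have "compact {w :: complex ^ 'a. (norm w)\<^sup>2 \<le> 1 - 1 / c}"
    proof -
      have "bounded {w :: complex ^ 'a. (norm w)\<^sup>2 \<le> 1 - 1 / c}"
      proof (rule boundedI[of _ 1])
        fix w :: "complex ^ 'a" assume "w \<in> {w. (norm w)\<^sup>2 \<le> 1 - 1 / c}"
        then have "(norm w)\<^sup>2 \<le> 1 - 1 / c" by simp
        moreover have "0 < 1 / c" using \<open>c > 0\<close> by simp
        ultimately have "(norm w)\<^sup>2 \<le> 1" by linarith
        then show "norm w \<le> 1" by (simp add: abs_square_le_1)
      qed
      moreover have "closed {w :: complex ^ 'a. (norm w)\<^sup>2 \<le> 1 - 1 / c}"
        by (intro closed_Collect_le continuous_intros)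
      ultimately show ?thesis by (simp add: compact_eq_bounded_closed)
    qed
    ultimately show ?thesis
      by (auto intro!: compact_continuous_image continuous_intros)
  next
    case False
    have eq: "{z \<in> ellipsoid M z0. u z \<le> c} = {}"
    proof -
      have "0 < u z" if "z \<in> ellipsoid M z0" for z using lt[OF that] by (simp add: u_def)
      then show ?thesis using False by fastforce
    qed
    show ?thesis unfolding eq by simp
  qed
  ultimately show ?thesis using cont unfolding pseudoconvex_def by blast
qed

text \<open>The constant does not depend on H, so one and the same c scales both integrals of the
  division estimate.\<close>

lemma nn_integral_affine_pullback:
  fixes M :: "complex ^ 'n ^ 'n"
  assumes MN: "M ** N = mat 1" "N ** M = mat 1"
  obtains c :: ennreal where "0 < c" "c < \<infinity>"
    "\<And>H. H \<in> borel_measurable borel \<Longrightarrow> (\<integral>\<^sup>+z. H (M *v (z - z0)) \<partial>lborel) = c * (\<integral>\<^sup>+w. H w \<partial>lborel)"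
proof -
  have NM: "N *v (M *v v) = v" "M *v (N *v v) = v" for v
    by (simp_all add: MN matrix_vector_mul_assoc)
  have "bij (\<lambda>v. M *v v)" by (rule bijI'[of "\<lambda>v. M *v v"]) (metis NM)+
  moreover have "linear (\<lambda>v. M *v v)"
    using bounded_linear_matrix_vector_mult bounded_linear.linear by blast
  ultimately obtain c where c: "0 < c" "c < \<infinity>"
    "\<And>h. h \<in> borel_measurable borel \<Longrightarrow> (\<integral>\<^sup>+x. h (M *v x) \<partial>lborel) = c * (\<integral>\<^sup>+x. h x \<partial>lborel)"
    using nn_integral_lborel_linear_bij by metis
  have [measurable]: "(\<lambda>v. M *v v) \<in> borel_measurable borel"
    by (intro borel_measurable_continuous_onI continuous_intros)
  have "(\<integral>\<^sup>+z. H (M *v (z - z0)) \<partial>lborel) = c * (\<integral>\<^sup>+w. H w \<partial>lborel)" if [measurable]: "H \<in> borel_measurable borel" for H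
  proof -
    have "(\<integral>\<^sup>+z. H (M *v (z - z0)) \<partial>lborel) = (\<integral>\<^sup>+z. H (M *v (z - z0)) \<partial>distr lborel borel ((+) z0))"
      by (simp add: lborel_distr_plus)
    also have "\<dots> = (\<integral>\<^sup>+z. H (M *v z) \<partial>lborel)"
      by (subst nn_integral_distr) simp_all
    finally show ?thesis using c(3)[OF that] by simp
  qed
  with c(1,2) show thesis by (rule that)
qed

context weight_pair
begin

text \<open>The division estimate transported to the unit ball by w = g(z). \<open>K1\<close> and
  \<open>K2\<close> are barriers below and above the transported weight |e^h|^2 e^(-\<phi>).
  Rotation invariance is asked of \<open>K1\<close>, since the averaging acts on the solution side;
  the bound B on \<open>K2\<close> yields the finite data integral under which the division property
  may be invoked.\<close>

lemma division_weight_inequality: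
  fixes M N :: "complex ^ 'n ^ 'n" and \<phi> :: "complex ^ 'n \<Rightarrow> real"
  assumes n: "CARD('n) \<ge> 2" and MN: "M ** N = mat 1" "N ** M = mat 1"
    and div: "sharp_L2_division C D (ellipsoid M z0) \<phi>"
    and \<phi>: "continuous_on (ellipsoid M z0) \<phi>"
    and h: "holomorphic_Cn UNIV h"
    and K1: "\<And>w. norm w < 1 \<Longrightarrow> K1 w \<le> (norm (exp (h w)))\<^sup>2 * exp (- \<phi> (z0 + N *v w))"
      "\<And>w. norm w < 1 \<Longrightarrow> 0 \<le> K1 w" "\<And>\<theta> w. K1 (cis \<theta> *s w) = K1 w" "K1 \<in> borel_measurable borel"
    and K2: "\<And>w. norm w < 1 \<Longrightarrow> (norm (exp (h w)))\<^sup>2 * exp (- \<phi> (z0 + N *v w)) \<le> K2 w"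
      "\<And>w. norm w < 1 \<Longrightarrow> K2 w \<le> B" "K2 \<in> borel_measurable borel"
  shows "(\<integral>\<^sup>+w. ennreal (K1 w) * div_weight (w :: complex ^ 'n) \<partial>lborel)
    \<le> (\<integral>\<^sup>+w. ennreal ((norm (w $ a))\<^sup>2 * K2 w) * data_weight (w :: complex ^ 'n) \<partial>lborel)"
proof -
  note [measurable] = K1(4) K2(3)
  define g where "g z = M *v (z - z0)" for z
  define f where "f z = g z $ a * exp (h (g z))" for z
  define \<psi> where "\<psi> w = \<phi> (z0 + N *v w)" for w
  have NM: "N *v (M *v v) = v" "M *v (N *v v) = v" for v
    by (simp_all add: MN matrix_vector_mul_assoc)
  have gN: "z0 + N *v g z = z" "g (z0 + N *v w) = w" for z w by (simp_all add: g_def NM)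
  obtain c where c: "0 < c" "c < \<infinity>"
    "\<And>H. H \<in> borel_measurable borel \<Longrightarrow> (\<integral>\<^sup>+z. H (g z) \<partial>lborel) = c * (\<integral>\<^sup>+w. H w \<partial>lborel)"
    unfolding g_def using nn_integral_affine_pullback[OF MN] by metis
  have in_E: "z0 + N *v w \<in> ellipsoid M z0 \<longleftrightarrow> norm w < 1" for w
    by (simp add: ellipsoid_def NM)
  have in_E': "z \<in> ellipsoid M z0 \<longleftrightarrow> norm (g z) < 1" for z
    by (simp add: ellipsoid_def g_def)
  have g_hol: "holomorphic_Cn S (\<lambda>z. g z $ i)" for S i
  proof -
    have "holomorphic_Cn S (\<lambda>z. (- (M *v z0) + M *v z) $ i)"
      by (rule holomorphic_Cn_compose_affine[OF holomorphic_Cn_coord[of UNIV]]) simp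
    then show ?thesis by (simp add: g_def vec.diff)
  qed
  have f_hol: "holomorphic_Cn S f" for S
  proof -
    have "holomorphic_Cn S (\<lambda>z. h (- (M *v z0) + M *v z))"
      by (rule holomorphic_Cn_compose_affine[OF h]) simp
    then have "holomorphic_Cn S (\<lambda>z. h (g z))" by (simp add: g_def vec.diff)
    then show ?thesis unfolding f_def by (intro holomorphic_Cn_mult holomorphic_Cn_exp g_hol)
  qed
  have zero_out: "data_weight w = 0" "div_weight w = 0" if "\<not> norm w < 1" for w :: "complex ^ 'n"
    using that by (simp_all add: data_weight_def div_weight_def Cr_eq_0 Dr_eq_0)
  define R where "R = (\<integral>\<^sup>+w. ennreal ((norm (w $ a))\<^sup>2 * K2 w) * data_weight (w :: complex ^ 'n) \<partial>lborel)"
  define I where "I = (\<integral>\<^sup>+z\<in>ellipsoid M z0. ennreal ((C (ln ((norm (g z))\<^sup>2)) + real (CARD('n) - 1) * D (ln ((norm (g z))\<^sup>2)))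
                   * (norm (f z))\<^sup>2 / norm (g z) ^ (2 * CARD('n)) * exp (- \<phi> z)) \<partial>lborel)"
  have I_le: "I \<le> c * R"
  proof -
    have "I \<le> (\<integral>\<^sup>+z. ennreal ((norm (g z $ a))\<^sup>2 * K2 (g z)) * data_weight (g z) \<partial>lborel)"
      unfolding I_def
    proof (rule nn_integral_mono)
      fix z
      define w where "w = g z"
      have z: "z = z0 + N *v w" by (simp add: w_def gN)
      show "ennreal ((C (ln ((norm (g z))\<^sup>2)) + real (CARD('n) - 1) * D (ln ((norm (g z))\<^sup>2)))
            * (norm (f z))\<^sup>2 / norm (g z) ^ (2 * CARD('n)) * exp (- \<phi> z)) * indicator (ellipsoid M z0) z
          \<le> ennreal ((norm (g z $ a))\<^sup>2 * K2 (g z)) * data_weight (g z)"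
      proof (cases "norm w < 1 \<and> w \<noteq> 0")
        case True
        define d where "d = (C (ln ((norm w)\<^sup>2)) + real (CARD('n) - 1) * D (ln ((norm w)\<^sup>2))) / norm w ^ (2 * CARD('n))"
        have d: "data_weight w = ennreal d" "0 \<le> d"
          using True Cr_nonneg[of "norm w"] Dr_nonneg[of "norm w"]
          by (simp_all add: d_def data_weight_def Cr_def Dr_def)
        have "(C (ln ((norm w)\<^sup>2)) + real (CARD('n) - 1) * D (ln ((norm w)\<^sup>2)))
            * (norm (f z))\<^sup>2 / norm w ^ (2 * CARD('n)) * exp (- \<phi> z)
          = (norm (w $ a))\<^sup>2 * ((norm (exp (h w)))\<^sup>2 * exp (- \<phi> (z0 + N *v w))) * d"
          by (simp add: d_def f_def norm_mult power_mult_distrib flip: w_def z)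
        also have "\<dots> \<le> (norm (w $ a))\<^sup>2 * K2 w * d"
          using True d K2(1)[of w] by (intro mult_right_mono mult_left_mono) auto
        finally show ?thesis using d True
          by (simp add: in_E' flip: w_def ennreal_mult'') (simp add: ennreal_mult'' ennreal_leI flip: ennreal_mult'')
      next
        case False
        \<comment> \<open>Outside the ellipsoid the indicator is 0; at the centre the integrand is a
          division by 0 and hence 0.\<close>
        then show ?thesis by (auto simp: in_E' indicator_def zero_power simp flip: w_def)
      qed
    qed
    also have "\<dots> = c * R"
      unfolding R_def by (rule c(3)) measurable
    finally show ?thesis .
  qed
  have "R < \<infinity>"
  proof -
    have "R \<le> (\<integral>\<^sup>+w. ennreal \<bar>B\<bar> * (ennreal ((norm (w $ a))\<^sup>2) * data_weight (w :: complex ^ 'n)) \<partial>lborel)"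
      unfolding R_def
    proof (rule nn_integral_mono)
      fix w :: "complex ^ 'n"
      show "ennreal ((norm (w $ a))\<^sup>2 * K2 w) * data_weight w \<le> ennreal \<bar>B\<bar> * (ennreal ((norm (w $ a))\<^sup>2) * data_weight w)"
      proof (cases "norm w < 1")
        case True
        have "(norm (w $ a))\<^sup>2 * K2 w \<le> \<bar>B\<bar> * (norm (w $ a))\<^sup>2"
          using K2(2)[OF True] by (subst mult.commute) (intro mult_right_mono, auto)
        then have "ennreal ((norm (w $ a))\<^sup>2 * K2 w) \<le> ennreal \<bar>B\<bar> * ennreal ((norm (w $ a))\<^sup>2)"
          by (simp add: ennreal_leI flip: ennreal_mult)
        then show ?thesis unfolding mult.assoc[symmetric] by (rule mult_right_mono) simp
      qed (simp add: zero_out)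
    qed
    also have "\<dots> = ennreal \<bar>B\<bar> * moment TYPE('n) (CARD('n) - 1)"
      by (subst nn_integral_cmult) (simp_all add: nn_integral_coord_data_weight)
    also have "\<dots> < \<infinity>"
      using moment_finite[where 'n = 'n, of "CARD('n) - 1"] by (simp add: ennreal_mult_less_top)
    finally show ?thesis .
  qed
  then have "c * R < \<infinity>" using c(2) by (simp add: ennreal_mult_less_top)
  with I_le have "I < \<infinity>" by (rule le_less_trans)
  moreover have "\<forall>z\<in>ellipsoid M z0. jacobian_det g z \<noteq> 0"
  proof -
    have "invertible M" unfolding invertible_def using MN by blast
    then show ?thesis by (simp add: g_def[abs_def] jacobian_det_affine invertible_det_nz)
  qed
  moreover have "holomorphic_Cn (ellipsoid M z0) f \<and> (\<forall>i. holomorphic_Cn (ellipsoid M z0) (\<lambda>z. g z $ i)) \<and>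
      (\<forall>z\<in>ellipsoid M z0. norm (g z) < 1) \<and> (\<forall>z\<in>ellipsoid M z0. jacobian_det g z \<noteq> 0) \<and> I < \<infinity> \<longrightarrow>
      (\<exists>F. (\<forall>i. holomorphic_Cn (ellipsoid M z0) (\<lambda>z. F z $ i)) \<and>
        (\<forall>z\<in>ellipsoid M z0. (\<Sum>i\<in>UNIV. g z $ i * F z $ i) = f z) \<and>
        (\<integral>\<^sup>+z\<in>ellipsoid M z0. ennreal (C (ln ((norm (g z))\<^sup>2)) * (norm (F z))\<^sup>2
                    / norm (g z) ^ (2 * (CARD('n) - 1)) * exp (- \<phi> z)) \<partial>lborel) \<le> I)"
    using div unfolding sharp_L2_division_def Let_def I_def by (elim allE[of _ f] allE[of _ g])
  ultimately obtain F :: "complex ^ 'n \<Rightarrow> complex ^ 'n" where F: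
    "\<And>i. holomorphic_Cn (ellipsoid M z0) (\<lambda>z. F z $ i)"
    "\<And>z. z \<in> ellipsoid M z0 \<Longrightarrow> (\<Sum>i\<in>UNIV. g z $ i * F z $ i) = f z"
    "(\<integral>\<^sup>+z\<in>ellipsoid M z0. ennreal (C (ln ((norm (g z))\<^sup>2)) * (norm (F z))\<^sup>2
                    / norm (g z) ^ (2 * (CARD('n) - 1)) * exp (- \<phi> z)) \<partial>lborel) \<le> I"
    using f_hol g_hol in_E' by blast
  \<comment> \<open>Removing e^h normalises the value at the centre to 1, while |G|^2 |e^h|^2 =
    |F_a|^2 restores the size of the solution.\<close>
  define G where "G w = exp (- h w) * F (z0 + N *v w) $ a" for w
  have G_hol: "holomorphic_Cn (ball 0 1) G"
  proof -
    have "holomorphic_Cn (ball 0 1) h" using h by (simp add: holomorphic_Cn_def)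
    moreover have "holomorphic_Cn (ball 0 1) (\<lambda>w. F (z0 + N *v w) $ a)"
      by (rule holomorphic_Cn_compose_affine[OF F(1)]) (simp add: in_E)
    ultimately show ?thesis
      unfolding G_def[abs_def] by (intro holomorphic_Cn_mult holomorphic_Cn_exp holomorphic_Cn_uminus)
  qed
  \<comment> \<open>On the a-axis all other components of g vanish, so the division identity reads t
    F_a = t e^h. This determines F_a for t > 0, and continuity reaches the centre, where the
    identity itself says nothing.\<close>
  have "G 0 = 1"
  proof -
    define e :: "real \<Rightarrow> complex ^ 'n" where "e t = axis a (complex_of_real t)" for t
    have norm_e: "norm (e t) = \<bar>t\<bar>" for t
    proof -
      have "(norm (e t))\<^sup>2 = (\<Sum>i\<in>UNIV. if i = a then \<bar>t\<bar>\<^sup>2 else 0)"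
        unfolding norm_vec_sq by (intro sum.cong) (auto simp: e_def axis_def)
      then have "(norm (e t))\<^sup>2 = \<bar>t\<bar>\<^sup>2" by simp
      then show ?thesis by (rule power2_eq_imp_eq) simp_all
    qed
    have G1: "G (e t) = 1" if t: "0 < t" "t < 1" for t
    proof -
      have "e t $ a * F (z0 + N *v e t) $ a = e t $ a * exp (h (e t))"
      proof -
        have "(\<Sum>i\<in>UNIV. e t $ i * F (z0 + N *v e t) $ i) = f (z0 + N *v e t)"
          using F(2)[of "z0 + N *v e t"] t by (simp add: in_E norm_e gN)
        moreover have "(\<Sum>i\<in>UNIV. e t $ i * F (z0 + N *v e t) $ i) = e t $ a * F (z0 + N *v e t) $ a"
          by (subst sum.remove[of _ a]) (auto simp: e_def axis_def intro!: sum.neutral)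
        ultimately show ?thesis by (simp add: f_def gN)
      qed
      then have "F (z0 + N *v e t) $ a = exp (h (e t))" using t by (simp add: e_def)
      then show ?thesis by (simp add: G_def flip: exp_add)
    qed
    have "isCont G 0"
      using holomorphic_Cn_continuous_on[OF G_hol] by (simp add: continuous_on_eq_continuous_at)
    moreover have "(e \<longlongrightarrow> 0) (at_right 0)"
    proof (rule tendsto_norm_zero_cancel)
      have "((\<lambda>t::real. \<bar>t\<bar>) \<longlongrightarrow> 0) (at_right 0)" by (auto intro!: tendsto_eq_intros)
      then show "((\<lambda>t. norm (e t)) \<longlongrightarrow> 0) (at_right 0)" by (simp add: norm_e)
    qed
    ultimately have "((\<lambda>t. G (e t)) \<longlongrightarrow> G 0) (at_right 0)" by (rule isCont_tendsto_compose)
    moreover have "((\<lambda>t. G (e t)) \<longlongrightarrow> 1) (at_right 0)"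
    proof (rule tendsto_eventually)
      show "\<forall>\<^sub>F t in at_right 0. G (e t) = 1"
        using eventually_at_right_real[of 0 1] by (auto elim!: eventually_mono simp: G1)
    qed
    ultimately show ?thesis by (intro tendsto_unique) auto
  qed
  define Gm where "Gm w = (if w \<in> ball 0 1 then (norm (G w))\<^sup>2 else 0)" for w
  have [measurable]: "Gm \<in> borel_measurable borel"
    unfolding Gm_def[abs_def]
    by (intro borel_measurable_continuous_on_if continuous_intros holomorphic_Cn_continuous_on G_hol) auto
  have "c * (\<integral>\<^sup>+w. ennreal (K1 w) * div_weight w \<partial>lborel)
    \<le> c * (\<integral>\<^sup>+w. ennreal ((norm (G w))\<^sup>2) * (ennreal (K1 w) * div_weight w) \<partial>lborel)"
  proof (intro mult_left_mono nn_integral_circle_average[OF G_hol \<open>G 0 = 1\<close>])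
    show "ennreal (K1 (cis \<theta> *s w)) * div_weight (cis \<theta> *s w) = ennreal (K1 w) * div_weight w" for \<theta> and w :: "complex ^ 'n"
      by (simp add: K1(3) div_weight_def norm_cis_smult)
  qed (auto simp: zero_out)
  also have "(\<integral>\<^sup>+w. ennreal ((norm (G w))\<^sup>2) * (ennreal (K1 w) * div_weight w) \<partial>lborel)
    = (\<integral>\<^sup>+w. ennreal (Gm w) * (ennreal (K1 w) * div_weight w) \<partial>lborel)"
    by (intro nn_integral_cong) (auto simp: Gm_def zero_out)
  also have "c * (\<integral>\<^sup>+w. ennreal (Gm w) * (ennreal (K1 w) * div_weight w) \<partial>lborel)
    = (\<integral>\<^sup>+z. ennreal (Gm (g z)) * (ennreal (K1 (g z)) * div_weight (g z)) \<partial>lborel)"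
    by (rule c(3)[symmetric]) measurable
  also have "\<dots> \<le> (\<integral>\<^sup>+z\<in>ellipsoid M z0. ennreal (C (ln ((norm (g z))\<^sup>2)) * (norm (F z))\<^sup>2
                    / norm (g z) ^ (2 * (CARD('n) - 1)) * exp (- \<phi> z)) \<partial>lborel)"
  proof (rule nn_integral_mono)
    fix z
    define w where "w = g z"
    have z: "z = z0 + N *v w" by (simp add: w_def gN)
    show "ennreal (Gm (g z)) * (ennreal (K1 (g z)) * div_weight (g z))
      \<le> ennreal (C (ln ((norm (g z))\<^sup>2)) * (norm (F z))\<^sup>2
          / norm (g z) ^ (2 * (CARD('n) - 1)) * exp (- \<phi> z)) * indicator (ellipsoid M z0) z"
    proof (cases "norm w < 1 \<and> w \<noteq> 0")
      case True
      define d where "d = C (ln ((norm w)\<^sup>2)) / norm w ^ (2 * (CARD('n) - 1))"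
      have d: "div_weight w = ennreal d" "0 \<le> d"
        using True Cr_nonneg[of "norm w"] by (simp_all add: d_def div_weight_def Cr_def)
      have Gw: "Gm w * (norm (exp (h w)))\<^sup>2 = (norm (F z $ a))\<^sup>2"
        using True by (simp add: Gm_def G_def norm_mult z power_mult_distrib flip: exp_add norm_power)
          (simp add: mult_ac norm_mult[symmetric] power_mult_distrib[symmetric] exp_minus)
      have "Gm w * (K1 w * d) \<le> Gm w * (((norm (exp (h w)))\<^sup>2 * exp (- \<phi> z)) * d)"
        using K1(1)[of w] True d(2) by (intro mult_left_mono mult_right_mono) (auto simp: Gm_def z)
      also have "\<dots> = (norm (F z $ a))\<^sup>2 * (exp (- \<phi> z) * d)"
        by (simp only: Gw[symmetric] mult.assoc)
      \<comment> \<open>The other components of F, about which nothing is known, are discarded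
        here.\<close>
      also have "\<dots> \<le> (norm (F z))\<^sup>2 * (exp (- \<phi> z) * d)"
        using d(2) by (intro mult_right_mono power_mono Finite_Cartesian_Product.norm_nth_le) auto
      also have "\<dots> = C (ln ((norm w)\<^sup>2)) * (norm (F z))\<^sup>2 / norm w ^ (2 * (CARD('n) - 1)) * exp (- \<phi> z)"
        by (simp add: d_def)
      finally have "ennreal (Gm w * (K1 w * d)) \<le> ennreal (C (ln ((norm w)\<^sup>2)) * (norm (F z))\<^sup>2 / norm w ^ (2 * (CARD('n) - 1)) * exp (- \<phi> z))"
        by (rule ennreal_leI)
      moreover have "ennreal (Gm w * (K1 w * d)) = ennreal (Gm w) * (ennreal (K1 w) * div_weight w)"
        using d K1(2)[of w] True by (simp add: ennreal_mult Gm_def)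
      ultimately show ?thesis using True by (simp add: in_E' flip: w_def)
    next
      case False
      have "div_weight w = 0"
      proof (cases "w = 0")
        case True
        then show ?thesis by (simp add: div_weight_def Cr_eq_0)
      next
        case False
        with \<open>\<not> (norm w < 1 \<and> w \<noteq> 0)\<close> show ?thesis by (intro zero_out) auto
      qed
      then show ?thesis by (simp flip: w_def)
    qed
  qed
  also have "\<dots> \<le> I" by (rule F(3))
  also have "\<dots> \<le> c * R" by (rule I_le)
  finally show ?thesis
    using c(1,2) unfolding R_def by (subst (asm) ennreal_mult_le_mult_iff) auto
qed

end

subsection \<open>Second order Taylor expansion and the Levi form\<close>

locale twice_differentiable =
  fixes \<Omega> :: "'a::real_normed_vector set" and u :: "'a \<Rightarrow> real"
    and u' :: "'a \<Rightarrow> 'a \<Rightarrow>\<^sub>L real" and u'' :: "'a \<Rightarrow> 'a \<Rightarrow>\<^sub>L ('a \<Rightarrow>\<^sub>L real)"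
  assumes open_dom: "open \<Omega>"
    and deriv1: "\<And>z. z \<in> \<Omega> \<Longrightarrow> (u has_derivative blinfun_apply (u' z)) (at z)"
    and deriv2: "\<And>z. z \<in> \<Omega> \<Longrightarrow> (u' has_derivative blinfun_apply (u'' z)) (at z)"
begin

lemma deriv2_approx:
  assumes z: "z \<in> \<Omega>" and e: "0 < e"
  obtains d where "0 < d" "\<And>x. norm x < d \<Longrightarrow> z + x \<in> \<Omega>"
    "\<And>x. norm x < d \<Longrightarrow> norm (u' (z + x) - u' z - u'' z x) \<le> e * norm x"
proof -
  obtain r where r: "r > 0" "ball z r \<subseteq> \<Omega>" using open_dom z openE by blast
  obtain d where d: "d > 0" "\<And>y. norm (y - z) < d \<Longrightarrow> norm (u' y - u' z - u'' z (y - z)) \<le> e * norm (y - z)"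
    using deriv2[OF z] e unfolding has_derivative_at_alt by blast
  show thesis
  proof (rule that[of "min r d"])
    fix x :: 'a assume x: "norm x < min r d"
    then have "z + x \<in> ball z r" by (simp add: dist_norm)
    then show "z + x \<in> \<Omega>" using r by blast
    show "norm (u' (z + x) - u' z - u'' z x) \<le> e * norm x"
      using d(2)[of "z + x"] x by simp
  qed (use r d in simp)
qed

lemma line_has_derivative:
  assumes "z + t *\<^sub>R x \<in> \<Omega>"
  shows "((\<lambda>t. u (z + t *\<^sub>R x)) has_real_derivative u' (z + t *\<^sub>R x) x) (at t)"
proof -
  have "((\<lambda>t. z + t *\<^sub>R x) has_derivative (\<lambda>t. t *\<^sub>R x)) (at t)"
    by (auto intro!: derivative_eq_intros)
  from has_derivative_compose[OF this deriv1[OF assms]] show ?thesis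
    by (simp add: has_field_derivative_def blinfun.scaleR_right mult_commute_abs)
qed

text \<open>The mean value theorem is applied to u on the segment minus its quadratic Taylor
  polynomial: the derivative of this difference is the first order remainder of \<open>u'\<close>
  evaluated at x, hence at most e |x|^2.\<close>

lemma taylor2:
  assumes z: "z \<in> \<Omega>" and e: "0 < e"
  obtains d where "0 < d" "\<And>x. norm x < d \<Longrightarrow> z + x \<in> \<Omega>"
    "\<And>x. norm x < d \<Longrightarrow> \<bar>u (z + x) - u z - u' z x - u'' z x x / 2\<bar> \<le> e * (norm x)\<^sup>2"
proof -
  obtain d where d: "0 < d" "\<And>x. norm x < d \<Longrightarrow> z + x \<in> \<Omega>"
    "\<And>x. norm x < d \<Longrightarrow> norm (u' (z + x) - u' z - u'' z x) \<le> e * norm x"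
    using deriv2_approx[OF z e] by blast
  have "\<bar>u (z + x) - u z - u' z x - u'' z x x / 2\<bar> \<le> e * (norm x)\<^sup>2" if x: "norm x < d" for x
  proof -
    define k where "k t = u (z + t *\<^sub>R x) - t * u' z x - t\<^sup>2 / 2 * u'' z x x" for t
    have small: "norm (t *\<^sub>R x) < d" if "0 \<le> t" "t \<le> 1" for t
    proof -
      have "\<bar>t\<bar> * norm x \<le> 1 * norm x" using that by (intro mult_right_mono) auto
      then show ?thesis using x by simp
    qed
    have "\<exists>t>0. t < 1 \<and> k 1 - k 0 = (1 - 0) * (u' (z + t *\<^sub>R x) x - u' z x - t * u'' z x x)"
    proof (rule MVT2)
      fix t :: real assume t: "0 \<le> t" "t \<le> 1"
      have "z + t *\<^sub>R x \<in> \<Omega>" using d(2)[OF small[OF t]] .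
      from line_has_derivative[OF this]
      show "(k has_real_derivative u' (z + t *\<^sub>R x) x - u' z x - t * u'' z x x) (at t)"
        unfolding k_def by (auto intro!: derivative_eq_intros)
    qed simp
    then obtain t where t: "0 < t" "t < 1" "k 1 - k 0 = u' (z + t *\<^sub>R x) x - u' z x - t * u'' z x x" by auto
    have "k 1 - k 0 = (u' (z + t *\<^sub>R x) - u' z - u'' z (t *\<^sub>R x)) x"
      unfolding t(3) by (simp add: blinfun.diff_left blinfun.scaleR_right blinfun.scaleR_left)
    then have "\<bar>k 1 - k 0\<bar> \<le> norm (u' (z + t *\<^sub>R x) - u' z - u'' z (t *\<^sub>R x)) * norm x"
      using norm_blinfun by (metis real_norm_def)
    also have "\<dots> \<le> e * norm (t *\<^sub>R x) * norm x"
      using d(3)[OF small[of t]] t by (intro mult_right_mono) auto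
    also have "\<dots> \<le> e * norm x * norm x"
      using e t by (intro mult_right_mono mult_left_mono) (auto simp: mult_left_le_one_le)
    finally show ?thesis by (simp add: k_def power2_eq_square algebra_simps)
  qed
  with d show thesis by (intro that[of d]) auto
qed

text \<open>The second difference u(z+ta+tb) - u(z+ta) - u(z+tb) + u(z) is symmetric in a and b, and
  by the mean value theorem it equals t^2 \<open>u'' z a b\<close> up to an arbitrarily small
  multiple of t^2. Needed for the Levi matrix to be Hermitian.\<close>

lemma deriv2_symmetric:
  assumes z: "z \<in> \<Omega>"
  shows "u'' z a b = u'' z b a"
proof -
  define m where "m = norm a + norm b + 1"
  have m: "m > 0" by (simp add: m_def add_nonneg_pos)
  have est: "\<bar>u (z + t *\<^sub>R a + t *\<^sub>R b) - u (z + t *\<^sub>R a) - u (z + t *\<^sub>R b) + u z - t\<^sup>2 * u'' z a b\<bar> \<le> 2 * e * m\<^sup>2 * t\<^sup>2"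
    if e: "0 < e" and d: "\<And>x. norm x < d \<Longrightarrow> z + x \<in> \<Omega>"
      "\<And>x. norm x < d \<Longrightarrow> norm (u' (z + x) - u' z - u'' z x) \<le> e * norm x"
      and t: "0 < t" "t * m < d" and ab: "norm a + norm b + 1 = m"
    for e d t and a b :: 'a
  proof -
    define k where "k s = u ((z + t *\<^sub>R a) + s *\<^sub>R b) - u (z + s *\<^sub>R b)" for s
    have small: "norm (t *\<^sub>R a + s *\<^sub>R b) \<le> t * m" "norm (s *\<^sub>R b) \<le> t * m" if "0 \<le> s" "s \<le> t" for s
    proof -
      have 1: "norm (s *\<^sub>R b) \<le> t * norm b" using that by (simp add: mult_right_mono)
      have 2: "t * norm a + t * norm b \<le> t * m" "t * norm b \<le> t * m"
        using t norm_ge_zero[of a] unfolding ab[symmetric] by (simp_all add: distrib_left)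
      show "norm (s *\<^sub>R b) \<le> t * m" using 1 2 by linarith
      have "norm (t *\<^sub>R a + s *\<^sub>R b) \<le> norm (t *\<^sub>R a) + norm (s *\<^sub>R b)" by (rule norm_triangle_ineq)
      then show "norm (t *\<^sub>R a + s *\<^sub>R b) \<le> t * m" using 1 2 t by simp
    qed
    have "\<exists>s>0. s < t \<and> k t - k 0 = (t - 0) * (u' ((z + t *\<^sub>R a) + s *\<^sub>R b) b - u' (z + s *\<^sub>R b) b)"
    proof (rule MVT2[OF t(1)])
      fix s assume s: "0 \<le> s" "s \<le> t"
      have "(z + t *\<^sub>R a) + s *\<^sub>R b \<in> \<Omega>" "z + s *\<^sub>R b \<in> \<Omega>"
        using d(1)[of "t *\<^sub>R a + s *\<^sub>R b"] d(1)[of "s *\<^sub>R b"] small[OF s] t by (simp_all add: add.assoc)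
      from line_has_derivative[OF this(1)] line_has_derivative[OF this(2)]
      show "(k has_real_derivative u' ((z + t *\<^sub>R a) + s *\<^sub>R b) b - u' (z + s *\<^sub>R b) b) (at s)"
        unfolding k_def by (rule DERIV_diff)
    qed
    then obtain s where s: "0 < s" "s < t" "k t - k 0 = t * (u' ((z + t *\<^sub>R a) + s *\<^sub>R b) b - u' (z + s *\<^sub>R b) b)" by auto
    define p q where "p = t *\<^sub>R a + s *\<^sub>R b" and "q = s *\<^sub>R b"
    have pq: "norm p \<le> t * m" "norm q \<le> t * m" using small[of s] s by (simp_all add: p_def q_def)
    have "u' (z + p) b - u' (z + q) b - t * u'' z a b
        = ((u' (z + p) - u' z - u'' z p) - (u' (z + q) - u' z - u'' z q)) b"
      by (simp add: p_def q_def blinfun.diff_left blinfun.add_right blinfun.add_left blinfun.scaleR_right blinfun.scaleR_left)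
    then have "\<bar>u' (z + p) b - u' (z + q) b - t * u'' z a b\<bar>
        \<le> norm ((u' (z + p) - u' z - u'' z p) - (u' (z + q) - u' z - u'' z q)) * norm b"
      using norm_blinfun by (metis real_norm_def)
    also have "\<dots> \<le> (norm (u' (z + p) - u' z - u'' z p) + norm (u' (z + q) - u' z - u'' z q)) * m"
      using ab norm_ge_zero[of a] by (intro mult_mono norm_triangle_ineq4) auto
    also have "\<dots> \<le> (e * (t * m) + e * (t * m)) * m"
    proof (intro mult_right_mono add_mono)
      have "norm (u' (z + p) - u' z - u'' z p) \<le> e * norm p" using d(2)[of p] pq t by simp
      also have "\<dots> \<le> e * (t * m)" using pq e by (intro mult_left_mono) auto
      finally show "norm (u' (z + p) - u' z - u'' z p) \<le> e * (t * m)" .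
      have "norm (u' (z + q) - u' z - u'' z q) \<le> e * norm q" using d(2)[of q] pq t by simp
      also have "\<dots> \<le> e * (t * m)" using pq e by (intro mult_left_mono) auto
      finally show "norm (u' (z + q) - u' z - u'' z q) \<le> e * (t * m)" .
    qed (use m in simp)
    finally have *: "\<bar>u' (z + p) b - u' (z + q) b - t * u'' z a b\<bar> \<le> 2 * e * m\<^sup>2 * t"
      by (simp add: power2_eq_square algebra_simps)
    have "u (z + t *\<^sub>R a + t *\<^sub>R b) - u (z + t *\<^sub>R a) - u (z + t *\<^sub>R b) + u z - t\<^sup>2 * u'' z a b
      = k t - k 0 - t\<^sup>2 * u'' z a b" by (simp add: k_def)
    also have "\<dots> = t * (u' (z + p) b - u' (z + q) b - t * u'' z a b)"
      unfolding s(3) by (simp add: p_def q_def add.assoc power2_eq_square algebra_simps)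
    also have "\<bar>\<dots>\<bar> \<le> t * (2 * e * m\<^sup>2 * t)"
      using * t(1) by (simp add: abs_mult)
    finally show ?thesis by (simp add: power2_eq_square mult_ac)
  qed
  have "\<bar>u'' z a b - u'' z b a\<bar> \<le> 4 * m\<^sup>2 * e" if e: "0 < e" for e
  proof -
    obtain d where d: "0 < d" "\<And>x. norm x < d \<Longrightarrow> z + x \<in> \<Omega>"
      "\<And>x. norm x < d \<Longrightarrow> norm (u' (z + x) - u' z - u'' z x) \<le> e * norm x"
      using deriv2_approx[OF z e] by blast
    define t where "t = d / (2 * m)"
    have t: "0 < t" "t * m < d" using d m by (simp_all add: t_def)
    have 1: "\<bar>u (z + t *\<^sub>R a + t *\<^sub>R b) - u (z + t *\<^sub>R a) - u (z + t *\<^sub>R b) + u z - t\<^sup>2 * u'' z a b\<bar> \<le> 2 * e * m\<^sup>2 * t\<^sup>2"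
      by (rule est[OF e d(2,3) t]) (simp_all add: m_def)
    have 2: "\<bar>u (z + t *\<^sub>R b + t *\<^sub>R a) - u (z + t *\<^sub>R b) - u (z + t *\<^sub>R a) + u z - t\<^sup>2 * u'' z b a\<bar> \<le> 2 * e * m\<^sup>2 * t\<^sup>2"
      by (rule est[OF e d(2,3) t]) (simp_all add: m_def)
    have comm: "z + t *\<^sub>R b + t *\<^sub>R a = z + t *\<^sub>R a + t *\<^sub>R b" by (simp add: add_ac)
    have "\<bar>t\<^sup>2 * u'' z a b - t\<^sup>2 * u'' z b a\<bar> \<le> 4 * e * m\<^sup>2 * t\<^sup>2"
      using 1 2 unfolding comm by linarith
    then have "t\<^sup>2 * \<bar>u'' z a b - u'' z b a\<bar> \<le> t\<^sup>2 * (4 * m\<^sup>2 * e)"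
      by (simp add: abs_mult mult_ac flip: right_diff_distrib)
    then show ?thesis using t by simp
  qed
  then have "\<bar>u'' z a b - u'' z b a\<bar> \<le> 0 + e" if "0 < e" for e
  proof -
    have "0 < e / (4 * m\<^sup>2)" using that m by simp
    from \<open>\<And>e. 0 < e \<Longrightarrow> _\<close>[OF this] show ?thesis using m by simp
  qed
  then have "\<bar>u'' z a b - u'' z b a\<bar> \<le> 0" by (rule field_le_epsilon)
  then show ?thesis by simp
qed

end

section \<open>The Levi form in terms of the real second derivative\<close>

lemma sesquilinear_form_expansion:
  fixes B :: "complex ^ 'n \<Rightarrow> complex ^ 'n \<Rightarrow> complex"
  assumes add1: "\<And>x y w. B (x + y) w = B x w + B y w" and add2: "\<And>x y w. B w (x + y) = B w x + B w y"
    and sm1: "\<And>c x w. B (c *s x) w = c * B x w" and sm2: "\<And>c x w. B w (c *s x) = cnj c * B w x"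
  shows "B v v = (\<Sum>j\<in>UNIV. \<Sum>k\<in>UNIV. B (axis j 1) (axis k 1) * v $ j * cnj (v $ k))"
proof -
  have z1: "B 0 w = 0" for w using sm1[of 0 0 w] by simp
  have z2: "B w 0 = 0" for w using sm2[of w 0 0] by simp
  have s1: "B (sum g S) w = (\<Sum>i\<in>S. B (g i) w)" for g w and S :: "'n set"
    using sum_comp_morphism[of "\<lambda>x. B x w" g S, OF z1 add1] by (simp add: o_def)
  have s2: "B w (sum g S) = (\<Sum>i\<in>S. B w (g i))" for g w and S :: "'n set"
    using sum_comp_morphism[of "\<lambda>x. B w x" g S, OF z2 add2] by (simp add: o_def)
  have "B v v = B (\<Sum>j\<in>UNIV. (v $ j) *s axis j 1) (\<Sum>k\<in>UNIV. (v $ k) *s axis k 1)"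
    by (simp add: basis_expansion)
  also have "\<dots> = (\<Sum>j\<in>UNIV. \<Sum>k\<in>UNIV. B (axis j 1) (axis k 1) * v $ j * cnj (v $ k))"
    by (simp only: s1) (simp add: s2 sm1 sm2 sum_distrib_left mult_ac)
  finally show ?thesis .
qed

lemma smult_complex: "c *s x = Re c *\<^sub>R x + Im c *\<^sub>R (\<i> *s x)" for x :: "complex ^ 'n"
  by (simp add: vec_eq_iff complex_eq_iff)

lemma i_smult: "\<i> *s (\<i> *s x) = - x" "\<i> *s (x + y) = \<i> *s x + \<i> *s y" "\<i> *s (r *\<^sub>R x) = r *\<^sub>R (\<i> *s x)"
  for x y :: "complex ^ 'n"
  by (simp_all add: vec_eq_iff algebra_simps)

lemmas bilinear_simps = blinfun.add_right blinfun.add_left blinfun.scaleR_right blinfun.scaleR_left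
  blinfun.minus_right blinfun.minus_left blinfun.diff_right blinfun.diff_left

locale twice_differentiable_Cn = twice_differentiable \<Omega> u u' u''
  for \<Omega> :: "(complex ^ 'n) set" and u u' u''
begin

text \<open>A quarter of the Laplacian at 0 of u restricted to the complex line through z in
  direction v.\<close>

definition levi_form :: "complex ^ 'n \<Rightarrow> complex ^ 'n \<Rightarrow> real" where
  "levi_form z v = (u'' z v v + u'' z (\<i> *s v) (\<i> *s v)) / 4"

text \<open>Polarisation of \<open>levi_form\<close>, complex linear in x and conjugate linear in y.
  The imaginary part is forced: by linearity in x it is minus the real part at (\<i> x, y).\<close>

definition levi_sesq :: "complex ^ 'n \<Rightarrow> complex ^ 'n \<Rightarrow> complex ^ 'n \<Rightarrow> complex" where
  "levi_sesq z x y = Complex ((u'' z x y + u'' z (\<i> *s x) (\<i> *s y)) / 4) ((u'' z x (\<i> *s y) - u'' z (\<i> *s x) y) / 4)"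

lemma levi_sesq_expansion:
  "levi_sesq z v v = (\<Sum>j\<in>UNIV. \<Sum>k\<in>UNIV. levi_sesq z (axis j 1) (axis k 1) * v $ j * cnj (v $ k))"
proof (rule sesquilinear_form_expansion)
  show "levi_sesq z (x + y) w = levi_sesq z x w + levi_sesq z y w" for x y w
    by (simp add: levi_sesq_def i_smult bilinear_simps complex_eq_iff field_simps)
  show "levi_sesq z w (x + y) = levi_sesq z w x + levi_sesq z w y" for x y w
    by (simp add: levi_sesq_def i_smult bilinear_simps complex_eq_iff field_simps)
  show "levi_sesq z (c *s x) w = c * levi_sesq z x w" for c x w
    unfolding smult_complex[of c x]
    by (simp add: levi_sesq_def i_smult bilinear_simps complex_eq_iff field_simps)
  show "levi_sesq z w (c *s x) = cnj c * levi_sesq z w x" for c x w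
    unfolding smult_complex[of c x]
    by (simp add: levi_sesq_def i_smult bilinear_simps complex_eq_iff field_simps)
qed

lemma levi_form_smult: "levi_form z (c *s v) = (norm c)\<^sup>2 * levi_form z v"
  unfolding smult_complex[of c v] cmod_power2
  by (simp add: levi_form_def i_smult bilinear_simps field_simps power2_eq_square)

lemma wirt_bar_eq:
  assumes z: "z \<in> \<Omega>"
  shows "wirt_bar k (\<lambda>w. complex_of_real (u w)) z
    = (of_real (u' z (axis k 1)) + \<i> * of_real (u' z (axis k \<i>))) / 2"
    and "wirt k (\<lambda>w. complex_of_real (u w)) z
    = (of_real (u' z (axis k 1)) - \<i> * of_real (u' z (axis k \<i>))) / 2"
proof -
  have "((\<lambda>w. complex_of_real (u w)) has_derivative (\<lambda>v. complex_of_real (u' z v))) (at z)"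
    by (rule has_derivative_of_real[OF deriv1[OF z]])
  then have "frechet_derivative (\<lambda>w. complex_of_real (u w)) (at z) = (\<lambda>v. complex_of_real (u' z v))"
    by (rule frechet_derivative_at[symmetric])
  then show "wirt_bar k (\<lambda>w. complex_of_real (u w)) z
    = (of_real (u' z (axis k 1)) + \<i> * of_real (u' z (axis k \<i>))) / 2"
    "wirt k (\<lambda>w. complex_of_real (u w)) z
    = (of_real (u' z (axis k 1)) - \<i> * of_real (u' z (axis k \<i>))) / 2"
    by (simp_all add: wirt_bar_def wirt_def)
qed

lemma levi_matrix_eq:
  assumes z: "z \<in> \<Omega>"
  shows "levi_matrix u z $ j $ k = levi_sesq z (axis j 1) (axis k 1)"
proof -
  have blin: "((\<lambda>w. complex_of_real (u' w x)) has_derivative (\<lambda>v. complex_of_real (u'' z v x))) (at z)" for x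
    by (intro has_derivative_of_real bounded_linear.has_derivative[OF blinfun.bounded_linear_left deriv2[OF z]])
  have "((\<lambda>w. (of_real (u' w (axis k 1)) + \<i> * of_real (u' w (axis k \<i>))) / 2) has_derivative
      (\<lambda>v. (of_real (u'' z v (axis k 1)) + \<i> * of_real (u'' z v (axis k \<i>))) / 2)) (at z)"
    by (intro bounded_linear.has_derivative[OF bounded_linear_divide] has_derivative_add has_derivative_mult_right blin)
  then have "((\<lambda>w. wirt_bar k (\<lambda>w. complex_of_real (u w)) w) has_derivative
      (\<lambda>v. (of_real (u'' z v (axis k 1)) + \<i> * of_real (u'' z v (axis k \<i>))) / 2)) (at z)"
    by (rule has_derivative_transform_within_open[OF _ open_dom z]) (simp add: wirt_bar_eq)
  then have "frechet_derivative (\<lambda>w. wirt_bar k (\<lambda>w. complex_of_real (u w)) w) (at z)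
     = (\<lambda>v. (of_real (u'' z v (axis k 1)) + \<i> * of_real (u'' z v (axis k \<i>))) / 2)"
    by (rule frechet_derivative_at[symmetric])
  moreover have "\<i> *s axis l 1 = (axis l \<i> :: complex ^ 'n)" for l
    by (simp add: vec_eq_iff axis_def)
  ultimately show ?thesis
    by (simp add: levi_matrix_def wirt_def levi_sesq_def complex_eq_iff)
qed

lemma levi_matrix_form:
  assumes z: "z \<in> \<Omega>"
  shows "Re (\<Sum>j\<in>UNIV. \<Sum>k\<in>UNIV. levi_matrix u z $ j $ k * v $ j * cnj (v $ k)) = levi_form z v"
  unfolding levi_matrix_eq[OF z] levi_sesq_expansion[symmetric]
  by (simp add: levi_sesq_def levi_form_def)

lemma levi_matrix_hermitian:
  assumes z: "z \<in> \<Omega>"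
  shows "levi_matrix u z $ j $ k = cnj (levi_matrix u z $ k $ j)"
  unfolding levi_matrix_eq[OF z] levi_sesq_def complex_eq_iff
  by (simp add: deriv2_symmetric[OF z, of "axis j 1"] deriv2_symmetric[OF z, of "\<i> *s axis j 1"] field_simps)

end

context twice_differentiable_Cn
begin

text \<open>The complex linear form with real part \<open>u' z\<close>, that is twice the (1,0)-part
  of the differential. It makes the first order Taylor term the real part of a holomorphic
  function.\<close>

definition complex_gradient :: "complex ^ 'n \<Rightarrow> complex ^ 'n \<Rightarrow> complex" where
  "complex_gradient z x = Complex (u' z x) (- u' z (\<i> *s x))"

lemma complex_gradient_smult: "complex_gradient z (c *s x) = c * complex_gradient z x"
  unfolding smult_complex[of c x]
  by (simp add: complex_gradient_def i_smult bilinear_simps complex_eq_iff algebra_simps)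

lemma bounded_linear_complex_gradient: "bounded_linear (complex_gradient z)"
  by (auto intro!: linear_conv_bounded_linear[THEN iffD1] linearI
      simp: complex_gradient_def i_smult bilinear_simps complex_eq_iff)

text \<open>The second derivative with respect to \<tau>, not its conjugate, of u(z + \<tau> v) at
  \<tau> = 0. On a complex line it carries the pluriharmonic part of the quadratic term, which a
  holomorphic square can absorb; the Levi form is what remains.\<close>

definition mixed_coeff :: "complex ^ 'n \<Rightarrow> complex ^ 'n \<Rightarrow> complex" where
  "mixed_coeff z v = Complex ((u'' z v v - u'' z (\<i> *s v) (\<i> *s v)) / 4) (- (u'' z v (\<i> *s v) + u'' z (\<i> *s v) v) / 4)"

lemma second_order_complex_line:
  "u'' z (c *s v) (c *s v) / 2 = Re (mixed_coeff z v * c\<^sup>2) + levi_form z v * (norm c)\<^sup>2"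
  unfolding smult_complex[of c v] cmod_power2
  by (simp add: mixed_coeff_def levi_form_def i_smult bilinear_simps power2_eq_square field_simps)

end

text \<open>Scaling by \<open>s\<close> along \<open>v\<close> and only by \<open>s\<^sup>2\<close> transversally isolates the second derivatives in the direction \<open>v\<close>.\<close>

definition stretch_matrix :: "'n \<Rightarrow> real \<Rightarrow> complex ^ 'n \<Rightarrow> complex ^ 'n ^ 'n" where
  "stretch_matrix k s v = (\<chi> i j. (if j = k then of_real s * v $ i else 0)
     + (if j = i then (if i = k then 0 else of_real (s\<^sup>2)) else 0))"

definition stretch_inverse :: "'n \<Rightarrow> real \<Rightarrow> complex ^ 'n \<Rightarrow> complex ^ 'n ^ 'n" where
  "stretch_inverse k s v = (\<chi> i j. (if j = k then (if i = k then 1 / of_real s else - v $ i / of_real (s\<^sup>2)) else 0)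
     + (if j = i then (if i = k then 0 else 1 / of_real (s\<^sup>2)) else 0))"

lemma stretch_matrix_mult:
  "(stretch_matrix k s v *v w) $ i = of_real s * v $ i * w $ k + (if i = k then 0 else of_real (s\<^sup>2) * w $ i)"
  by (simp add: stretch_matrix_def matrix_vector_mult_def distrib_right sum.distrib if_distrib[of "\<lambda>x. x * _"] cong: if_cong)

lemma stretch_inverse_mult:
  "(stretch_inverse k s v *v w) $ i = (if i = k then w $ k / of_real s else (w $ i - v $ i * w $ k) / of_real (s\<^sup>2))"
  by (simp add: stretch_inverse_def matrix_vector_mult_def distrib_right sum.distrib if_distrib[of "\<lambda>x. x * _"]
      diff_divide_distrib cong: if_cong)

lemma stretch_matrix_inverse:
  assumes s: "s > 0" and v: "v $ k = 1"
  shows "stretch_inverse k s v ** stretch_matrix k s v = mat 1" "stretch_matrix k s v ** stretch_inverse k s v = mat 1"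
  unfolding matrix_eq using s v
  by (simp_all add: vec_eq_iff stretch_matrix_mult stretch_inverse_mult power2_eq_square field_simps
      flip: matrix_vector_mul_assoc)

lemma stretch_matrix_decomp:
  "stretch_matrix k s v *v w = s *\<^sub>R (w $ k *s v + s *\<^sub>R (\<chi> i. if i = k then 0 else w $ i))"
  by (simp add: vec_eq_iff stretch_matrix_mult complex_eq_iff power2_eq_square algebra_simps)

lemma norm_drop_coord_le: "norm (\<chi> i. if i = k then 0 else w $ i) \<le> norm (w :: complex ^ 'n)"
  unfolding norm_vec_def by (intro L2_set_mono) auto

section \<open>Exclusion of a negative direction of the Levi form\<close>

context weight_pair
begin

lemma levi_form_nonneg:
  fixes \<phi> :: "complex ^ 'n \<Rightarrow> real"
  assumes n: "CARD('n) \<ge> 2"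
    and tw: "twice_differentiable_Cn \<Omega> \<phi> u' u''"
    and div: "\<And>\<Omega>'. pseudoconvex_subdomain \<Omega>' \<Omega> \<Longrightarrow> sharp_L2_division C D \<Omega>' \<phi>"
    and z0: "z0 \<in> \<Omega>"
  shows "0 \<le> twice_differentiable_Cn.levi_form u'' z0 v"
proof (rule ccontr)
  interpret twice_differentiable_Cn \<Omega> \<phi> u' u'' by (rule tw)
  assume neg: "\<not> 0 \<le> levi_form z0 v"
  then have "v \<noteq> 0" by (auto simp: levi_form_def)
  then obtain k where k: "v $ k \<noteq> 0" by (auto simp: vec_eq_iff)
  \<comment> \<open>Rescaling multiplies the Levi form by a positive factor, so it stays negative;
    p_k = 1 is what makes the stretch matrix invertible.\<close>
  define p where "p = (1 / v $ k) *s v"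
  have pk: "p $ k = 1" using k by (simp add: p_def)
  define \<kappa> where "\<kappa> = - levi_form z0 p"
  have \<kappa>: "\<kappa> > 0" using neg k
    by (auto simp: \<kappa>_def p_def levi_form_smult norm_divide power_divide not_le intro!: divide_neg_pos)
  have "UNIV \<noteq> {k}"
  proof
    assume "UNIV = {k}"
    then have "CARD('n) = card {k}" by (rule arg_cong)
    then show False using n by simp
  qed
  then obtain a where ak: "a \<noteq> k" by blast
  \<comment> \<open>For every error level \<eta> a small s produces an inequality in which s no
    longer occurs, so that \<eta> can tend to 0 at the end.\<close>
  have key: "\<kappa> * enn2real (moment TYPE('n) (CARD('n) - 2)) * (CARD('n) - 1)
    \<le> 3 * \<eta> * (CARD('n))\<^sup>2 * enn2real (moment TYPE('n) (CARD('n) - 1))" if \<eta>: "\<eta> > 0" for \<eta> :: real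
  proof -
    define A where "A = norm (u'' z0)"
    define m where "m = norm p + 1"
    have m: "m > 0" by (simp add: m_def add_nonneg_pos)
    \<comment> \<open>The precision \<eta>/(2 m^2) turns into the error s^2 \<eta>/2 on the
      ellipsoid, whose points are within s m of z0.\<close>
    obtain d where d: "0 < d" "\<And>x. norm x < d \<Longrightarrow> z0 + x \<in> \<Omega>"
      "\<And>x. norm x < d \<Longrightarrow> \<bar>\<phi> (z0 + x) - \<phi> z0 - u' z0 x - u'' z0 x x / 2\<bar> \<le> (\<eta> / (2 * m\<^sup>2)) * (norm x)\<^sup>2"
      using taylor2[OF z0, of "\<eta> / (2 * m\<^sup>2)"] \<eta> m by auto
    have small: "\<forall>\<^sub>F s in at_right 0. s * c < e" if "e > 0" for c e :: real
    proof -
      have "((\<lambda>s. s * c) \<longlongrightarrow> 0) (at_right 0)" by (auto intro!: tendsto_eq_intros)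
      from order_tendstoD(2)[OF this that] show ?thesis .
    qed
    \<comment> \<open>The conditions in turn: s < 1; the ellipsoid lies in the Taylor neighbourhood;
      the terms of the second derivative involving the transversal part are below \<eta>; the
      quadratic remainder of the exponential is below s^2 \<eta>; the exponents are at most 1, which
      also gives s^2 \<eta> \<le> 1.\<close>
    have "\<forall>\<^sub>F s in at_right 0. 0 < s \<and> s * 1 < 1 \<and> s * m < d \<and> s * (A * (2 * norm p + 1)) < \<eta>
       \<and> s * (\<kappa> + \<eta>)\<^sup>2 < \<eta> \<and> s * (\<kappa> + \<eta>) < (1::real)"
      using d(1) \<eta> by (intro eventually_conj small eventually_at_right_less) auto
    then obtain s where s: "0 < s" "s < 1" "s * m < d" "s * (A * (2 * norm p + 1)) < \<eta>"
       "s * (\<kappa> + \<eta>)\<^sup>2 < \<eta>" "s * (\<kappa> + \<eta>) < (1::real)"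
      using eventually_happens'[OF trivial_limit_at_right_real] by auto
    define N where "N = stretch_matrix k s p"
    define M where "M = stretch_inverse k s p"
    have MN: "M ** N = mat 1" "N ** M = mat 1"
      unfolding M_def N_def by (rule stretch_matrix_inverse[OF s(1) pk])+
    define T where "T w = (\<chi> i. if i = k then 0 else w $ i)" for w :: "complex ^ 'n"
    have Nw: "N *v w = s *\<^sub>R (w $ k *s p + s *\<^sub>R T w)" for w
      unfolding N_def T_def by (rule stretch_matrix_decomp)
    have bounds: "norm (T w) \<le> 1" "norm (w $ k *s p) \<le> norm p" "norm (N *v w) \<le> s * m" if w: "norm w < 1" for w
    proof -
      show T1: "norm (T w) \<le> 1" using norm_drop_coord_le[of k w] w by (simp add: T_def)
      have "norm (w $ k) \<le> 1" using Finite_Cartesian_Product.norm_nth_le[of w k] w by simp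
      then show P1: "norm (w $ k *s p) \<le> norm p" by (simp add: norm_smult_vec mult_left_le_one_le)
      have "norm (s *\<^sub>R T w) \<le> 1 * 1" unfolding norm_scaleR using s T1 by (intro mult_mono) auto
      then have "norm (w $ k *s p + s *\<^sub>R T w) \<le> m"
        unfolding m_def using P1 norm_triangle_ineq[of "w $ k *s p" "s *\<^sub>R T w"] by linarith
      then show "norm (N *v w) \<le> s * m" unfolding Nw using s by simp
    qed
    have in_\<Omega>: "z0 + N *v w \<in> \<Omega>" if w: "norm w < 1" for w
      using bounds(3)[OF w] s(3) by (intro d(2)) linarith
    have sub: "ellipsoid M z0 \<subseteq> \<Omega>"
      unfolding ellipsoid_eq_image[OF MN] using in_\<Omega> by auto
    have "pseudoconvex_subdomain (ellipsoid M z0) \<Omega>"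
      unfolding pseudoconvex_subdomain_def using Cn_domain_ellipsoid[OF MN] pseudoconvex_ellipsoid[OF MN] sub by blast
    then have dv: "sharp_L2_division C D (ellipsoid M z0) \<phi>" by (rule div)
    have cont: "continuous_on (ellipsoid M z0) \<phi>"
      using sub deriv1 has_derivative_continuous by (blast intro: continuous_at_imp_continuous_on)
    define b where "b = mixed_coeff z0 p"
    \<comment> \<open>The factor 1/2 compensates |e^h|^2 = exp(2 Re h). The constant, the first
      order term and the holomorphic square along p are removed from \<phi>.\<close>
    define h where "h w = (of_real (\<phi> z0) + complex_gradient z0 (N *v w) + b * of_real (s\<^sup>2) * (w $ k * w $ k)) * (1 / 2)" for w
    have h_hol: "holomorphic_Cn UNIV h"
    proof -
      have "holomorphic_Cn UNIV (\<lambda>w. complex_gradient z0 (0 + N *v w))"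
        by (rule holomorphic_Cn_compose_affine[OF holomorphic_Cn_linear[of _ UNIV]])
          (simp_all add: bounded_linear_complex_gradient complex_gradient_smult)
      then have "holomorphic_Cn UNIV (\<lambda>w. complex_gradient z0 (N *v w))" by simp
      then show ?thesis
        unfolding h_def[abs_def]
        by (intro holomorphic_Cn_mult holomorphic_Cn_add holomorphic_Cn_const holomorphic_Cn_coord)
    qed
    define y where "y w = \<phi> z0 + u' z0 (N *v w) + s\<^sup>2 * Re (b * (w $ k)\<^sup>2) - \<phi> (z0 + N *v w)" for w
    have exp_y: "(norm (exp (h w)))\<^sup>2 * exp (- \<phi> (z0 + N *v w)) = exp (y w)" for w
    proof -
      have "(norm (exp (h w)))\<^sup>2 = exp (2 * Re (h w))"
        by (simp add: power2_eq_square flip: exp_add)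
      moreover have "2 * Re (h w) = \<phi> z0 + u' z0 (N *v w) + s\<^sup>2 * Re (b * (w $ k)\<^sup>2)"
        by (simp add: h_def complex_gradient_def power2_eq_square field_simps)
      ultimately show ?thesis by (simp add: y_def flip: exp_add)
    qed
    \<comment> \<open>The Taylor remainder contributes s^2 \<eta>/2, and half of the error s^2
      \<eta> of the second derivative contributes the rest. The sign is positive because y contains
      -\<phi> and the Levi form at p is -\<kappa>.\<close>
    have y_est: "\<bar>y w - s\<^sup>2 * (\<kappa> * (norm (w $ k))\<^sup>2)\<bar> \<le> s\<^sup>2 * \<eta>" if w: "norm w < 1" for w
    proof -
      define P where "P = w $ k *s p"
      define Q where "Q = T w"
      have PQ: "norm P \<le> norm p" "norm Q \<le> 1" using bounds[OF w] by (simp_all add: P_def Q_def)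
      have bil: "\<bar>u'' z0 x x'\<bar> \<le> A * (norm x * norm x')" for x x'
      proof -
        have "\<bar>u'' z0 x x'\<bar> \<le> norm (u'' z0 x) * norm x'" using norm_blinfun by (metis real_norm_def)
        also have "\<dots> \<le> (A * norm x) * norm x'" unfolding A_def by (intro mult_right_mono norm_blinfun) simp
        finally show ?thesis by (simp add: mult.assoc)
      qed
      have Nw': "N *v w = s *\<^sub>R (P + s *\<^sub>R Q)" by (simp add: Nw P_def Q_def)
      have e1: "\<bar>\<phi> (z0 + N *v w) - \<phi> z0 - u' z0 (N *v w) - u'' z0 (N *v w) (N *v w) / 2\<bar> \<le> s\<^sup>2 * \<eta> / 2"
      proof -
        have "\<bar>\<phi> (z0 + N *v w) - \<phi> z0 - u' z0 (N *v w) - u'' z0 (N *v w) (N *v w) / 2\<bar> \<le> (\<eta> / (2 * m\<^sup>2)) * (norm (N *v w))\<^sup>2"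
          using bounds(3)[OF w] s(3) by (intro d(3)) linarith
        also have "\<dots> \<le> (\<eta> / (2 * m\<^sup>2)) * (s * m)\<^sup>2"
          using bounds(3)[OF w] \<eta> m by (intro mult_left_mono power_mono) auto
        also have "\<dots> = s\<^sup>2 * \<eta> / 2" using m by (simp add: power_mult_distrib field_simps)
        finally show ?thesis .
      qed
      have e2: "\<bar>u'' z0 (N *v w) (N *v w) - s\<^sup>2 * u'' z0 P P\<bar> \<le> s\<^sup>2 * \<eta>"
      proof -
        have "u'' z0 (N *v w) (N *v w) - s\<^sup>2 * u'' z0 P P = s\<^sup>2 * (s * (u'' z0 P Q + u'' z0 Q P + s * u'' z0 Q Q))"
          unfolding Nw' by (simp add: bilinear_simps power2_eq_square algebra_simps)
        also have "\<bar>\<dots>\<bar> \<le> s\<^sup>2 * (s * (A * (2 * norm p + 1)))"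
        proof -
          have A0: "A \<ge> 0" by (simp add: A_def)
          have 1: "\<bar>u'' z0 P Q\<bar> \<le> A * (norm p * 1)" "\<bar>u'' z0 Q P\<bar> \<le> A * (1 * norm p)" "\<bar>u'' z0 Q Q\<bar> \<le> A * (1 * 1)"
            by (rule order_trans[OF bil mult_left_mono[OF mult_mono A0]]; use PQ in simp)+
          have 2: "\<bar>s * u'' z0 Q Q\<bar> \<le> 1 * (A * (1 * 1))"
            unfolding abs_mult using 1(3) s by (intro mult_mono) auto
          have "\<bar>u'' z0 P Q + u'' z0 Q P + s * u'' z0 Q Q\<bar> \<le> A * (2 * norm p + 1)"
            using 1 2 by (simp add: algebra_simps)
          then show ?thesis using s(1) by (simp add: abs_mult)
        qed
        also have "\<dots> \<le> s\<^sup>2 * \<eta>" using s by (intro mult_left_mono) auto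
        finally show ?thesis .
      qed
      have "u'' z0 P P / 2 = Re (b * (w $ k)\<^sup>2) - \<kappa> * (norm (w $ k))\<^sup>2"
        unfolding P_def b_def \<kappa>_def second_order_complex_line by simp
      then have "u'' z0 P P = 2 * Re (b * (w $ k)\<^sup>2) - 2 * (\<kappa> * (norm (w $ k))\<^sup>2)" by linarith
      then have "s\<^sup>2 * u'' z0 P P = 2 * (s\<^sup>2 * Re (b * (w $ k)\<^sup>2)) - 2 * (s\<^sup>2 * (\<kappa> * (norm (w $ k))\<^sup>2))"
        by (simp only: right_diff_distrib mult.left_commute[of "s\<^sup>2" 2])
      then show ?thesis using e1 e2 unfolding y_def by linarith
    qed
    have q1: "s\<^sup>2 \<le> s" using s by (simp add: power2_eq_square)
    have q2: "s\<^sup>2 * (\<kappa> + \<eta>) < 1"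
    proof -
      have "s\<^sup>2 * (\<kappa> + \<eta>) \<le> s * (\<kappa> + \<eta>)" using q1 \<kappa> \<eta> by (intro mult_right_mono) auto
      then show ?thesis using s(6) by linarith
    qed
    have q3: "s\<^sup>2 * \<eta> \<le> 1"
    proof -
      have "s\<^sup>2 * \<eta> \<le> s\<^sup>2 * (\<kappa> + \<eta>)" using \<kappa> by (intro mult_left_mono) auto
      then show ?thesis using q2 by linarith
    qed
    have wk: "(norm (w $ k))\<^sup>2 \<le> 1" if "norm w < 1" for w :: "complex ^ 'n"
    proof -
      have "norm (w $ k) \<le> 1" using Finite_Cartesian_Product.norm_nth_le[of w k] that by simp
      then show ?thesis by (simp add: abs_square_le_1)
    qed
    have "(\<integral>\<^sup>+w. ennreal (1 + s\<^sup>2 * (\<kappa> * (norm (w $ k))\<^sup>2 - \<eta>)) * div_weight (w :: complex ^ 'n) \<partial>lborel)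
      \<le> (\<integral>\<^sup>+w. ennreal ((norm (w $ a))\<^sup>2 * (1 + s\<^sup>2 * (\<kappa> * (norm (w $ k))\<^sup>2 + 2 * \<eta>))) * data_weight (w :: complex ^ 'n) \<partial>lborel)"
    proof (rule division_weight_inequality[OF n MN dv cont h_hol])
      fix w :: "complex ^ 'n" assume w: "norm w < 1"
      note ye = y_est[OF w]
      have "1 + s\<^sup>2 * (\<kappa> * (norm (w $ k))\<^sup>2 - \<eta>) \<le> 1 + y w" using ye by (simp add: algebra_simps abs_le_iff)
      also have "\<dots> \<le> exp (y w)" by (rule exp_ge_add_one_self)
      finally show "1 + s\<^sup>2 * (\<kappa> * (norm (w $ k))\<^sup>2 - \<eta>) \<le> (norm (exp (h w)))\<^sup>2 * exp (- \<phi> (z0 + N *v w))"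
        by (simp only: exp_y)
      have "0 \<le> s\<^sup>2 * (\<kappa> * (norm (w $ k))\<^sup>2)" using \<kappa> by simp
      then show "0 \<le> 1 + s\<^sup>2 * (\<kappa> * (norm (w $ k))\<^sup>2 - \<eta>)" using q3 by (simp add: right_diff_distrib)
      \<comment> \<open>The lower barrier came from e^y \<ge> 1 + y. For the upper one, e^Y \<le> 1
        + Y + Y^2 with Y^2 \<le> s^2 \<eta>, which explains the 2 \<eta> there against \<eta>
        below.\<close>
      define Y where "Y = s\<^sup>2 * (\<kappa> * (norm (w $ k))\<^sup>2 + \<eta>)"
      have Y0: "0 \<le> Y" using \<kappa> \<eta> by (simp add: Y_def)
      have "\<kappa> * (norm (w $ k))\<^sup>2 + \<eta> \<le> \<kappa> + \<eta>" using wk[OF w] \<kappa> by simp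
      then have Y1: "Y \<le> s\<^sup>2 * (\<kappa> + \<eta>)" unfolding Y_def by (intro mult_left_mono) auto
      have "exp (y w) \<le> exp Y" using ye by (simp add: Y_def algebra_simps abs_le_iff)
      also have "\<dots> \<le> 1 + Y + Y\<^sup>2" using Y0 Y1 q2 by (intro exp_bound) auto
      also have "Y\<^sup>2 \<le> s\<^sup>2 * \<eta>"
      proof -
        have "Y\<^sup>2 \<le> (s\<^sup>2 * (\<kappa> + \<eta>))\<^sup>2" using Y0 Y1 by (intro power_mono)
        also have "\<dots> = s\<^sup>2 * (s\<^sup>2 * (\<kappa> + \<eta>)\<^sup>2)" by (simp add: power2_eq_square mult_ac)
        also have "\<dots> \<le> s\<^sup>2 * (s * (\<kappa> + \<eta>)\<^sup>2)" using q1 by (intro mult_left_mono mult_right_mono) auto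
        also have "\<dots> \<le> s\<^sup>2 * \<eta>" using s by (intro mult_left_mono) auto
        finally show ?thesis .
      qed
      finally show "(norm (exp (h w)))\<^sup>2 * exp (- \<phi> (z0 + N *v w)) \<le> 1 + s\<^sup>2 * (\<kappa> * (norm (w $ k))\<^sup>2 + 2 * \<eta>)"
        unfolding exp_y by (simp add: Y_def algebra_simps)
      have "\<kappa> * (norm (w $ k))\<^sup>2 \<le> \<kappa>" using wk[OF w] \<kappa> by simp
      then show "1 + s\<^sup>2 * (\<kappa> * (norm (w $ k))\<^sup>2 + 2 * \<eta>) \<le> 1 + s\<^sup>2 * (\<kappa> + 2 * \<eta>)"
        by (intro add_left_mono mult_left_mono) auto
    qed (simp_all add: norm_mult)
    then show ?thesis
      using s(1) q3 \<kappa> \<eta> by (intro moment_inequality[OF n ak, of "s\<^sup>2"]) auto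
  qed
  define X where "X = \<kappa> * enn2real (moment TYPE('n) (CARD('n) - 2)) * (CARD('n) - 1)"
  define Z where "Z = 3 * (real CARD('n))\<^sup>2 * enn2real (moment TYPE('n) (CARD('n) - 1))"
  have "X > 0"
    using \<kappa> n moment_pos[where 'n = 'n, of "CARD('n) - 2"] moment_finite[where 'n = 'n, of "CARD('n) - 2"]
    by (simp add: X_def enn2real_positive_iff)
  have "Z \<ge> 0" by (simp add: Z_def)
  have "X \<le> \<eta> * Z" if "\<eta> > 0" for \<eta>
    using key[OF that] by (simp add: X_def Z_def mult_ac)
  \<comment> \<open>X is positive because \<kappa>, n-1 and the moment are, so this \<eta> is
    admissible, and it makes \<eta> Z smaller than X.\<close>
  from this[of "X / (2 * (Z + 1))"] have "X \<le> X / (2 * (Z + 1)) * Z"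
    using \<open>X > 0\<close> \<open>Z \<ge> 0\<close> by simp
  also have "\<dots> < X"
  proof -
    have "0 < X * Z + X * 2"
      using \<open>X > 0\<close> \<open>Z \<ge> 0\<close> by (intro add_nonneg_pos mult_nonneg_nonneg) auto
    then show ?thesis using \<open>Z \<ge> 0\<close> by (simp add: field_simps)
  qed
  finally show False by simp
qed

end

subsection \<open>Nonnegative Levi form implies plurisubharmonicity\<close>

context twice_differentiable
begin

lemma curve_has_derivative:
  assumes P: "(P has_vector_derivative P1) (at t within S)" and z: "z + P t \<in> \<Omega>"
  shows "((\<lambda>t. u (z + P t)) has_real_derivative u' (z + P t) P1) (at t within S)"
proof -
  have "((\<lambda>t. z + P t) has_derivative (\<lambda>h. h *\<^sub>R P1)) (at t within S)"
    using P by (auto intro!: derivative_eq_intros simp: has_vector_derivative_def)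
  from has_derivative_compose[OF this deriv1[OF z]] show ?thesis
    by (simp add: has_field_derivative_def blinfun.scaleR_right mult_commute_abs)
qed

lemma curve_has_derivative2:
  assumes P: "(P has_vector_derivative P1) (at t within S)" and Q: "(Q has_vector_derivative Q1) (at t within S)"
    and z: "z + P t \<in> \<Omega>"
  shows "((\<lambda>t. u' (z + P t) (Q t)) has_real_derivative u'' (z + P t) P1 (Q t) + u' (z + P t) Q1) (at t within S)"
proof -
  have "((\<lambda>t. z + P t) has_derivative (\<lambda>h. h *\<^sub>R P1)) (at t within S)"
    using P by (auto intro!: derivative_eq_intros simp: has_vector_derivative_def)
  from has_derivative_compose[OF this deriv2[OF z]]
  have 1: "((\<lambda>t. u' (z + P t)) has_derivative (\<lambda>h. u'' (z + P t) (h *\<^sub>R P1))) (at t within S)" .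
  have 2: "(Q has_derivative (\<lambda>h. h *\<^sub>R Q1)) (at t within S)"
    using Q by (simp add: has_vector_derivative_def)
  have eq: "(\<lambda>h. u' (z + P t) (h *\<^sub>R Q1) + u'' (z + P t) (h *\<^sub>R P1) (Q t)) = (*) (u'' (z + P t) P1 (Q t) + u' (z + P t) Q1)"
    by (simp add: fun_eq_iff blinfun.scaleR_right blinfun.scaleR_left algebra_simps)
  from bounded_bilinear.FDERIV[OF bounded_bilinear_blinfun_apply 1 2] show ?thesis
    unfolding has_field_derivative_def eq .
qed

lemma continuous_on_dom: "continuous_on \<Omega> u" "continuous_on \<Omega> u'"
  using deriv1 deriv2 has_derivative_continuous
  by (blast intro: continuous_at_imp_continuous_on)+

end

context twice_differentiable_Cn
begin

text \<open>In the coordinates \<open>e\<^sup>s\<^sup>+\<^sup>i\<^sup>\<theta>\<close> the Laplacian is a positive multiple of \<open>\<partial>\<^sub>s\<^sup>2 + \<partial>\<^sub>\<theta>\<^sup>2\<close>, so the circle means are convex in \<open>s\<close>;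
  their derivative vanishes at \<open>-\<infinity>\<close>.\<close>

lemma submean_of_levi_nonneg:
  assumes cont2: "continuous_on \<Omega> u''" and levi: "\<And>z v. z \<in> \<Omega> \<Longrightarrow> 0 \<le> levi_form z v"
    and disc: "\<And>\<tau>. norm \<tau> \<le> 1 \<Longrightarrow> z + \<tau> *s v \<in> \<Omega>"
  shows "2 * pi * u z \<le> integral {0..2*pi} (\<lambda>\<theta>. u (z + cis \<theta> *s v))"
proof -
  \<comment> \<open>P is e^(s+i\<theta>) v, hence its derivatives are P in s and \<i> P in \<theta>;
    every derivative of u along the circles is thus expressed through P itself.\<close>
  define P where "P s \<theta> = (of_real (exp s) * cis \<theta>) *s v" for s \<theta>
  have dom: "z + P s \<theta> \<in> \<Omega>" if "s \<le> 0" for s \<theta>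
    unfolding P_def using that by (intro disc) (simp add: norm_mult)
  have z: "z \<in> \<Omega>" using disc[of 0] by simp
  have Ps: "((\<lambda>s. P s \<theta>) has_vector_derivative P s \<theta>) (at s within S)" for s \<theta> S
  proof -
    have "((\<lambda>s. of_real (exp s) * cis \<theta>) has_vector_derivative of_real (exp s) * cis \<theta>) (at s within S)"
      by (auto intro!: derivative_eq_intros simp: has_vector_derivative_def scaleR_conv_of_real)
    then show ?thesis unfolding P_def
      by (rule bounded_linear.has_vector_derivative[OF bounded_linear_smult_vec])
  qed
  have P\<theta>: "((\<lambda>\<theta>. P s \<theta>) has_vector_derivative \<i> *s P s \<theta>) (at \<theta> within S)" for s \<theta> S
  proof -
    have "((\<lambda>\<theta>. of_real (exp s) * cis \<theta>) has_vector_derivative of_real (exp s) * (\<i> * cis \<theta>)) (at \<theta> within S)"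
    proof -
      have "((\<lambda>x. of_real (exp s) * exp (\<i> * x)) has_field_derivative of_real (exp s) * (\<i> * exp (\<i> * of_real \<theta>))) (at (of_real \<theta>))"
        by (auto intro!: derivative_eq_intros)
      from has_vector_derivative_real_field[OF this] show ?thesis by (simp add: cis_conv_exp)
    qed
    from bounded_linear.has_vector_derivative[OF bounded_linear_smult_vec this, of v]
    show ?thesis by (simp add: P_def vector_smult_assoc mult_ac)
  qed
  have iP\<theta>: "((\<lambda>\<theta>. \<i> *s P s \<theta>) has_vector_derivative - P s \<theta>) (at \<theta> within S)" for s \<theta> S
    using bounded_linear.has_vector_derivative[OF bounded_linear_i_smult P\<theta>[of s \<theta> S]] by (simp add: i_smult)
  define W where "W = {..(0::real)} \<times> cbox 0 (2*pi)"
  have Pc: "continuous_on W (\<lambda>x. P (fst x) (snd x))"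
    unfolding P_def by (intro continuous_intros)
  have zP: "(\<lambda>x. z + P (fst x) (snd x)) ` W \<subseteq> \<Omega>" using dom by (auto simp: W_def)
  note cz = continuous_on_compose2[OF _ continuous_on_add[OF continuous_on_const Pc] zP]
  have Uc: "continuous_on W (\<lambda>x. u (z + P (fst x) (snd x)))" by (rule cz[OF continuous_on_dom(1)])
  have U1c: "continuous_on W (\<lambda>x. u' (z + P (fst x) (snd x)) (P (fst x) (snd x)))"
    by (intro continuous_intros cz[OF continuous_on_dom(2)] Pc)
  have U2c: "continuous_on W (\<lambda>x. u'' (z + P (fst x) (snd x)) (P (fst x) (snd x)) (P (fst x) (snd x))
      + u' (z + P (fst x) (snd x)) (P (fst x) (snd x)))"
    by (intro continuous_intros cz[OF continuous_on_dom(2)] cz[OF cont2] Pc)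
  have slice: "(\<lambda>\<theta>. f s \<theta>) integrable_on cbox 0 (2*pi)" if "continuous_on W (\<lambda>x. f (fst x) (snd x))" "s \<le> 0"
    for f :: "real \<Rightarrow> real \<Rightarrow> real" and s
  proof -
    have "continuous_on (cbox 0 (2*pi)) (\<lambda>\<theta>. f (fst (s, \<theta>)) (snd (s, \<theta>)))"
      by (rule continuous_on_compose2[OF that(1)]) (use that(2) in \<open>auto simp: W_def intro!: continuous_intros\<close>)
    then show ?thesis by (intro integrable_continuous) simp
  qed
  \<comment> \<open>A is 2 pi times the mean over the circle of radius e^s; B and E are its first
    and second derivatives in s.\<close>
  define A where "A s = integral (cbox 0 (2*pi)) (\<lambda>\<theta>. u (z + P s \<theta>))" for s
  define B where "B s = integral (cbox 0 (2*pi)) (\<lambda>\<theta>. u' (z + P s \<theta>) (P s \<theta>))" for s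
  define E where "E s = integral (cbox 0 (2*pi)) (\<lambda>\<theta>. u'' (z + P s \<theta>) (P s \<theta>) (P s \<theta>) + u' (z + P s \<theta>) (P s \<theta>))" for s
  have dA: "(A has_real_derivative B s) (at s within {..0})" if s: "s \<le> 0" for s
    unfolding A_def[abs_def] B_def
  proof (rule leibniz_rule_field_derivative)
    show "continuous_on ({..0} \<times> cbox 0 (2*pi)) (\<lambda>(s, \<theta>). u' (z + P s \<theta>) (P s \<theta>))"
      using U1c by (simp add: W_def split_beta')
  qed (use s dom Ps in \<open>auto intro!: curve_has_derivative slice[OF Uc, unfolded cbox_interval]\<close>)
  have dB: "(B has_real_derivative E s) (at s within {..0})" if s: "s \<le> 0" for s
    unfolding B_def[abs_def] E_def
  proof (rule leibniz_rule_field_derivative)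
    show "continuous_on ({..0} \<times> cbox 0 (2*pi)) (\<lambda>(s, \<theta>). u'' (z + P s \<theta>) (P s \<theta>) (P s \<theta>) + u' (z + P s \<theta>) (P s \<theta>))"
      using U2c by (simp add: W_def split_beta')
  qed (use s dom Ps in \<open>auto intro!: curve_has_derivative2 slice[OF U1c, unfolded cbox_interval]\<close>)
  \<comment> \<open>The second \<theta>-derivative of u integrates to 0 over a period. Adding it
    cancels the first order terms and turns E into the integral of four times the Levi form at
    P.\<close>
  have E_nonneg: "0 \<le> E s" if s: "s \<le> 0" for s
  proof -
    have per: "P s (2*pi) = P s 0" by (simp add: P_def)
    have "((\<lambda>\<theta>. u'' (z + P s \<theta>) (\<i> *s P s \<theta>) (\<i> *s P s \<theta>) + u' (z + P s \<theta>) (- P s \<theta>))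
        has_integral (u' (z + P s (2*pi)) (\<i> *s P s (2*pi)) - u' (z + P s 0) (\<i> *s P s 0))) {0..2*pi}"
    proof (rule fundamental_theorem_of_calculus)
      fix \<theta>
      show "((\<lambda>\<theta>. u' (z + P s \<theta>) (\<i> *s P s \<theta>)) has_vector_derivative
          u'' (z + P s \<theta>) (\<i> *s P s \<theta>) (\<i> *s P s \<theta>) + u' (z + P s \<theta>) (- P s \<theta>)) (at \<theta> within {0..2*pi})"
        unfolding has_real_derivative_iff_has_vector_derivative[symmetric]
        by (rule curve_has_derivative2[OF P\<theta> iP\<theta> dom[OF s]])
    qed simp
    then have 1: "((\<lambda>\<theta>. u'' (z + P s \<theta>) (\<i> *s P s \<theta>) (\<i> *s P s \<theta>) - u' (z + P s \<theta>) (P s \<theta>)) has_integral 0) {0..2*pi}"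
      by (simp add: per bilinear_simps)
    have 2: "((\<lambda>\<theta>. u'' (z + P s \<theta>) (P s \<theta>) (P s \<theta>) + u' (z + P s \<theta>) (P s \<theta>)) has_integral E s) {0..2*pi}"
      unfolding E_def cbox_interval by (rule integrable_integral[OF slice[OF U2c s, unfolded cbox_interval]])
    have "0 \<le> 0 + E s"
    proof (rule has_integral_nonneg[OF has_integral_add[OF 1 2]])
      fix \<theta>
      show "0 \<le> u'' (z + P s \<theta>) (\<i> *s P s \<theta>) (\<i> *s P s \<theta>) - u' (z + P s \<theta>) (P s \<theta>)
          + (u'' (z + P s \<theta>) (P s \<theta>) (P s \<theta>) + u' (z + P s \<theta>) (P s \<theta>))"
        using levi[OF dom[OF s], of \<theta> "P s \<theta>"] by (simp add: levi_form_def add.commute)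
    qed
    then show ?thesis by simp
  qed
  have near: "\<exists>s0\<le>0. \<forall>s\<le>s0. \<forall>\<theta>. f (z + P s \<theta>) \<in> X" if f: "isCont f z" and X: "open X" "f z \<in> X"
    for f :: "complex ^ 'n \<Rightarrow> 'b::topological_space" and X
  proof -
    have "\<forall>\<^sub>F y in nhds z. f y \<in> X"
    proof -
      have "(f \<longlongrightarrow> f z) (nhds z)" using f by (simp add: isCont_def tendsto_at_iff_tendsto_nhds)
      then show ?thesis using X by (rule topological_tendstoD)
    qed
    then obtain d where d: "d > 0" "\<And>y. dist y z < d \<Longrightarrow> f y \<in> X" by (auto simp: eventually_nhds_metric)
    have "((\<lambda>s. exp s * norm v) \<longlongrightarrow> 0) at_bot"
      by (rule tendsto_mult_left_zero[OF exp_at_bot])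
    from order_tendstoD(2)[OF this d(1)] obtain s0 where s0: "\<And>s. s \<le> s0 \<Longrightarrow> exp s * norm v < d"
      by (auto simp: eventually_at_bot_linorder)
    have "f (z + P s \<theta>) \<in> X" if "s \<le> min s0 0" for s \<theta>
      using s0[of s] that by (intro d(2)) (simp add: dist_norm P_def norm_smult_vec norm_mult)
    then show ?thesis by (intro exI[of _ "min s0 0"]) auto
  qed
  \<comment> \<open>B is nondecreasing because its derivative E is nonnegative, and |B| is at most a
    constant times e^s for very negative s. A negative value would persist as s tends to minus
    infinity.\<close>
  have B_nonneg: "0 \<le> B s" if s: "s \<le> 0" for s
  proof (rule ccontr)
    assume neg: "\<not> 0 \<le> B s"
    have "isCont u' z" using deriv2[OF z] has_derivative_continuous by blast
    then obtain s0 where s0: "s0 \<le> 0" "\<And>s \<theta>. s \<le> s0 \<Longrightarrow> u' (z + P s \<theta>) \<in> ball (u' z) 1"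
      using near[of u' "ball (u' z) 1"] by auto
    define K where "K = (norm (u' z) + 1) * norm v"
    have B_bd: "- (exp t * K * (2 * pi)) \<le> B t" if t: "t \<le> s0" for t
    proof -
      have t0: "t \<le> 0" using t s0 by simp
      have "norm (B t) \<le> exp t * K * measure lborel (cbox 0 (2*pi))"
        unfolding B_def
      proof (rule integrable_bound[OF _ slice[OF U1c t0]])
        fix \<theta>
        have "norm (u' (z + P t \<theta>)) \<le> norm (u' z) + 1"
          using s0(2)[OF t, of \<theta>] norm_triangle_ineq2[of "u' (z + P t \<theta>)" "u' z"]
          by (simp add: dist_norm norm_minus_commute)
        moreover have "norm (P t \<theta>) = exp t * norm v" by (simp add: P_def norm_smult_vec norm_mult)
        ultimately have "norm (u' (z + P t \<theta>)) * norm (P t \<theta>) \<le> (norm (u' z) + 1) * (exp t * norm v)"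
          by (metis mult_right_mono norm_ge_zero)
        then show "norm (u' (z + P t \<theta>) (P t \<theta>)) \<le> exp t * K"
          using norm_blinfun[of "u' (z + P t \<theta>)" "P t \<theta>"] by (simp add: K_def mult_ac)
      qed (simp add: K_def)
      then show ?thesis by simp
    qed
    have "((\<lambda>t. - (exp t * K * (2 * pi))) \<longlongrightarrow> 0) at_bot"
      using tendsto_minus[OF tendsto_mult_left_zero[OF tendsto_mult_left_zero[OF exp_at_bot]]] by simp
    from order_tendstoD(1)[OF this, of "B s"] neg
    have "\<forall>\<^sub>F t in at_bot. B s < - (exp t * K * (2 * pi))" by simp
    then obtain t where t: "t \<le> min s s0" "B s < - (exp t * K * (2 * pi))"
      by (auto simp: eventually_at_bot_linorder) (metis min.cobounded1 min.cobounded2 min.bounded_iff)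
    then have "B s < B t" using B_bd[of t] by simp
    moreover have "B t \<le> B s"
    proof -
      have "\<exists>x\<in>{t..s}. B s - B t = E x * (s - t)"
        using t s by (intro mvt_very_simple) (auto intro!: has_derivative_subset[OF dB[unfolded has_field_derivative_def]])
      then show ?thesis using E_nonneg s t by (metis atLeastAtMost_iff diff_ge_0_iff_ge min.boundedE mult_nonneg_nonneg order_trans)
    qed
    ultimately show False by simp
  qed
  have A_mono: "A s \<le> A 0" if s: "s \<le> 0" for s
  proof -
    have "\<exists>x\<in>{s..0}. A 0 - A s = B x * (0 - s)"
      using s by (intro mvt_very_simple) (auto intro!: has_derivative_subset[OF dA[unfolded has_field_derivative_def]])
    then show ?thesis using B_nonneg s by (metis atLeastAtMost_iff diff_ge_0_iff_ge mult_nonneg_nonneg)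
  qed
  \<comment> \<open>For s near minus infinity the circle shrinks to z, so A is nearly at least 2 pi
    u(z) by continuity; monotonicity carries this to s = 0.\<close>
  have "2 * pi * u z \<le> A 0 + e" if e: "e > 0" for e
  proof -
    define e' where "e' = e / (2 * pi)"
    have e': "e' > 0" using e by (simp add: e'_def)
    have "isCont u z" using deriv1[OF z] has_derivative_continuous by blast
    then obtain s0 where s0: "s0 \<le> 0" "\<And>s \<theta>. s \<le> s0 \<Longrightarrow> u z - e' < u (z + P s \<theta>)"
      using near[of u "{u z - e'<..}"] e' by auto
    have "((\<lambda>_. u z - e') has_integral (2 * pi * (u z - e'))) {0..2*pi}"
      using has_integral_const_real[of "u z - e'" 0 "2*pi"] by simp
    moreover have "((\<lambda>\<theta>. u (z + P s0 \<theta>)) has_integral A s0) {0..2*pi}"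
      unfolding A_def cbox_interval by (rule integrable_integral[OF slice[OF Uc s0(1), unfolded cbox_interval]])
    ultimately have "2 * pi * (u z - e') \<le> A s0"
      by (rule has_integral_le) (use s0(2)[of s0] in \<open>auto simp: less_imp_le\<close>)
    then show ?thesis using A_mono[OF s0(1)] by (simp add: e'_def algebra_simps)
  qed
  then have "2 * pi * u z \<le> A 0" by (rule field_le_epsilon)
  then show ?thesis by (simp add: A_def P_def)
qed

end

text \<open>Jensen's inequality through the tangent of exp at u(z): integrating e^x \<ge> e^(u(z))
  (1 + x - u(z)) over the circle leaves at least 2 pi e^(u(z)).\<close>

lemma plurisubharmonic_on_exp:
  fixes u :: "complex ^ 'n \<Rightarrow> real"
  assumes cont: "continuous_on \<Omega> u" and psh: "plurisubharmonic_on \<Omega> u"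
  shows "plurisubharmonic_on \<Omega> (\<lambda>z. exp (u z))"
proof (rule plurisubharmonic_onI)
  show ce: "continuous_on \<Omega> (\<lambda>z. exp (u z))" using cont by (intro continuous_intros)
  fix z v assume disc: "\<And>\<tau>. norm \<tau> \<le> 1 \<Longrightarrow> z + \<tau> *s v \<in> \<Omega>"
  define I where "I = integral {0..2*pi} (\<lambda>\<theta>. u (z + cis \<theta> *s v))"
  have uI: "((\<lambda>\<theta>. u (z + cis \<theta> *s v)) has_integral I) {0..2*pi}"
    unfolding I_def by (rule integrable_integral[OF circle_integrable[OF cont disc]])
  have "u z \<le> 1 / (2 * pi) * I"
    using psh disc unfolding plurisubharmonic_on_def I_def by blast
  then have I: "2 * pi * u z \<le> I" by (simp add: field_simps)
  have c: "((\<lambda>_. 1 - u z) has_integral (2 * pi * (1 - u z))) {0..2*pi}"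
    using has_integral_const_real[of "1 - u z" 0 "2*pi"] by simp
  have "((\<lambda>\<theta>. exp (u z) * ((1 - u z) + u (z + cis \<theta> *s v))) has_integral exp (u z) * (2 * pi * (1 - u z) + I)) {0..2*pi}"
    by (intro has_integral_mult_right has_integral_add c uI)
  moreover have "((\<lambda>\<theta>. exp (u (z + cis \<theta> *s v))) has_integral integral {0..2*pi} (\<lambda>\<theta>. exp (u (z + cis \<theta> *s v)))) {0..2*pi}"
    by (rule integrable_integral[OF circle_integrable[OF ce disc]])
  ultimately have "exp (u z) * (2 * pi * (1 - u z) + I) \<le> integral {0..2*pi} (\<lambda>\<theta>. exp (u (z + cis \<theta> *s v)))"
  proof (rule has_integral_le)
    fix \<theta>
    have "exp (u z) * (1 + (u (z + cis \<theta> *s v) - u z)) \<le> exp (u z) * exp (u (z + cis \<theta> *s v) - u z)"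
      by (intro mult_left_mono exp_ge_add_one_self) simp
    then show "exp (u z) * ((1 - u z) + u (z + cis \<theta> *s v)) \<le> exp (u (z + cis \<theta> *s v))"
      by (simp add: algebra_simps flip: exp_add)
  qed
  moreover have "exp (u z) * (2 * pi) \<le> exp (u z) * (2 * pi * (1 - u z) + I)"
    using I by (intro mult_left_mono) (simp_all add: algebra_simps)
  ultimately have "exp (u z) * (2 * pi) \<le> integral {0..2*pi} (\<lambda>\<theta>. exp (u (z + cis \<theta> *s v)))"
    by linarith
  then show "2 * pi * exp (u z) \<le> integral {0..2*pi} (\<lambda>\<theta>. exp (u (z + cis \<theta> *s v)))"
    by (simp only: mult.commute)
qed

section \<open>Consequences of a nonnegative Levi form\<close>

context twice_differentiable_Cn
begin

lemma plurisubharmonic_of_levi_nonneg: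
  assumes "continuous_on \<Omega> u''" "\<And>z v. z \<in> \<Omega> \<Longrightarrow> 0 \<le> levi_form z v"
  shows "plurisubharmonic_on \<Omega> u"
  by (rule plurisubharmonic_onI[OF continuous_on_dom(1)]) (rule submean_of_levi_nonneg[OF assms])

text \<open>The gradient matrix has the entries d_j times the conjugate of d_k, so it adds the
  square of the modulus of the sum of d_j v_j to the Levi form.\<close>

lemma pos_semidef_levi_grad:
  assumes z: "z \<in> \<Omega>" and levi: "\<And>v. 0 \<le> levi_form z v"
  shows "pos_semidef (levi_matrix u z + grad_matrix u z)"
  unfolding pos_semidef_def
proof (intro conjI allI)
  define d where "d j = wirt j (\<lambda>w. complex_of_real (u w)) z" for j
  have grad: "grad_matrix u z $ j $ k = d j * cnj (d k)" for j k
    by (simp add: grad_matrix_def d_def wirt_bar_eq[OF z])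
  show "(levi_matrix u z + grad_matrix u z) $ j $ k = cnj ((levi_matrix u z + grad_matrix u z) $ k $ j)" for j k
    using levi_matrix_hermitian[OF z, of j k] by (simp add: grad)
  fix v :: "complex ^ 'n"
  define c where "c = (\<Sum>j\<in>UNIV. d j * v $ j)"
  have "(\<Sum>j\<in>UNIV. \<Sum>k\<in>UNIV. grad_matrix u z $ j $ k * v $ j * cnj (v $ k)) = c * cnj c"
    by (simp add: c_def grad sum_product mult_ac)
  then have "Re (\<Sum>j\<in>UNIV. \<Sum>k\<in>UNIV. (levi_matrix u z + grad_matrix u z) $ j $ k * v $ j * cnj (v $ k))
    = levi_form z v + Re (c * cnj c)"
    by (simp add: distrib_right sum.distrib levi_matrix_form[OF z, symmetric] del: Re_sum)
  also have "\<dots> \<ge> 0" using levi[of v] by simp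
  finally show "0 \<le> Re (\<Sum>j\<in>UNIV. \<Sum>k\<in>UNIV. (levi_matrix u z + grad_matrix u z) $ j $ k * v $ j * cnj (v $ k))" .
qed

text \<open>An eigenvector with eigenvalue l would give the Levi form the value l |v|^2. The form is
  tested on the conjugate of v, because it pairs the second index of the matrix with conjugated
  entries while the matrix product does not.\<close>

lemma neg_eigenvalue_count_levi:
  assumes z: "z \<in> \<Omega>" and levi: "\<And>v. 0 \<le> levi_form z v"
  shows "neg_eigenvalue_count (levi_matrix u z) = 0"
proof -
  have False if l: "l < 0" and v: "v \<noteq> 0" "levi_matrix u z *v v = complex_of_real l *s v" for l v
  proof -
    have "(\<Sum>j\<in>UNIV. \<Sum>k\<in>UNIV. levi_matrix u z $ j $ k * cnj (v $ j) * v $ k)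
      = (\<Sum>j\<in>UNIV. cnj (v $ j) * (levi_matrix u z *v v) $ j)"
      by (simp add: matrix_vector_mult_def sum_distrib_left mult_ac)
    also have "\<dots> = (\<Sum>j\<in>UNIV. complex_of_real (l * (norm (v $ j))\<^sup>2))"
      unfolding v(2) by (intro sum.cong) (auto simp: complex_norm_square mult_ac simp del: of_real_power)
    also have "\<dots> = complex_of_real (l * (norm v)\<^sup>2)"
      by (simp only: norm_vec_sq sum_distrib_left of_real_sum)
    finally have "levi_form z (\<chi> j. cnj (v $ j)) = l * (norm v)\<^sup>2"
      unfolding levi_matrix_form[OF z, symmetric] by simp
    moreover have "l * (norm v)\<^sup>2 < 0" using l v(1) by (simp add: mult_neg_pos)
    ultimately show False using levi[of "\<chi> j. cnj (v $ j)"] by simp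
  qed
  then have empty: "{l::real. l < 0 \<and> (\<exists>v. v \<noteq> 0 \<and> levi_matrix u z *v v = complex_of_real l *s v)} = {}" by blast
  then show ?thesis unfolding neg_eigenvalue_count_def empty by simp
qed

end

lemma weight_pair_of_G_class:
  assumes "(C, D, S) \<in> G_class" "sharp_condition D"
  shows "weight_pair C D"
proof
  have "smooth_real_on {..<0} C" using assms by (simp add: G_class_def)
  then have "C field_differentiable (at t)" if "t < 0" for t
    using that by (force simp: smooth_real_on_def dest: spec[of _ "0::nat"])
  then show "continuous_on {..<0} C"
    by (intro continuous_at_imp_continuous_on) (simp add: field_differentiable_imp_continuous_at)
qed (use assms in \<open>auto simp: G_class_def sharp_condition_def\<close>)

theorem theoremB:
  fixes C D S :: "real \<Rightarrow> real"
    and \<Omega> :: "(complex ^ 'n) set"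
    and \<phi> :: "complex ^ 'n \<Rightarrow> real"
  assumes "(C, D, S) \<in> G_class"
    and "sharp_condition D"
    and "CARD('n) \<ge> 2"
    and "Cn_domain \<Omega>"
    and "C2_on \<Omega> \<phi>"
  shows "((\<forall>\<Omega>'. pseudoconvex_subdomain \<Omega>' \<Omega> \<longrightarrow> sharp_L2_division C D \<Omega>' \<phi>)
           \<longrightarrow> plurisubharmonic_on \<Omega> (\<lambda>z. exp (\<phi> z)) \<and>
               (\<forall>z\<in>\<Omega>. pos_semidef (levi_matrix \<phi> z + grad_matrix \<phi> z)) \<and>
               (\<forall>z\<in>\<Omega>. neg_eigenvalue_count (levi_matrix \<phi> z) \<le> 1)) \<and>
         ((\<forall>\<Omega>' \<psi>. pseudoconvex_subdomain \<Omega>' \<Omega> \<and> pluriharmonic_on \<Omega> \<psi>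
             \<longrightarrow> sharp_L2_division C D \<Omega>' (\<lambda>z. \<phi> z + \<psi> z))
           \<longrightarrow> plurisubharmonic_on \<Omega> \<phi>) \<and>
         ((\<forall>\<Omega>' \<epsilon>. pseudoconvex_subdomain \<Omega>' \<Omega> \<and> \<epsilon> > 0
             \<longrightarrow> sharp_L2_division C D \<Omega>' (\<lambda>z. \<epsilon> * \<phi> z))
           \<longrightarrow> plurisubharmonic_on \<Omega> \<phi>)"
proof -
  interpret weight_pair C D by (rule weight_pair_of_G_class[OF assms(1,2)])
  obtain u' u'' where u: "\<forall>z\<in>\<Omega>. (\<phi> has_derivative blinfun_apply (u' z)) (at z)"
    "\<forall>z\<in>\<Omega>. (u' has_derivative blinfun_apply (u'' z)) (at z)" "continuous_on \<Omega> u''"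
    using assms(5) unfolding C2_on_def by blast
  have tw: "twice_differentiable_Cn \<Omega> \<phi> u' u''"
    using assms(4) u unfolding Cn_domain_def by unfold_locales auto
  interpret twice_differentiable_Cn \<Omega> \<phi> u' u'' by (rule tw)
  have levi: "0 \<le> levi_form z v" if "\<forall>\<Omega>'. pseudoconvex_subdomain \<Omega>' \<Omega> \<longrightarrow> sharp_L2_division C D \<Omega>' \<phi>" "z \<in> \<Omega>" for z v
    using levi_form_nonneg[OF assms(3) tw _ that(2)] that(1) by blast
  have psh: "plurisubharmonic_on \<Omega> \<phi>" if "\<forall>\<Omega>'. pseudoconvex_subdomain \<Omega>' \<Omega> \<longrightarrow> sharp_L2_division C D \<Omega>' \<phi>"
    using levi[OF that] by (rule plurisubharmonic_of_levi_nonneg[OF u(3)])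
  have zero: "pluriharmonic_on \<Omega> (\<lambda>_. 0 :: real)"
  proof -
    have "C2_on \<Omega> (\<lambda>_. 0)"
      unfolding C2_on_def by (intro exI[of _ "\<lambda>_. 0"]) (auto simp: zero_blinfun.rep_eq)
    moreover have "frechet_derivative (\<lambda>_. 0 :: complex) (at z) = (\<lambda>_. 0)" for z :: "complex ^ 'n"
      by (rule frechet_derivative_at[symmetric]) simp
    then have "wirt_bar j (\<lambda>_. 0) = (\<lambda>_. 0)" "wirt j (\<lambda>_. 0) = (\<lambda>_. 0)" for j :: 'n
      by (simp_all add: wirt_bar_def wirt_def fun_eq_iff)
    then have "levi_matrix (\<lambda>_. 0) z = 0" for z :: "complex ^ 'n"
      by (simp add: levi_matrix_def vec_eq_iff)
    ultimately show ?thesis by (simp add: pluriharmonic_on_def)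
  qed
  show ?thesis
  proof (intro conjI impI)
    assume h: "\<forall>\<Omega>'. pseudoconvex_subdomain \<Omega>' \<Omega> \<longrightarrow> sharp_L2_division C D \<Omega>' \<phi>"
    show "plurisubharmonic_on \<Omega> (\<lambda>z. exp (\<phi> z))"
      by (rule plurisubharmonic_on_exp[OF continuous_on_dom(1) psh[OF h]])
    show "\<forall>z\<in>\<Omega>. pos_semidef (levi_matrix \<phi> z + grad_matrix \<phi> z)"
      using pos_semidef_levi_grad levi[OF h] by blast
    show "\<forall>z\<in>\<Omega>. neg_eigenvalue_count (levi_matrix \<phi> z) \<le> 1"
      using neg_eigenvalue_count_levi levi[OF h] by simp
  next
    assume h: "\<forall>\<Omega>' \<psi>. pseudoconvex_subdomain \<Omega>' \<Omega> \<and> pluriharmonic_on \<Omega> \<psi>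
      \<longrightarrow> sharp_L2_division C D \<Omega>' (\<lambda>z. \<phi> z + \<psi> z)"
    show "plurisubharmonic_on \<Omega> \<phi>"
    proof (rule psh, intro allI impI)
      fix \<Omega>' assume "pseudoconvex_subdomain \<Omega>' \<Omega>"
      then have "sharp_L2_division C D \<Omega>' (\<lambda>z. \<phi> z + 0)" using h zero by blast
      then show "sharp_L2_division C D \<Omega>' \<phi>" by simp
    qed
  next
    assume h: "\<forall>\<Omega>' \<epsilon>. pseudoconvex_subdomain \<Omega>' \<Omega> \<and> \<epsilon> > 0
      \<longrightarrow> sharp_L2_division C D \<Omega>' (\<lambda>z. \<epsilon> * \<phi> z)"
    show "plurisubharmonic_on \<Omega> \<phi>"
    proof (rule psh, intro allI impI)
      fix \<Omega>' assume "pseudoconvex_subdomain \<Omega>' \<Omega>"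
      then have "sharp_L2_division C D \<Omega>' (\<lambda>z. 1 * \<phi> z)" using h zero_less_one by blast
      then show "sharp_L2_division C D \<Omega>' \<phi>" by simp
    qed
  qed
qed

end
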